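(* Let $H$ be a real Hilbert space and let $A$ be a self-adjoint nonnegative operator on $H$ with dense domain (with $\{e_k\}$, $\lambda_k$, and the spaces $\mathcal{G}_{\varphi,r,\alpha}(A)$ and $\mathcal{GM}^{(\beta)}_{\varphi,\{\rho_n\},\alpha}(A)$ as described in the context). Let $\omega$ be a continuity modulus, let $m:[0,+\infty)\to[0,+\infty)$ be a function for which there exists a constant $L\in\mathbb{R}$ such that $$|m(a)-m(b)|\leq L\,\omega(|a-b|)\qquad\forall a\geq 0,\ \forall b\geq 0,$$ let $\varphi:[0,+\infty)\to(0,+\infty)$ be any function, and let $\{\rho_n\}\in\mathcal{L}$. Assume that one of the following two sets of hypotheses holds. (i) (Strictly hyperbolic case) There exists $\nu>0$ such that $m(\sigma)\geq\nu$ for every $\sigma\geq 0$; there exists a constant $\Lambda$ such that $$\sigma\,\omega\left(\frac{1}{\sigma}\right)\leq\Lambda\,\varphi(\sigma)\qquad\forall\sigma>0;$$ and $$(u_0,u_1)\in \mathcal{GM}^{(2)}_{\varphi,\{\rho_n\},3/4}(A)\times\mathcal{GM}^{(2)}_{\varphi,\{\rho_n\},1/4}(A).$$ (ii) (Weakly hyperbolic case) $m(\sigma)\geq 0$ for every $\sigma\geq 0$; there exists a constant $\Lambda$ such that $$\sigma\leq\Lambda\,\varphi\left(\frac{\sigma}{\sqrt{\omega(1/\sigma)}}\right)\qquad\forall\sigma>0;$$ and $$(u_0,u_1)\in \mathcal{GM}^{(3)}_{\varphi,\{\rho_n\},3/4}(A)\times\mathcal{GM}^{(3)}_{\varphi,\{\rho_n\},1/4}(A).$$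 Then the Cauchy problem $$u''(t)+m\big(|A^{1/2}u(t)|^2\big)Au(t)=0\quad (t\geq 0),\qquad u(0)=u_0,\quad u'(0)=u_1,$$ admits at least one global solution $u(t)$ such that $$u\in C^1\big([0,+\infty);\mathcal{G}_{\varphi,r,1/4}(A)\big)\cap C^0\big([0,+\infty);\mathcal{G}_{\varphi,r,3/4}(A)\big)$$ for every $r>0$.
   Context: Hilbert space setting. $H$ is a real Hilbert space with norm $|x|$ and scalar product $\langle x,y\rangle$. $A$ is an unbounded linear operator on $H$ with dense domain $D(A)$, self-adjoint and nonnegative, so that $A^\alpha$ is defined on $D(A^\alpha)$ for every $\alpha\geq 0$. It is assumed that $H$ admits a countable complete orthonormal system $\{e_k\}_{k\geq 1}$ made of eigenvectors of $A$, with $Ae_k=\lambda_k^2e_k$ and $\lambda_k\geq 0$. For $u\in H$ write $u_k=\langle u,e_k\rangle$, so $u=\sum_{k\ge1} u_ke_k$, and $D(A^\alpha)=\{u\in H:\sum_{k}\lambda_k^{4\alpha}u_k^2<+\infty\}$. Spaces. For $\varphi:[0,+\infty)\to(0,+\infty)$, $\alpha\geq 0$, $r>0$, set $$\|u\|_{\varphi,r,\alpha}^2:=\sum_{k=1}^\infty\lambda_k^{4\alpha}u_k^2\exp\big(r\varphi(\lambda_k)\big),\qquad \mathcal{G}_{\varphi,r,\alpha}(A):=\{u\in H:\|u\|_{\varphi,r,\alpha}^2<+\infty\},$$ a Hilbert space with norm $(|u|^2+\|u\|_{\varphi,r,\alpha}^2)^{1/2}$. Let $\mathcal{L}$ be the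 set of all sequences $\{\rho_n\}_{n\in\mathbb{N}}$ of positive real numbers with $\rho_n\to+\infty$. For $\{\rho_n\}\in\mathcal{L}$, $\alpha\geq 0$, $\beta\geq 0$, set $$\mathcal{GM}^{(\beta)}_{\varphi,\{\rho_n\},\alpha}(A):=\Big\{u\in H:\sum_{\lambda_k>\rho_n}\lambda_k^{4\alpha}u_k^2\exp\big(\rho_n^\beta\varphi(\lambda_k)\big)\leq\rho_n\quad\forall n\in\mathbb{N}\Big\},$$ where the sum is over all indices $k$ with $\lambda_k>\rho_n$. Continuity modulus. A continuity modulus is a continuous increasing function $\omega:[0,+\infty)\to[0,+\infty)$ such that $\omega(0)=0$ (with $\omega(x)>0$ for $x>0$) and $\omega(a+b)\leq\omega(a)+\omega(b)$ for all $a,b\geq 0$. Solutions. The equation is understood componentwise: each Fourier component $u_k(t)=\langle u(t),e_k\rangle$ is of class $C^2$ and satisfies $u_k''(t)+m(|A^{1/2}u(t)|^2)\lambda_k^2u_k(t)=0$. A global solution is one defined for all $t\in[0,+\infty)$.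
   Formalization: It is additionally assumed that for all r>0 and R the sums of λ_k u_k² exp(rφ(λ_k)) over λ_k≤R converge for u_0 and u_1; the claim fails without this when frequencies accumulate where φ is unbounded, and its conclusion implies it. *)

theory Defs
  imports "HOL-Analysis.Analysis"
begin

(* An unbounded operator on H is a function A together with its domain D; the values of A
   outside D are irrelevant. *)

definition linear_operator_on :: "'h::real_inner set \<Rightarrow> ('h \<Rightarrow> 'h) \<Rightarrow> bool" where
  "linear_operator_on D A \<longleftrightarrow> subspace D \<and>
     (\<forall>x\<in>D. \<forall>y\<in>D. A (x + y) = A x + A y) \<and>
     (\<forall>c. \<forall>x\<in>D. A (c *\<^sub>R x) = c *\<^sub>R A x)"

(* (v, w) is in the graph iff v belongs to the domain of the adjoint of A and the adjoint
   maps v to w; w is unique when D is dense. *)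
definition adjoint_graph :: "'h::real_inner set \<Rightarrow> ('h \<Rightarrow> 'h) \<Rightarrow> ('h \<times> 'h) set" where
  "adjoint_graph D A = {(v, w). \<forall>x\<in>D. A x \<bullet> v = x \<bullet> w}"

definition self_adjoint_operator :: "'h::real_inner set \<Rightarrow> ('h \<Rightarrow> 'h) \<Rightarrow> bool" where
  "self_adjoint_operator D A \<longleftrightarrow> linear_operator_on D A \<and> closure D = UNIV \<and>
     adjoint_graph D A = {(v, A v) | v. v \<in> D}"

definition nonnegative_operator :: "'h::real_inner set \<Rightarrow> ('h \<Rightarrow> 'h) \<Rightarrow> bool" where
  "nonnegative_operator D A \<longleftrightarrow> (\<forall>x\<in>D. 0 \<le> A x \<bullet> x)"

(* The orthonormal system is indexed from 0 instead of 1. The eigenvalue of e k is the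
   square of lam k. *)
definition eigenbasis ::
  "'h::real_inner set \<Rightarrow> ('h \<Rightarrow> 'h) \<Rightarrow> (nat \<Rightarrow> 'h) \<Rightarrow> (nat \<Rightarrow> real) \<Rightarrow> bool" where
  "eigenbasis D A e lam \<longleftrightarrow>
     (\<forall>j k. e j \<bullet> e k = (if j = k then 1 else 0)) \<and>
     closure (span (range e)) = UNIV \<and>
     (\<forall>k. 0 \<le> lam k \<and> e k \<in> D \<and> A (e k) = (lam k)\<^sup>2 *\<^sub>R e k)"

(* powr has 0 powr 0 = 0; here 0 to the power 0 is 1, so that the power 0 of A is the
   identity even if A has a kernel. *)
definition rpow :: "real \<Rightarrow> real \<Rightarrow> real" where
  "rpow x a = (if a = 0 then 1 else x powr a)"

definition dom_pow :: "(nat \<Rightarrow> 'h::real_inner) \<Rightarrow> (nat \<Rightarrow> real) \<Rightarrow> real \<Rightarrow> 'h set" where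
  "dom_pow e lam \<alpha> = {u. summable (\<lambda>k. rpow (lam k) (4 * \<alpha>) * (u \<bullet> e k)\<^sup>2)}"

(* The eigenvalues of A being squares, those of its power with exponent \<alpha> are
   rpow (lam k) (2 * \<alpha>). *)
definition op_pow ::
  "(nat \<Rightarrow> 'h::real_inner) \<Rightarrow> (nat \<Rightarrow> real) \<Rightarrow> real \<Rightarrow> 'h \<Rightarrow> 'h" where
  "op_pow e lam \<alpha> u = (\<Sum>k. (rpow (lam k) (2 * \<alpha>) * (u \<bullet> e k)) *\<^sub>R e k)"

definition gevrey_term ::
  "(nat \<Rightarrow> 'h::real_inner) \<Rightarrow> (nat \<Rightarrow> real) \<Rightarrow> (real \<Rightarrow> real) \<Rightarrow> real \<Rightarrow> real \<Rightarrow> 'h \<Rightarrow> nat \<Rightarrow> real"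
where
  "gevrey_term e lam \<phi> r \<alpha> u k =
     rpow (lam k) (4 * \<alpha>) * (u \<bullet> e k)\<^sup>2 * exp (r * \<phi> (lam k))"

definition gevrey ::
  "(nat \<Rightarrow> 'h::real_inner) \<Rightarrow> (nat \<Rightarrow> real) \<Rightarrow> (real \<Rightarrow> real) \<Rightarrow> real \<Rightarrow> real \<Rightarrow> 'h set" where
  "gevrey e lam \<phi> r \<alpha> = {u. summable (gevrey_term e lam \<phi> r \<alpha> u)}"

(* Meaningful only on the space gevrey e lam \<phi> r \<alpha>: suminf has no meaning for a divergent
   series. Below the norm is applied to elements of that space only. *)
definition gevrey_norm ::
  "(nat \<Rightarrow> 'h::real_inner) \<Rightarrow> (nat \<Rightarrow> real) \<Rightarrow> (real \<Rightarrow> real) \<Rightarrow> real \<Rightarrow> real \<Rightarrow> 'h \<Rightarrow> real" where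
  "gevrey_norm e lam \<phi> r \<alpha> u = sqrt ((norm u)\<^sup>2 + (\<Sum>k. gevrey_term e lam \<phi> r \<alpha> u k))"

definition divergent_seqs :: "(nat \<Rightarrow> real) set" where
  "divergent_seqs = {\<rho>. (\<forall>n. 0 < \<rho> n) \<and> filterlim \<rho> at_top sequentially}"

definition gevrey_M ::
  "(nat \<Rightarrow> 'h::real_inner) \<Rightarrow> (nat \<Rightarrow> real) \<Rightarrow> real \<Rightarrow> (real \<Rightarrow> real) \<Rightarrow> (nat \<Rightarrow> real) \<Rightarrow> real \<Rightarrow> 'h set"
where
  "gevrey_M e lam \<beta> \<phi> \<rho> \<alpha> = {u. \<forall>n.
     gevrey_term e lam \<phi> (rpow (\<rho> n) \<beta>) \<alpha> u summable_on {k. lam k > \<rho> n} \<and>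
     (\<Sum>\<^sub>\<infinity>k\<in>{k. lam k > \<rho> n}. gevrey_term e lam \<phi> (rpow (\<rho> n) \<beta>) \<alpha> u k) \<le> \<rho> n}"

(* The sums defining gevrey_M involve only frequencies above some \<rho> n. If infinitely many
   frequencies lie in a bounded set on which \<phi> is unbounded, they do not control the Gevrey
   terms of the remaining components, and gevrey_M is not contained in the Gevrey spaces.
   Example: lam k = 1 + 1 / (k + 1), \<phi> (lam k) = k + 1, \<rho> n = n + 3, where gevrey_M is the
   whole of H. The condition below concerns those components only. It is automatic if only
   finitely many frequencies lie in each bounded set, or if \<phi> is bounded on bounded sets of
   frequencies, and the regularity of u in the theorem implies it for the initial data: this
   is what the lemmas after the definition of a solution say. *)
definition low_frequency_regular ::
  "(nat \<Rightarrow> 'h::real_inner) \<Rightarrow> (nat \<Rightarrow> real) \<Rightarrow> (real \<Rightarrow> real) \<Rightarrow> 'h \<Rightarrow> bool" where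
  "low_frequency_regular e lam \<phi> u \<longleftrightarrow>
     (\<forall>r>0. \<forall>R. gevrey_term e lam \<phi> r (1/4) u summable_on {k. lam k \<le> R})"

(* "Increasing" is read in the weak sense. *)
definition continuity_modulus :: "(real \<Rightarrow> real) \<Rightarrow> bool" where
  "continuity_modulus \<omega> \<longleftrightarrow> continuous_on {0..} \<omega> \<and> mono_on {0..} \<omega> \<and>
     \<omega> 0 = 0 \<and> (\<forall>x>0. 0 < \<omega> x) \<and>
     (\<forall>a\<ge>0. \<forall>b\<ge>0. \<omega> (a + b) \<le> \<omega> a + \<omega> b)"

definition C0_gevrey ::
  "(nat \<Rightarrow> 'h::real_inner) \<Rightarrow> (nat \<Rightarrow> real) \<Rightarrow> (real \<Rightarrow> real) \<Rightarrow> real \<Rightarrow> real \<Rightarrow> (real \<Rightarrow> 'h) set" where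
  "C0_gevrey e lam \<phi> r \<alpha> = {u. \<forall>t\<ge>0. u t \<in> gevrey e lam \<phi> r \<alpha> \<and>
     ((\<lambda>s. gevrey_norm e lam \<phi> r \<alpha> (u s - u t)) \<longlongrightarrow> 0) (at t within {0..})}"

(* v is the derivative of u in the norm of the space, one-sided at t = 0. *)
definition C1_gevrey ::
  "(nat \<Rightarrow> 'h::real_inner) \<Rightarrow> (nat \<Rightarrow> real) \<Rightarrow> (real \<Rightarrow> real) \<Rightarrow> real \<Rightarrow> real \<Rightarrow> (real \<Rightarrow> 'h) set" where
  "C1_gevrey e lam \<phi> r \<alpha> = {u. (\<forall>t\<ge>0. u t \<in> gevrey e lam \<phi> r \<alpha>) \<and>
     (\<exists>v \<in> C0_gevrey e lam \<phi> r \<alpha>. \<forall>t\<ge>0.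
        ((\<lambda>s. gevrey_norm e lam \<phi> r \<alpha> ((u s - u t) /\<^sub>R (s - t) - v t)) \<longlongrightarrow> 0)
          (at t within {0..}))}"

(* The function t \<mapsto> u t \<bullet> e k is C2 on the closed half-line, with first derivative v and
   second derivative w. Values of u at negative times are irrelevant. *)
definition kirchhoff_global_solution ::
  "(nat \<Rightarrow> 'h::real_inner) \<Rightarrow> (nat \<Rightarrow> real) \<Rightarrow> (real \<Rightarrow> real) \<Rightarrow> 'h \<Rightarrow> 'h \<Rightarrow> (real \<Rightarrow> 'h) \<Rightarrow> bool" where
  "kirchhoff_global_solution e lam m u0 u1 u \<longleftrightarrow>
     (\<forall>t\<ge>0. u t \<in> dom_pow e lam (1/2)) \<and>
     (\<forall>k. \<exists>v w.
        (\<forall>t\<ge>0. ((\<lambda>s. u s \<bullet> e k) has_real_derivative v t) (at t within {0..})) \<and>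
        (\<forall>t\<ge>0. (v has_real_derivative w t) (at t within {0..})) \<and>
        continuous_on {0..} w \<and>
        (\<forall>t\<ge>0. w t + m ((norm (op_pow e lam (1/2) (u t)))\<^sup>2) * (lam k)\<^sup>2 * (u t \<bullet> e k) = 0)) \<and>
     u 0 = u0 \<and>
     (u has_vector_derivative u1) (at 0 within {0..})"

lemma low_frequency_regular_if_finite:
  assumes "\<And>R. finite {k. lam k \<le> R}"
  shows "low_frequency_regular e lam \<phi> u"
  using assms by (simp add: low_frequency_regular_def)

lemma bessel_summable:
  fixes e :: "nat \<Rightarrow> 'h::real_inner"
  assumes on: "\<And>j k. e j \<bullet> e k = (if j = k then 1 else 0)"
  shows "summable (\<lambda>k. (u \<bullet> e k)\<^sup>2)"
proof (rule summableI_nonneg_bounded)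
  fix n
  define p where "p = (\<Sum>k<n. (u \<bullet> e k) *\<^sub>R e k)"
  have up: "u \<bullet> p = (\<Sum>k<n. (u \<bullet> e k)\<^sup>2)"
    by (simp add: p_def inner_sum_right power2_eq_square)
  have pe: "p \<bullet> e k = (if k < n then u \<bullet> e k else 0)" for k
    by (simp add: p_def inner_sum_left on if_distrib[of "\<lambda>x. _ * x"] cong: if_cong)
  have pp: "p \<bullet> p = (\<Sum>k<n. (u \<bullet> e k)\<^sup>2)"
    by (subst (2) p_def) (simp add: inner_sum_right pe power2_eq_square)
  have "0 \<le> (u - p) \<bullet> (u - p)" by simp
  also have "\<dots> = u \<bullet> u - (\<Sum>k<n. (u \<bullet> e k)\<^sup>2)"
    by (simp add: inner_diff_left inner_diff_right up pp inner_commute[of p u])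
  finally show "(\<Sum>k<n. (u \<bullet> e k)\<^sup>2) \<le> u \<bullet> u" by simp
qed simp

lemma low_frequency_regular_if_bounded:
  fixes e :: "nat \<Rightarrow> 'h::real_inner"
  assumes eb: "eigenbasis D A e lam"
    and bd: "\<And>R. bdd_above (\<phi> ` {lam k | k. lam k \<le> R})"
  shows "low_frequency_regular e lam \<phi> u"
  unfolding low_frequency_regular_def
proof (intro allI impI)
  fix r R :: real assume r: "r > 0"
  obtain B where B: "\<And>k. lam k \<le> R \<Longrightarrow> \<phi> (lam k) \<le> B"
    using bd[of R] unfolding bdd_above_def by blast
  have lam: "lam k \<ge> 0" for k using eb by (simp add: eigenbasis_def)
  have "summable (\<lambda>k. (u \<bullet> e k)\<^sup>2)"
    using eb by (intro bessel_summable) (simp add: eigenbasis_def)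
  then have "summable (\<lambda>k. R * exp (r * B) * (u \<bullet> e k)\<^sup>2)" by (rule summable_mult)
  then have s: "(\<lambda>k. \<bar>R * exp (r * B)\<bar> * (u \<bullet> e k)\<^sup>2) summable_on {k. lam k \<le> R}"
    using \<open>summable (\<lambda>k. (u \<bullet> e k)\<^sup>2)\<close>
    by (intro summable_on_subset_banach[OF summable_nonneg_imp_summable_on])
       (auto intro: summable_mult)
  show "gevrey_term e lam \<phi> r (1/4) u summable_on {k. lam k \<le> R}"
  proof (rule summable_on_comparison_test[OF s])
    fix k assume k: "k \<in> {k. lam k \<le> R}"
    have "lam k * exp (r * \<phi> (lam k)) \<le> R * exp (r * B)"
      using k B[of k] r lam[of k] by (intro mult_mono) auto
    then have "lam k * exp (r * \<phi> (lam k)) \<le> \<bar>R * exp (r * B)\<bar>" by linarith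
    then have "lam k * exp (r * \<phi> (lam k)) * (u \<bullet> e k)\<^sup>2 \<le> \<bar>R * exp (r * B)\<bar> * (u \<bullet> e k)\<^sup>2"
      by (rule mult_right_mono) simp
    then show "gevrey_term e lam \<phi> r (1/4) u k \<le> \<bar>R * exp (r * B)\<bar> * (u \<bullet> e k)\<^sup>2"
      using lam[of k] by (simp add: gevrey_term_def rpow_def mult_ac)
  next
    fix k show "0 \<le> gevrey_term e lam \<phi> r (1/4) u k"
      using lam[of k] by (simp add: gevrey_term_def rpow_def)
  qed
qed

lemma gevrey_term_nonneg: "0 \<le> gevrey_term e lam \<phi> r \<alpha> u k"
  by (simp add: gevrey_term_def rpow_def)

lemma low_frequency_regular_if_gevrey:
  assumes "\<And>r. r > 0 \<Longrightarrow> u \<in> gevrey e lam \<phi> r (1/4)"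
  shows "low_frequency_regular e lam \<phi> u"
  using assms unfolding low_frequency_regular_def gevrey_def
  by (auto intro!: summable_on_subset_banach[OF summable_nonneg_imp_summable_on]
      simp: gevrey_term_nonneg)

lemma gevrey_add:
  assumes "u \<in> gevrey e lam \<phi> r \<alpha>" "v \<in> gevrey e lam \<phi> r \<alpha>"
  shows "u + v \<in> gevrey e lam \<phi> r \<alpha>"
proof -
  have "summable (\<lambda>k. 2 * gevrey_term e lam \<phi> r \<alpha> u k + 2 * gevrey_term e lam \<phi> r \<alpha> v k)"
    using assms by (auto simp: gevrey_def intro!: summable_add summable_mult)
  moreover have "gevrey_term e lam \<phi> r \<alpha> (u + v) k
      \<le> 2 * gevrey_term e lam \<phi> r \<alpha> u k + 2 * gevrey_term e lam \<phi> r \<alpha> v k" for k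
  proof -
    have "((u + v) \<bullet> e k)\<^sup>2 \<le> 2 * (u \<bullet> e k)\<^sup>2 + 2 * (v \<bullet> e k)\<^sup>2"
      using zero_le_power2[of "u \<bullet> e k - v \<bullet> e k"]
      by (simp add: inner_add_left power2_eq_square algebra_simps)
    then have "rpow (lam k) (4 * \<alpha>) * exp (r * \<phi> (lam k)) * ((u + v) \<bullet> e k)\<^sup>2
       \<le> rpow (lam k) (4 * \<alpha>) * exp (r * \<phi> (lam k)) * (2 * (u \<bullet> e k)\<^sup>2 + 2 * (v \<bullet> e k)\<^sup>2)"
      by (rule mult_left_mono) (simp add: rpow_def)
    then show ?thesis by (simp add: gevrey_term_def algebra_simps)
  qed
  ultimately have "summable (gevrey_term e lam \<phi> r \<alpha> (u + v))"
    by (intro summable_comparison_test[where f = "gevrey_term e lam \<phi> r \<alpha> (u + v)"])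
       (auto simp: gevrey_term_nonneg)
  then show ?thesis by (simp add: gevrey_def)
qed

lemma gevrey_scaleR:
  assumes "u \<in> gevrey e lam \<phi> r \<alpha>"
  shows "c *\<^sub>R u \<in> gevrey e lam \<phi> r \<alpha>"
proof -
  have "gevrey_term e lam \<phi> r \<alpha> (c *\<^sub>R u) = (\<lambda>k. c\<^sup>2 * gevrey_term e lam \<phi> r \<alpha> u k)"
    by (auto simp: gevrey_term_def power_mult_distrib)
  then show ?thesis using assms by (simp add: gevrey_def summable_mult)
qed

lemma gevrey_diff:
  assumes "u \<in> gevrey e lam \<phi> r \<alpha>" "v \<in> gevrey e lam \<phi> r \<alpha>"
  shows "u - v \<in> gevrey e lam \<phi> r \<alpha>"
  using gevrey_add[OF assms(1) gevrey_scaleR[OF assms(2), of "-1"]] by simp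

lemma norm_le_gevrey_norm:
  assumes "u \<in> gevrey e lam \<phi> r \<alpha>"
  shows "norm u \<le> gevrey_norm e lam \<phi> r \<alpha> u"
  unfolding gevrey_norm_def
  using assms by (intro real_le_rsqrt) (simp add: gevrey_def suminf_nonneg gevrey_term_nonneg)

lemma low_frequency_regular_necessary:
  fixes u :: "real \<Rightarrow> 'h::real_inner"
  assumes sol: "kirchhoff_global_solution e lam m u0 u1 u"
    and C1: "\<And>r. r > 0 \<Longrightarrow> u \<in> C1_gevrey e lam \<phi> r (1/4)"
  shows "low_frequency_regular e lam \<phi> u0" and "low_frequency_regular e lam \<phi> u1"
proof -
  have "u0 \<in> gevrey e lam \<phi> r (1/4) \<and> u1 \<in> gevrey e lam \<phi> r (1/4)" if r: "r > 0" for r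
  proof -
    let ?G = "gevrey e lam \<phi> r (1/4)"
    let ?N = "gevrey_norm e lam \<phi> r (1/4)"
    obtain v where u: "\<forall>t\<ge>0. u t \<in> ?G" and v: "v \<in> C0_gevrey e lam \<phi> r (1/4)"
      and lim: "((\<lambda>s. ?N ((u s - u 0) /\<^sub>R (s - 0) - v 0)) \<longlongrightarrow> 0) (at 0 within {0..})"
      using C1[OF r] unfolding C1_gevrey_def by auto
    have v0: "v 0 \<in> ?G" using v by (simp add: C0_gevrey_def)
    have ev: "\<forall>\<^sub>F s in at 0 within {0..}. norm ((u s - u 0) /\<^sub>R (s - 0) - v 0)
        \<le> ?N ((u s - u 0) /\<^sub>R (s - 0) - v 0)"
      unfolding eventually_at_filter
      using u v0 by (auto intro!: always_eventually norm_le_gevrey_norm gevrey_diff gevrey_scaleR)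
    have "((\<lambda>s. (u s - u 0) /\<^sub>R (s - 0) - v 0) \<longlongrightarrow> 0) (at 0 within {0..})"
      by (rule Lim_null_comparison[OF ev lim])
    then have "((\<lambda>s. (u s - u 0) /\<^sub>R (s - 0)) \<longlongrightarrow> v 0) (at 0 within {0..})"
      by (simp add: LIM_zero_iff)
    moreover have "((\<lambda>s. (u s - u 0) /\<^sub>R (s - 0)) \<longlongrightarrow> u1) (at 0 within {0..})"
    proof -
      have d: "(u has_vector_derivative u1) (at 0 within {0..})"
        using sol by (simp add: kirchhoff_global_solution_def)
      have lim1: "((\<lambda>s. norm (u s - (u 0 + (s - 0) *\<^sub>R u1)) / norm (s - 0)) \<longlongrightarrow> 0)
          (at 0 within {0..})"
        using d unfolding has_vector_derivative_def has_derivative_iff_norm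
        by (simp add: algebra_simps)
      have ev1: "\<forall>\<^sub>F s in at 0 within {0..}. norm ((u s - u 0) /\<^sub>R (s - 0) - u1)
          \<le> norm (u s - (u 0 + (s - 0) *\<^sub>R u1)) / norm (s - 0)"
        unfolding eventually_at_filter
      proof (intro always_eventually allI impI)
        fix s :: real assume s: "s \<noteq> 0" 
        have "(u s - u 0) /\<^sub>R (s - 0) - u1 = (u s - (u 0 + (s - 0) *\<^sub>R u1)) /\<^sub>R (s - 0)"
          using s by (simp add: scaleR_diff_right algebra_simps)
        then show "norm ((u s - u 0) /\<^sub>R (s - 0) - u1)
          \<le> norm (u s - (u 0 + (s - 0) *\<^sub>R u1)) / norm (s - 0)"
          by (simp add: divide_inverse mult.commute)
      qed
      have "((\<lambda>s. (u s - u 0) /\<^sub>R (s - 0) - u1) \<longlongrightarrow> 0) (at 0 within {0..})"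
        by (rule Lim_null_comparison[OF ev1 lim1])
      then show ?thesis by (simp add: LIM_zero_iff)
    qed
    moreover have "at (0::real) within {0..} \<noteq> bot"
      using trivial_limit_at_right_real[of "0::real"]
      by (metis at_within_Ici_at_right)
    ultimately have "v 0 = u1" using tendsto_unique by blast
    moreover have "u 0 = u0" using sol by (simp add: kirchhoff_global_solution_def)
    ultimately show ?thesis using u v0 by auto
  qed
  then show "low_frequency_regular e lam \<phi> u0" and "low_frequency_regular e lam \<phi> u1"
    by (auto intro: low_frequency_regular_if_gevrey)
qed

end

theory Submission
  imports Defs "HOL-Complex_Analysis.Great_Picard" "HOL-Library.Diagonal_Subsequence"
begin

text \<open>
  Write \<open>s(t)\<close> for the squared norm of \<open>A\<^sup>1\<^sup>/\<^sup>2 u(t)\<close>. If \<open>s\<close> is \<open>B\<close>-Lipschitz on \<open>[0, T]\<close>, then the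
  coefficient \<open>m(s(t))\<close> has continuity modulus \<open>L (1 + B) \<omega>\<close>, and the energy method for linear
  equations with such coefficients bounds the growth of the component of frequency \<open>\<lambda>\<close> by
  \<open>exp (K (1 + B) \<phi>(\<lambda>))\<close>. Conversely, \<open>s'\<close> is controlled as follows: the Hamiltonian makes the
  contribution of the frequencies up to \<open>\<rho>\<^sub>n\<close> at most a multiple of \<open>\<rho>\<^sub>n\<^sup>p\<close>, with \<open>p = 1\<close> in the
  strictly hyperbolic case and \<open>p = 2\<close> in the weakly hyperbolic case, while the data are such that
  the higher frequencies contribute at most a multiple of \<open>\<rho>\<^sub>n\<close> as long as
  \<open>K (1 + B) \<le> \<rho>\<^sub>n\<^sup>p\<^sup>+\<^sup>1\<close>. Taking \<open>B\<close> to be a multiple of \<open>\<rho>\<^sub>n\<^sup>p\<close> with \<open>n\<close> large closes the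
  estimate on any interval \<open>[0, T]\<close>. These bounds are uniform over the Galerkin approximations in
  which \<open>m\<close> is replaced by a Lipschitz average, so the functions \<open>s\<close> converge along a subsequence,
  and every other passage to the limit concerns a linear equation for a single component.
\<close>


section \<open>Ordinary differential equations\<close>

text \<open>The obstacle is a circle: the loss of regularity at frequency \<open>l\<close> is
  exponential in \<open>(1 + B) * \<phi> l\<close>, where \<open>B\<close> is a Lipschitz constant
  of the very solution under study, so no fixed exponent can be prescribed in advance. The data
  break the circle because their exponent is tied to the cut-off: with \<open>B\<close> of order
  \<open>\<rho> n ^ p\<close> the loss is a constant times \<open>\<rho> n ^ p\<close>, and the
  extra power in \<open>\<rho> n ^ (p + 1)\<close> beats that constant once \<open>\<rho> n\<close>
  is large. One suitable \<open>n\<close> is enough for each interval [0, T], so gaps between the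
  \<open>\<rho> n\<close> are harmless; the constants depend on T, and so does \<open>n\<close>. A
  modulus of continuity does not make \<open>m\<close> Lipschitz, so Picard's theorem does not apply
  to the Galerkin systems as they stand; averaging \<open>m\<close> forward repairs this without
  changing \<open>\<omega>\<close>, \<open>L\<close> or the lower bound. Compactness is needed for
  the scalar function \<open>s\<close> only. The modes of the limit are defined as solutions of
  linear equations with coefficient \<open>m (s t)\<close>; that \<open>s\<close> is the squared
  norm built from these modes is proved afterwards, by dominated convergence.\<close>

lemma at_within_Icc_Ici:
  fixes t T :: real
  assumes "0 \<le> t" "t < T"
  shows "at t within {0..T} = at t within {0..}"
  by (rule at_within_nhd[of t "{..<T}"]) (use assms in auto)

lemma has_real_derivative_integral_Ici:
  fixes g :: "real \<Rightarrow> real"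
  assumes "continuous_on {0..} g" "0 \<le> t"
  shows "((\<lambda>x. integral {0..x} g) has_real_derivative g t) (at t within {0..})"
proof -
  have "((\<lambda>x. integral {0..x} g) has_real_derivative g t) (at t within {0..t+1})"
    using assms by (intro integral_has_real_derivative) (auto intro: continuous_on_subset)
  then show ?thesis using assms at_within_Icc_Ici[of t "t+1"] by simp
qed

text \<open>The function \<open>E t * exp (- a * t) - b * t\<close> is nonincreasing, because
  \<open>b * exp (- a * s)\<close> is at most \<open>b\<close>. The result is slightly weaker than
  the sharp form, but it covers \<open>a = 0\<close> without a case distinction.\<close>

lemma gronwall:
  fixes E E' :: "real \<Rightarrow> real"
  assumes der: "\<And>t. t \<in> {0..T} \<Longrightarrow> (E has_real_derivative E' t) (at t within {0..T})"
    and le: "\<And>t. t \<in> {0..T} \<Longrightarrow> E' t \<le> a * E t + b"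
    and a: "0 \<le> a" and b: "0 \<le> b" and t: "t \<in> {0..T}"
  shows "E t \<le> (E 0 + b * t) * exp (a * t)"
proof -
  let ?G = "\<lambda>t. E t * exp (- a * t) - b * t"
  have d: "(?G has_real_derivative (E' s - a * E s) * exp (- a * s) - b) (at s within {0..T})"
    if "s \<in> {0..T}" for s
    using der[OF that] by (auto intro!: derivative_eq_intros simp: algebra_simps)
  have "?G t \<le> ?G 0"
  proof (rule DERIV_nonpos_imp_decreasing_open[where f = ?G])
    show "0 \<le> t" using t by simp
    show "continuous_on {0..t} ?G"
      using d t by (intro continuous_on_subset[OF DERIV_continuous_on[of "{0..T}"]]) auto
    fix s assume s: "0 < s" "s < t"
    have "at s within {0..T} = at s" using s t by (intro at_within_interior) auto
    moreover have "(E' s - a * E s) * exp (- a * s) - b \<le> 0"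
    proof -
      have "(E' s - a * E s) * exp (- a * s) \<le> b * exp (- a * s)"
        using le[of s] s t by (intro mult_right_mono) auto
      also have "\<dots> \<le> b * 1" using s a b by (intro mult_left_mono) auto
      finally show ?thesis by simp
    qed
    ultimately show "\<exists>y. (?G has_real_derivative y) (at s) \<and> y \<le> 0"
      using d[of s] s t by auto
  qed
  then have "E t * exp (- a * t) * exp (a * t) \<le> (E 0 + b * t) * exp (a * t)"
    by (intro mult_right_mono) auto
  then show ?thesis by (simp add: mult.assoc flip: exp_add)
qed

text \<open>The Picard operator is a contraction of the space of bounded continuous functions of time
  and index once the unknown is divided by \<open>exp (2 * N * (N + 1) * \<integral>K)\<close>; with this weight
  a Lipschitz constant which is unbounded in time does no harm. The index is interpolated to a
  real variable because completeness of the space is only available over metric spaces.\<close>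

theorem picard_global:
  fixes F :: "real \<Rightarrow> (nat \<Rightarrow> real) \<Rightarrow> nat \<Rightarrow> real" and K :: "real \<Rightarrow> real" and N :: nat
  assumes contK: "continuous_on {0..} K" and K0: "\<And>t. 0 \<le> t \<Longrightarrow> 0 \<le> K t"
    and lip: "\<And>t x y i. 0 \<le> t \<Longrightarrow> i < N \<Longrightarrow> \<bar>F t x i - F t y i\<bar> \<le> K t * (\<Sum>j<N. \<bar>x j - y j\<bar>)"
    and zero: "\<And>t i. 0 \<le> t \<Longrightarrow> i < N \<Longrightarrow> F t (\<lambda>_. 0) i = 0"
    and cont: "\<And>x i. i < N \<Longrightarrow> (\<And>j. continuous_on {0..} (x j)) \<Longrightarrow>
                 continuous_on {0..} (\<lambda>t. F t (\<lambda>j. x j t) i)"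
  shows "\<exists>x. \<forall>i<N. x i 0 = x0 i \<and>
           (\<forall>t\<ge>0. (x i has_real_derivative F t (\<lambda>j. x j t) i) (at t within {0..}))"
proof -
  \<comment> \<open>Each of the \<open>N\<close> terms of the Lipschitz sum gives one factor, so a
    component of the Picard operator contracts by 1 / (2 (N + 1)); summing over the \<open>N\<close>
    components leaves at most 1/2. Using \<open>N + 1\<close> instead of \<open>N\<close> avoids a
    division by zero.\<close>
  define w where "w t = 2 * real N * real (N + 1) * K t" for t
  define W where "W t = integral {0..t} w" for t
  have w0: "0 \<le> w t" if "0 \<le> t" for t using K0[OF that] by (simp add: w_def)
  have cw: "continuous_on {0..} w" unfolding w_def by (intro continuous_intros contK)
  have W': "(W has_real_derivative w t) (at t within {0..})" if "0 \<le> t" for t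
    unfolding W_def by (rule has_real_derivative_integral_Ici[OF cw that])
  have cW: "continuous_on {0..} W" using W' by (intro DERIV_continuous_on) auto
  have WW: "W 0 = 0" by (simp add: W_def)
  have W0: "0 \<le> W t" if "0 \<le> t" for t
    unfolding W_def using w0 cw
    by (intro integral_nonneg integrable_continuous_real) (auto intro: continuous_on_subset)
  have int: "((\<lambda>s. w s * exp (W s)) has_integral exp (W t) - 1) {0..t}" if "0 \<le> t" for t
  proof -
    have "((\<lambda>s. w s * exp (W s)) has_integral exp (W t) - exp (W 0)) {0..t}"
    proof (rule fundamental_theorem_of_calculus[OF that])
      fix s assume "s \<in> {0..t}"
      then have "(W has_real_derivative w s) (at s within {0..t})"
        using W'[of s] by (auto intro: DERIV_subset)
      then show "((\<lambda>s. exp (W s)) has_vector_derivative w s * exp (W s)) (at s within {0..t})"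
        unfolding has_real_derivative_iff_has_vector_derivative[symmetric]
        by (auto intro!: derivative_eq_intros)
    qed
    then show ?thesis by (simp add: WW)
  qed
  \<comment> \<open>\<open>w * exp W\<close> is the derivative of \<open>exp W\<close>: integrating
    the weighted bound reproduces the weight, and dividing by it leaves \<open>C / 2\<close>,
    however large \<open>t\<close> is.\<close>
  have key: "exp (- W t) * \<bar>integral {0..t} f\<bar> \<le> C / 2"
    if t: "0 \<le> t" and f: "continuous_on {0..t} f" and C: "0 \<le> C"
      and le: "\<And>s. s \<in> {0..t} \<Longrightarrow> \<bar>f s\<bar> \<le> C / 2 * (w s * exp (W s))" for t C f
  proof -
    have i: "((\<lambda>s. C / 2 * (w s * exp (W s))) has_integral C / 2 * (exp (W t) - 1)) {0..t}"
      by (intro has_integral_mult_right int t)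
    have "\<bar>integral {0..t} f\<bar> \<le> integral {0..t} (\<lambda>s. C / 2 * (w s * exp (W s)))"
      using f le i has_integral_integrable[OF i]
      integral_norm_bound_integral[of f "{0..t}" "\<lambda>s. C / 2 * (w s * exp (W s))"]
      by (auto intro: integrable_continuous_real)
    also have "\<dots> = C / 2 * (exp (W t) - 1)" using i by (rule integral_unique)
    also have "\<dots> \<le> C / 2 * exp (W t)" using C by (intro mult_left_mono) auto
    finally have "exp (- W t) * \<bar>integral {0..t} f\<bar> \<le> exp (- W t) * (C / 2 * exp (W t))"
      by (intro mult_left_mono) auto
    then show ?thesis by (simp add: exp_minus field_simps)
  qed
  \<comment> \<open>Hat function centred at \<open>i\<close>. By \<open>bij\<close>, evaluating
    \<open>\<Phi> z\<close> at the abscissa \<open>i < N\<close> returns exactly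
    \<open>\<Psi> z i\<close>; values in [0, 1] keep the bounds.\<close>
  define b where "b i r = max 0 (1 - \<bar>r - real i\<bar>)" for i :: nat and r :: real
  have b: "0 \<le> b i r" "b i r \<le> 1" for i r by (auto simp: b_def)
  have bij: "b i (real j) = (if i = j then 1 else 0)" for i j by (auto simp: b_def)
  define X where "X z j s = exp (W s) * apply_bcontfun z (s, real j)"
    for z :: "(real \<times> real) \<Rightarrow>\<^sub>C real" and j :: nat and s
  \<comment> \<open>\<open>max 0 t\<close> extends the function to negative times by its value at 0,
    which keeps it continuous and bounded on the whole line.\<close>
  define \<Psi> where "\<Psi> z i t = exp (- W (max 0 t)) *
     (x0 i + integral {0..max 0 t} (\<lambda>s. F s (\<lambda>j. X z j s) i))" for z i t
  define \<Phi> where "\<Phi> z = (\<lambda>(t, r). \<Sum>i<N. b i r * \<Psi> z i t)" for z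
  have cX: "continuous_on {0..} (X z j)" for z j
  proof -
    have "continuous_on {0..} (\<lambda>s. apply_bcontfun z (s, real j))"
      by (rule continuous_on_compose2[OF continuous_on_apply_bcontfun])
        (auto intro!: continuous_intros)
    then show ?thesis unfolding X_def by (intro continuous_intros cW)
  qed
  have cF: "continuous_on {0..} (\<lambda>s. F s (\<lambda>j. X z j s) i)" if "i < N" for z i
    by (rule cont[OF that cX])
  have cF': "continuous_on {0..t} (\<lambda>s. F s (\<lambda>j. X z j s) i)" if "i < N" for z i t
    by (rule continuous_on_subset[OF cF[OF that]]) auto
  have diffle: "\<bar>F s (\<lambda>j. X z j s) i - F s (\<lambda>j. X z' j s) i\<bar> \<le> (dist z z' / real (N + 1)) / 2 * (w s * exp (W s))"
    if s: "0 \<le> s" and i: "i < N" for s i z z'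
  proof -
    have "\<bar>F s (\<lambda>j. X z j s) i - F s (\<lambda>j. X z' j s) i\<bar> \<le> K s * (\<Sum>j<N. \<bar>X z j s - X z' j s\<bar>)"
      by (rule lip[OF s i])
    also have "\<dots> \<le> K s * (\<Sum>j<N. exp (W s) * dist z z')"
    proof (intro mult_left_mono sum_mono K0 s)
      fix j
      have "\<bar>X z j s - X z' j s\<bar> = exp (W s) * dist (apply_bcontfun z (s, real j)) (apply_bcontfun z' (s, real j))"
        by (simp add: X_def dist_real_def abs_mult flip: right_diff_distrib)
      also have "\<dots> \<le> exp (W s) * dist z z'"
        by (intro mult_left_mono dist_bounded) auto
      finally show "\<bar>X z j s - X z' j s\<bar> \<le> exp (W s) * dist z z'" .
    qed
    also have "\<dots> = (dist z z' / real (N + 1)) / 2 * (w s * exp (W s))"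
      by (simp add: w_def del: of_nat_Suc)
    finally show ?thesis .
  qed
  have X0: "X 0 = (\<lambda>j s. 0)" by (simp add: X_def fun_eq_iff)
  have c\<Psi>: "continuous_on UNIV (\<Psi> z i)" if "i < N" for z i
  proof -
    let ?g = "\<lambda>t. exp (- W t) * (x0 i + integral {0..t} (\<lambda>s. F s (\<lambda>j. X z j s) i))"
    have "continuous_on {0..} (\<lambda>t. integral {0..t} (\<lambda>s. F s (\<lambda>j. X z j s) i))"
      using has_real_derivative_integral_Ici[OF cF[OF that]] by (intro DERIV_continuous_on) auto
    then have "continuous_on {0..} ?g" by (intro continuous_intros cW)
    then have "continuous_on UNIV (?g \<circ> (\<lambda>t. max 0 t))"
      by (intro continuous_on_compose continuous_on_max continuous_on_const continuous_on_id
          continuous_on_subset[of "{0..}" ?g "range (max 0)"]) auto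
    then show ?thesis by (simp add: \<Psi>_def[abs_def] o_def)
  qed
  have bsum: "\<bar>\<Sum>i<N. b i r * f i\<bar> \<le> (\<Sum>i<N. \<bar>f i\<bar>)" for r and f :: "nat \<Rightarrow> real"
    by (rule order_trans[OF sum_abs sum_mono])
      (use b in \<open>auto simp: abs_mult intro: mult_left_le_one_le\<close>)
  have bc: "\<Phi> z \<in> bcontfun" for z
    unfolding bcontfun_def
  proof (intro CollectI conjI)
    show "continuous_on UNIV (\<Phi> z)"
      unfolding \<Phi>_def case_prod_beta b_def
      by (intro continuous_intros continuous_on_compose2[OF c\<Psi>]) auto
    \<comment> \<open>Comparison with the argument 0, where the force vanishes by
      \<open>zero\<close>, bounds the integral term by the norm of \<open>z\<close>.\<close>
    have "\<bar>\<Psi> z i t\<bar> \<le> \<bar>x0 i\<bar> + (norm z / real (N + 1)) / 2" if i: "i < N" for t i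
    proof -
      let ?t = "max 0 t"
      let ?f = "\<lambda>s. F s (\<lambda>j. X z j s) i"
      have "exp (- W ?t) * \<bar>integral {0..?t} ?f\<bar> \<le> (norm z / real (N + 1)) / 2"
      proof (rule key)
        fix s assume "s \<in> {0..?t}"
        then show "\<bar>?f s\<bar> \<le> (norm z / real (N + 1)) / 2 * (w s * exp (W s))"
          using diffle[of s i z 0] i zero[of s i] by (simp add: X0)
      qed (auto intro: cF'[OF i])
      moreover have "exp (- W ?t) * \<bar>x0 i\<bar> \<le> 1 * \<bar>x0 i\<bar>"
        using W0[of ?t] by (intro mult_right_mono) auto
      moreover have "\<bar>\<Psi> z i t\<bar> \<le> exp (- W ?t) * (\<bar>x0 i\<bar> + \<bar>integral {0..?t} ?f\<bar>)"
        by (simp add: \<Psi>_def abs_mult abs_triangle_ineq)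
      ultimately show ?thesis by (simp add: distrib_left)
    qed
    then have "(\<Sum>i<N. \<bar>\<Psi> z i t\<bar>) \<le> (\<Sum>i<N. \<bar>x0 i\<bar> + (norm z / real (N + 1)) / 2)" for t
      by (intro sum_mono) auto
    then show "bounded (range (\<Phi> z))"
      by (intro boundedI[of _ "\<Sum>i<N. \<bar>x0 i\<bar> + (norm z / real (N + 1)) / 2"])
        (auto simp: \<Phi>_def intro: order_trans[OF bsum])
  qed
  have "dist (Bcontfun (\<Phi> z)) (Bcontfun (\<Phi> z')) \<le> 1 / 2 * dist z z'" for z z'
  proof (rule dist_bound)
    fix p :: "real \<times> real"
    obtain t r where p: "p = (t, r)" by (cases p)
    have "\<bar>\<Psi> z i t - \<Psi> z' i t\<bar> \<le> (dist z z' / real (N + 1)) / 2" if i: "i < N" for i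
    proof -
      let ?t = "max 0 t"
      let ?f = "\<lambda>z s. F s (\<lambda>j. X z j s) i"
      have "exp (- W ?t) * \<bar>integral {0..?t} (\<lambda>s. ?f z s - ?f z' s)\<bar> \<le> (dist z z' / real (N + 1)) / 2"
        by (intro key diffle i continuous_on_diff cF'[OF i]) auto
      also have "integral {0..?t} (\<lambda>s. ?f z s - ?f z' s) = integral {0..?t} (?f z) - integral {0..?t} (?f z')"
        by (intro integral_diff integrable_continuous_real cF'[OF i])
      finally show ?thesis
        by (simp add: \<Psi>_def abs_mult right_diff_distrib[symmetric] del: right_diff_distrib)
    qed
    then have "(\<Sum>i<N. \<bar>\<Psi> z i t - \<Psi> z' i t\<bar>) \<le> (\<Sum>i<N. (dist z z' / real (N + 1)) / 2)"
      by (intro sum_mono) auto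
    also have "\<dots> \<le> 1 / 2 * dist z z'"
      by (simp add: field_simps)
    finally show "dist (apply_bcontfun (Bcontfun (\<Phi> z)) p) (apply_bcontfun (Bcontfun (\<Phi> z')) p) \<le> 1 / 2 * dist z z'"
      unfolding Bcontfun_inverse[OF bc] p
      using bsum[of r "\<lambda>i. \<Psi> z i t - \<Psi> z' i t"]
      by (simp add: \<Phi>_def dist_real_def right_diff_distrib sum_subtractf)
  qed
  then have "\<exists>!z. Bcontfun (\<Phi> z) = z"
    by (intro banach_fix_type[where f = "\<lambda>z. Bcontfun (\<Phi> z)" and c = "1/2"]) auto
  then obtain z where "Bcontfun (\<Phi> z) = z" by blast
  then have z: "apply_bcontfun z = \<Phi> z" using Bcontfun_inverse[OF bc[of z]] by simp
  have eq: "X z i t = x0 i + integral {0..t} (\<lambda>s. F s (\<lambda>j. X z j s) i)" if i: "i < N" and t: "0 \<le> t" for i t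
  proof -
    have "\<Phi> z (t, real i) = (\<Sum>j<N. if j = i then \<Psi> z j t else 0)"
      unfolding \<Phi>_def case_prod_conv bij by (rule sum.cong) auto
    also have "\<dots> = \<Psi> z i t" using i by simp
    finally have "X z i t = exp (W t) * \<Psi> z i t" by (simp add: X_def z)
    then show ?thesis using t by (simp add: \<Psi>_def mult.assoc[symmetric] flip: exp_add)
  qed
  have "(X z i has_real_derivative F t (\<lambda>j. X z j t) i) (at t within {0..})"
    if i: "i < N" and t: "0 \<le> t" for i t
  proof -
    have "((\<lambda>t. x0 i + integral {0..t} (\<lambda>s. F s (\<lambda>j. X z j s) i)) has_real_derivative
       F t (\<lambda>j. X z j t) i) (at t within {0..})"
      using has_real_derivative_integral_Ici[OF cF[OF i] t, of z]
      by (auto intro!: derivative_eq_intros)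
    then show ?thesis
      by (rule has_field_derivative_transform_within[where d=1]) (use t eq[OF i] in auto)
  qed
  then show ?thesis using eq by (intro exI[of _ "X z"]) auto
qed

section \<open>Energy estimates for the linear equation\<close>

text \<open>A forward average needs no values at negative times, and its derivative is the
  difference quotient of \<open>f\<close> over one step. It serves twice: in time, to differentiate
  a rough coefficient, and in the argument of \<open>m\<close>, to make \<open>m\<close>
  Lipschitz.\<close>

definition avg :: "real \<Rightarrow> (real \<Rightarrow> real) \<Rightarrow> real \<Rightarrow> real" where
  "avg \<epsilon> f t = integral {t..t+\<epsilon>} f / \<epsilon>"

lemma avg_has_real_derivative:
  fixes f :: "real \<Rightarrow> real"
  assumes f: "continuous_on {0..} f" and e: "0 < \<epsilon>" and t: "0 \<le> t"
  shows "(avg \<epsilon> f has_real_derivative (f (t + \<epsilon>) - f t) / \<epsilon>) (at t within {0..})"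
proof -
  let ?I = "\<lambda>x. integral {0..x} f"
  have i: "f integrable_on {a..b}" if "0 \<le> a" for a b
    using that f by (auto intro!: integrable_continuous_real intro: continuous_on_subset)
  have "at (t + \<epsilon>) within {0..} = at (t + \<epsilon>)" using e t by (intro at_within_interior) auto
  then have "(?I has_real_derivative f (t + \<epsilon>)) (at (t + \<epsilon>))"
    using has_real_derivative_integral_Ici[OF f, of "t + \<epsilon>"] e t by simp
  then have "((\<lambda>x. ?I (x + \<epsilon>)) has_real_derivative f (t + \<epsilon>)) (at t within {0..})"
    by (simp add: DERIV_shift has_field_derivative_at_within)
  then have "((\<lambda>x. (?I (x + \<epsilon>) - ?I x) / \<epsilon>) has_real_derivative (f (t + \<epsilon>) - f t) / \<epsilon>)
      (at t within {0..})"
    using has_real_derivative_integral_Ici[OF f t] e by (auto intro!: derivative_eq_intros)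
  then show ?thesis
  proof (rule has_field_derivative_transform_within[where d=1])
    fix x :: real assume "x \<in> {0..}"
    then have "?I x + integral {x..x+\<epsilon>} f = ?I (x + \<epsilon>)"
      using e by (intro Henstock_Kurzweil_Integration.integral_combine i) auto
    then show "(?I (x + \<epsilon>) - ?I x) / \<epsilon> = avg \<epsilon> f x" by (simp add: avg_def)
  qed (use t in auto)
qed

lemma avg_le:
  fixes f :: "real \<Rightarrow> real"
  assumes "continuous_on {t..t+\<epsilon>} f" "0 < \<epsilon>" "\<And>s. s \<in> {t..t+\<epsilon>} \<Longrightarrow> f s \<le> b"
  shows "avg \<epsilon> f t \<le> b"
proof -
  have "integral {t..t+\<epsilon>} f \<le> integral {t..t+\<epsilon>} (\<lambda>_. b)"
    using assms by (intro integral_le integrable_continuous_real) auto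
  also have "\<dots> = \<epsilon> * b" using assms(2) by simp
  finally show ?thesis using assms(2) by (simp add: avg_def field_simps)
qed

lemma avg_ge:
  fixes f :: "real \<Rightarrow> real"
  assumes "continuous_on {t..t+\<epsilon>} f" "0 < \<epsilon>" "\<And>s. s \<in> {t..t+\<epsilon>} \<Longrightarrow> b \<le> f s"
  shows "b \<le> avg \<epsilon> f t"
proof -
  have "integral {t..t+\<epsilon>} (\<lambda>_. b) \<le> integral {t..t+\<epsilon>} f"
    using assms by (intro integral_le integrable_continuous_real) auto
  also have "integral {t..t+\<epsilon>} (\<lambda>_. b) = \<epsilon> * b" using assms(2) by simp
  finally show ?thesis using assms(2) by (simp add: avg_def field_simps)
qed

text \<open>This form shows that averaging preserves a modulus of continuity with the same constant:
  a bound on all differences of shifted values passes to their average.\<close>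

lemma avg_shift_diff:
  fixes f :: "real \<Rightarrow> real"
  assumes f: "continuous_on {0..} f" and e: "0 < \<epsilon>" and "0 \<le> a" "0 \<le> b"
  shows "avg \<epsilon> f a - avg \<epsilon> f b = avg \<epsilon> (\<lambda>s. f (s + a) - f (s + b)) 0"
proof -
  have c: "continuous_on {0..\<epsilon>} (\<lambda>s. f (s + x))" if "0 \<le> x" for x
    by (rule continuous_on_compose2[OF f]) (use that in \<open>auto intro!: continuous_intros\<close>)
  have "integral {x..x+\<epsilon>} f = integral {0..\<epsilon>} (\<lambda>s. f (s + x))" if "0 \<le> x" for x
    using integral_shift[of 0 x \<epsilon> f] that continuous_on_subset[OF f, of "{x..x+\<epsilon>}"]
    by (simp add: o_def add.commute)
  then show ?thesis
    using assms(3,4) c[THEN integrable_continuous_real]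
    by (simp add: avg_def integral_diff diff_divide_distrib)
qed

section \<open>Moduli of continuity\<close>

lemma continuity_modulusD:
  assumes "continuity_modulus \<omega>"
  shows "continuous_on {0..} \<omega>" "\<And>x y. 0 \<le> x \<Longrightarrow> x \<le> y \<Longrightarrow> \<omega> x \<le> \<omega> y" "\<omega> 0 = 0"
    "\<And>x. 0 < x \<Longrightarrow> 0 < \<omega> x" "\<And>x. 0 \<le> x \<Longrightarrow> 0 \<le> \<omega> x"
    "\<And>a b. 0 \<le> a \<Longrightarrow> 0 \<le> b \<Longrightarrow> \<omega> (a + b) \<le> \<omega> a + \<omega> b"
proof -
  have *: "continuous_on {0..} \<omega>" "mono_on {0..} \<omega>" "\<omega> 0 = 0" "\<forall>x>0. 0 < \<omega> x"
    "\<forall>a\<ge>0. \<forall>b\<ge>0. \<omega> (a + b) \<le> \<omega> a + \<omega> b"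
    using assms unfolding continuity_modulus_def by blast+
  show "continuous_on {0..} \<omega>" "\<omega> 0 = 0" using * by auto
  show m: "\<omega> x \<le> \<omega> y" if "0 \<le> x" "x \<le> y" for x y
    using *(2) that by (auto simp: mono_on_def)
  show "0 < \<omega> x" if "0 < x" for x using that * by auto
  show "0 \<le> \<omega> x" if "0 \<le> x" for x using m[OF order_refl that] *(3) by simp
  show "\<omega> (a + b) \<le> \<omega> a + \<omega> b" if "0 \<le> a" "0 \<le> b" for a b using that * by auto
qed

text \<open>Subadditivity yields the factor \<open>n\<close> for an integer multiple
  \<open>n\<close>, and rounding \<open>B\<close> up costs at most 1. Through this bound a
  \<open>B\<close>-Lipschitz argument of \<open>m\<close> costs only the factor \<open>1 + B\<close>
  in the modulus.\<close>

lemma continuity_modulus_mult: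
  assumes cm: "continuity_modulus \<omega>" and B: "0 \<le> B" and x: "0 \<le> x"
  shows "\<omega> (B * x) \<le> (1 + B) * \<omega> x"
proof -
  note w = continuity_modulusD[OF cm]
  have n: "\<omega> (real n * x) \<le> real n * \<omega> x" for n
  proof (induction n)
    case (Suc n)
    have "\<omega> (real n * x + x) \<le> \<omega> (real n * x) + \<omega> x" using x by (intro w(6)) auto
    then show ?case using Suc by (simp add: algebra_simps)
  qed (simp add: w)
  have "B * x \<le> real (nat \<lceil>B\<rceil>) * x" using B x by (intro mult_right_mono) auto
  then have "\<omega> (B * x) \<le> \<omega> (real (nat \<lceil>B\<rceil>) * x)" using B x by (intro w(2)) auto
  also note n
  also have "real (nat \<lceil>B\<rceil>) * \<omega> x \<le> (1 + B) * \<omega> x"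
    using B w(5)[OF x] by (intro mult_right_mono) linarith+
  finally show ?thesis .
qed

text \<open>For frequencies up to a fixed \<open>R\<close> a bound on the coefficient suffices, with
  no sign and no modulus. The constant is poor in \<open>R\<close>, but \<open>R\<close> will be
  fixed before any approximation is considered.\<close>

lemma crude_energy_estimate:
  fixes c y z :: "real \<Rightarrow> real"
  assumes y: "\<And>t. t \<in> {0..T} \<Longrightarrow> (y has_real_derivative z t) (at t within {0..T})"
    and z: "\<And>t. t \<in> {0..T} \<Longrightarrow> (z has_real_derivative - (c t * l\<^sup>2 * y t)) (at t within {0..T})"
    and c: "\<And>t. t \<in> {0..T} \<Longrightarrow> \<bar>c t\<bar> \<le> C" and l: "0 \<le> l" "l \<le> R" and t: "t \<in> {0..T}"
  shows "(y t)\<^sup>2 + (z t)\<^sup>2 \<le> ((y 0)\<^sup>2 + (z 0)\<^sup>2) * exp ((1 + C * R\<^sup>2) * t)"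
proof -
  let ?E = "\<lambda>t. (y t)\<^sup>2 + (z t)\<^sup>2" and ?E' = "\<lambda>t. (1 - c t * l\<^sup>2) * (2 * (y t * z t))"
  have C: "0 \<le> C" using c[OF t] by linarith
  have "?E t \<le> (?E 0 + 0 * t) * exp ((1 + C * R\<^sup>2) * t)"
  proof (rule gronwall[where E' = ?E' and T = T])
    fix s assume s: "s \<in> {0..T}"
    show "(?E has_real_derivative ?E' s) (at s within {0..T})"
      using y[OF s] z[OF s]
      by (auto intro!: derivative_eq_intros simp: power2_eq_square algebra_simps)
    have "\<bar>c s * l\<^sup>2\<bar> \<le> C * R\<^sup>2"
      using c[OF s] l C by (auto simp: abs_mult intro!: mult_mono power_mono)
    then have "\<bar>1 - c s * l\<^sup>2\<bar> * \<bar>2 * (y s * z s)\<bar> \<le> (1 + C * R\<^sup>2) * ?E s"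
    proof (intro mult_mono)
      show "\<bar>1 - c s * l\<^sup>2\<bar> \<le> 1 + C * R\<^sup>2"
        using \<open>\<bar>c s * l\<^sup>2\<bar> \<le> C * R\<^sup>2\<close> by linarith
      then show "0 \<le> 1 + C * R\<^sup>2" by linarith
      show "\<bar>2 * (y s * z s)\<bar> \<le> ?E s"
        using sum_squares_bound[of "y s" "z s"] sum_squares_bound[of "y s" "- z s"]
        by (simp add: abs_le_iff)
    qed simp
    moreover have "?E' s \<le> \<bar>1 - c s * l\<^sup>2\<bar> * \<bar>2 * (y s * z s)\<bar>"
      using abs_ge_self[of "(1 - c s * l\<^sup>2) * (2 * (y s * z s))"] by (simp add: abs_mult)
    ultimately show "?E' s \<le> (1 + C * R\<^sup>2) * ?E s + 0" by simp
  qed (use C t in auto)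
  then show ?thesis by simp
qed

text \<open>The energy method of Colombini, De Giorgi and Spagnolo: the coefficient is replaced in the
  energy by its average over an interval of length \<open>\<epsilon>\<close>, raised by \<open>\<eta>\<close>.\<close>

lemma energy_estimate:
  fixes c y z :: "real \<Rightarrow> real"
  assumes c: "continuous_on {0..} c"
    and osc: "\<And>s t. 0 \<le> t \<Longrightarrow> t \<le> s \<Longrightarrow> s \<le> t + \<epsilon> \<Longrightarrow> \<bar>c s - c t\<bar> \<le> \<Omega>"
    and low: "\<And>t. 0 \<le> t \<Longrightarrow> \<kappa> \<le> c t + \<eta>"
    and pos: "0 < \<epsilon>" "0 \<le> \<eta>" "0 < \<kappa>" "0 \<le> l"
    and y: "\<And>t. t \<in> {0..T} \<Longrightarrow> (y has_real_derivative z t) (at t within {0..T})"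
    and z: "\<And>t. t \<in> {0..T} \<Longrightarrow> (z has_real_derivative - (c t * l\<^sup>2 * y t)) (at t within {0..T})"
    and t: "t \<in> {0..T}"
  shows "(z t)\<^sup>2 + l\<^sup>2 * \<kappa> * (y t)\<^sup>2 \<le>
    ((z 0)\<^sup>2 + l\<^sup>2 * (c 0 + \<Omega> + \<eta>) * (y 0)\<^sup>2) * exp ((\<Omega> / (\<epsilon> * \<kappa>) + l * (\<Omega> + \<eta>) / sqrt \<kappa>) * t)"
proof -
  let ?a = "avg \<epsilon> c"
  let ?E = "\<lambda>t. (z t)\<^sup>2 + l\<^sup>2 * (?a t + \<eta>) * (y t)\<^sup>2"
  let ?G = "\<lambda>t. (z t)\<^sup>2 + l\<^sup>2 * \<kappa> * (y t)\<^sup>2"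
  \<comment> \<open>Differentiating the energy leaves two errors: the slope of the average, at most
    \<open>\<Omega> / \<epsilon>\<close>, and the mismatch between the raised average and
    \<open>c\<close>, at most \<open>\<Omega> + \<eta>\<close>. They produce the two summands of
    \<open>?k\<close>.\<close>
  let ?E' = "\<lambda>t. l\<^sup>2 * ((c (t + \<epsilon>) - c t) / \<epsilon>) * (y t)\<^sup>2 + 2 * l\<^sup>2 * (?a t + \<eta> - c t) * (y t * z t)"
  let ?k = "\<Omega> / (\<epsilon> * \<kappa>) + l * (\<Omega> + \<eta>) / sqrt \<kappa>"
  have \<Omega>: "0 \<le> \<Omega>" using osc[of 0 0] pos by simp
  have cs: "continuous_on {s..s+\<epsilon>} c" if "0 \<le> s" for s
    by (rule continuous_on_subset[OF c]) (use that in auto)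
  have a1: "?a s \<le> c s + \<Omega>" if "0 \<le> s" for s
    using osc[OF that] by (intro avg_le cs that pos) (force simp: abs_le_iff)
  have a2: "c s - \<Omega> \<le> ?a s" if "0 \<le> s" for s
    using osc[OF that] by (intro avg_ge cs that pos) (force simp: abs_le_iff)
  have a3: "\<kappa> - \<eta> \<le> ?a s" if "0 \<le> s" for s
    using low that by (intro avg_ge cs that pos) (force simp: algebra_simps)
  have GE: "?G s \<le> ?E s" if "0 \<le> s" for s
    using a3[OF that] by (intro add_left_mono mult_right_mono mult_left_mono) auto
  have k: "0 \<le> ?k" using \<Omega> pos by auto
  have "?E t \<le> (?E 0 + 0 * t) * exp (?k * t)"
  proof (rule gronwall[where E' = ?E' and T = T])
    fix s assume s: "s \<in> {0..T}"
    then have s0: "0 \<le> s" by simp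
    have a': "(?a has_real_derivative (c (s + \<epsilon>) - c s) / \<epsilon>) (at s within {0..T})"
      using avg_has_real_derivative[OF c pos(1) s0] by (rule DERIV_subset) auto
    show "(?E has_real_derivative ?E' s) (at s within {0..T})"
      by (rule derivative_eq_intros a' y[OF s] z[OF s] refl)+
        (use pos in \<open>simp add: power2_eq_square field_simps\<close>)
    have "l\<^sup>2 * ((c (s + \<epsilon>) - c s) / \<epsilon>) * (y s)\<^sup>2 \<le> l\<^sup>2 * (\<Omega> / \<epsilon>) * (y s)\<^sup>2"
      using osc[of s "s + \<epsilon>"] s0 pos
      by (intro mult_right_mono mult_left_mono divide_right_mono) auto
    also have "\<dots> = \<Omega> / (\<epsilon> * \<kappa>) * (l\<^sup>2 * \<kappa> * (y s)\<^sup>2)" using pos by simp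
    also have "\<dots> \<le> \<Omega> / (\<epsilon> * \<kappa>) * ?G s"
      using \<Omega> pos by (intro mult_left_mono) auto
    finally have 1: "l\<^sup>2 * ((c (s + \<epsilon>) - c s) / \<epsilon>) * (y s)\<^sup>2 \<le> \<Omega> / (\<epsilon> * \<kappa>) * ?G s" .
    have "2 * l\<^sup>2 * (?a s + \<eta> - c s) * (y s * z s) \<le> 2 * l\<^sup>2 * (\<bar>?a s + \<eta> - c s\<bar> * \<bar>y s * z s\<bar>)"
      using abs_ge_self[of "2 * l\<^sup>2 * (?a s + \<eta> - c s) * (y s * z s)"] by (simp add: abs_mult mult_ac)
    also have "\<dots> \<le> 2 * l\<^sup>2 * ((\<Omega> + \<eta>) * \<bar>y s * z s\<bar>)"
      using a1[OF s0] a2[OF s0] pos by (intro mult_left_mono mult_right_mono) auto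
    \<comment> \<open>Splitting off \<open>l * sqrt \<kappa>\<close> balances the product so that
      Young's inequality returns exactly the form \<open>?G\<close>.\<close>
    also have "\<dots> = l * (\<Omega> + \<eta>) / sqrt \<kappa> * (2 * (l * sqrt \<kappa> * \<bar>y s\<bar>) * \<bar>z s\<bar>)"
      using pos by (simp add: power2_eq_square abs_mult)
    also have "\<dots> \<le> l * (\<Omega> + \<eta>) / sqrt \<kappa> * ((l * sqrt \<kappa> * \<bar>y s\<bar>)\<^sup>2 + \<bar>z s\<bar>\<^sup>2)"
      using \<Omega> pos by (intro mult_left_mono sum_squares_bound) auto
    also have "(l * sqrt \<kappa> * \<bar>y s\<bar>)\<^sup>2 + \<bar>z s\<bar>\<^sup>2 = ?G s"
      using pos by (simp add: power_mult_distrib)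
    finally have "?E' s \<le> ?k * ?G s" using 1 by (simp add: distrib_right)
    also have "\<dots> \<le> ?k * ?E s" by (intro mult_left_mono GE s0 k)
    finally show "?E' s \<le> ?k * ?E s + 0" by simp
  qed (use k t in auto)
  also have "(?E 0 + 0 * t) * exp (?k * t) \<le>
      ((z 0)\<^sup>2 + l\<^sup>2 * (c 0 + \<Omega> + \<eta>) * (y 0)\<^sup>2) * exp (?k * t)"
    using a1[of 0] by (auto intro!: mult_right_mono mult_left_mono)
  finally show ?thesis using GE[of t] t by (auto intro: order_trans)
qed

lemma energy_estimate_modulus:
  fixes c y z :: "real \<Rightarrow> real"
  assumes cm: "continuity_modulus \<omega>" and M: "0 \<le> M"
    and osc: "\<And>s t. s \<in> {0..T} \<Longrightarrow> t \<in> {0..T} \<Longrightarrow> \<bar>c s - c t\<bar> \<le> M * \<omega> \<bar>s - t\<bar>"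
    and low: "\<And>t. t \<in> {0..T} \<Longrightarrow> \<kappa> \<le> c t + \<eta>"
    and pos: "0 < \<epsilon>" "0 \<le> \<eta>" "0 < \<kappa>" "0 \<le> l"
    and y: "\<And>t. t \<in> {0..T} \<Longrightarrow> (y has_real_derivative z t) (at t within {0..T})"
    and z: "\<And>t. t \<in> {0..T} \<Longrightarrow> (z has_real_derivative - (c t * l\<^sup>2 * y t)) (at t within {0..T})"
    and t: "t \<in> {0..T}"
  shows "(z t)\<^sup>2 + l\<^sup>2 * \<kappa> * (y t)\<^sup>2 \<le>
    ((z 0)\<^sup>2 + l\<^sup>2 * (c 0 + M * \<omega> \<epsilon> + \<eta>) * (y 0)\<^sup>2) *
      exp ((M * \<omega> \<epsilon> / (\<epsilon> * \<kappa>) + l * (M * \<omega> \<epsilon> + \<eta>) / sqrt \<kappa>) * t)"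
proof -
  note w = continuity_modulusD[OF cm]
  \<comment> \<open>The average looks ahead by \<open>\<epsilon>\<close>, beyond \<open>T\<close>
    for late times, so the coefficient is frozen after \<open>T\<close>. As \<open>min T\<close> is
    1-Lipschitz, the modulus survives.\<close>
  define d where "d t = c (min T t)" for t
  have mem: "min T s \<in> {0..T}" if "0 \<le> s" for s using that t by auto
  have dd: "\<bar>d s - d t\<bar> \<le> M * \<omega> \<bar>s - t\<bar>" if "0 \<le> s" "0 \<le> t" for s t
  proof -
    have "\<bar>d s - d t\<bar> \<le> M * \<omega> \<bar>min T s - min T t\<bar>"
      unfolding d_def by (intro osc mem that)
    also have "\<dots> \<le> M * \<omega> \<bar>s - t\<bar>" using M by (intro mult_left_mono w(2)) auto
    finally show ?thesis .
  qed
  have d0: "d 0 = c 0" using t by (simp add: d_def)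
  have "continuous_on {0..} d"
    unfolding continuous_on
  proof
    fix x :: real assume x: "x \<in> {0..}"
    have "continuous_on {0..} (\<lambda>s. M * \<omega> \<bar>s - x\<bar>)"
      by (intro continuous_intros continuous_on_compose2[OF w(1)]) auto
    then have "((\<lambda>s. M * \<omega> \<bar>s - x\<bar>) \<longlongrightarrow> 0) (at x within {0..})"
      using x w(3) unfolding continuous_on by (force dest: bspec[of _ _ x])
    then have "((\<lambda>s. d s - d x) \<longlongrightarrow> 0) (at x within {0..})"
      by (rule Lim_null_comparison[rotated]) (use dd x in \<open>auto simp: eventually_at_filter\<close>)
    then show "(d \<longlongrightarrow> d x) (at x within {0..})" by (simp add: LIM_zero_iff)
  qed
  moreover have "\<bar>d s - d r\<bar> \<le> M * \<omega> \<epsilon>" if "0 \<le> r" "r \<le> s" "s \<le> r + \<epsilon>" for s r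
    using dd[of s r] w(2)[of "\<bar>s - r\<bar>" \<epsilon>] that M by (auto intro: order_trans mult_left_mono)
  moreover have "\<kappa> \<le> d s + \<eta>" if "0 \<le> s" for s
    unfolding d_def by (intro low mem that)
  moreover have "(z has_real_derivative - (d s * l\<^sup>2 * y s)) (at s within {0..T})"
    if "s \<in> {0..T}" for s using z[OF that] that by (simp add: d_def)
  ultimately show ?thesis
    using energy_estimate[of d \<epsilon> "M * \<omega> \<epsilon>" \<kappa> \<eta> l T y z t] pos y t by (simp add: d0)
qed

text \<open>\<open>B\<close> stands for a Lipschitz constant of the argument of \<open>m\<close>. The constants \<open>K0\<close>, \<open>K1\<close>, \<open>R0\<close> do not
  depend on it: the exponent grows linearly with \<open>B\<close>, and this decides which exponent \<open>p + 1\<close> of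
  \<open>\<rho> n\<close> is needed in the data.\<close>

definition high_frequency_estimate ::
  "real \<Rightarrow> (real \<Rightarrow> real) \<Rightarrow> (real \<Rightarrow> real) \<Rightarrow> real \<Rightarrow> real \<Rightarrow> real \<Rightarrow> real \<Rightarrow> real \<Rightarrow> real \<Rightarrow> bool"
where
  "high_frequency_estimate \<nu> \<omega> \<phi> L C0 T K0 K1 R0 \<longleftrightarrow> (\<forall>B c y z l \<tau>.
     0 \<le> B \<longrightarrow> R0 < l \<longrightarrow> 0 \<le> \<tau> \<longrightarrow> \<tau> \<le> T \<longrightarrow> (\<forall>t\<in>{0..\<tau>}. \<nu> \<le> c t) \<longrightarrow> c 0 \<le> C0 \<longrightarrow>
     (\<forall>s\<in>{0..\<tau>}. \<forall>t\<in>{0..\<tau>}. \<bar>c s - c t\<bar> \<le> L * (1 + B) * \<omega> \<bar>s - t\<bar>) \<longrightarrow>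
     (\<forall>t\<in>{0..\<tau>}. (y has_real_derivative z t) (at t within {0..\<tau>}) \<and>
        (z has_real_derivative - (c t * l\<^sup>2 * y t)) (at t within {0..\<tau>})) \<longrightarrow>
     (\<forall>t\<in>{0..\<tau>}. l^3 * (y t)\<^sup>2 + l * (z t)\<^sup>2 \<le>
        K0 * exp (K1 * (1 + B) * \<phi> l) * (l^3 * (y 0)\<^sup>2 + l * (z 0)\<^sup>2)))"

text \<open>The frequency dictates the averaging length: with \<open>\<epsilon> = 1 / l\<close>,
  \<open>\<kappa> = \<nu>\<close> and \<open>\<eta> = 0\<close> both errors of the energy method are
  multiples of \<open>L * (1 + B) * (l * \<omega> (1 / l))\<close>, which the hypothesis on
  \<open>\<phi>\<close> turns into a multiple of \<open>(1 + B) * \<phi> l\<close>.\<close>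

lemma high_frequency_estimate_strict:
  assumes cm: "continuity_modulus \<omega>" and nu: "0 < \<nu>" and L: "0 \<le> L" and C0: "0 \<le> C0"
    and T: "0 \<le> T"
    and phi: "\<And>x. 0 \<le> x \<Longrightarrow> 0 < \<phi> x"
    and Lam: "\<And>\<sigma>. 0 < \<sigma> \<Longrightarrow> \<sigma> * \<omega> (1 / \<sigma>) \<le> \<Lambda> * \<phi> \<sigma>"
  shows "\<exists>K0\<ge>0. \<exists>K1\<ge>0. \<exists>R0. high_frequency_estimate \<nu> \<omega> \<phi> L C0 T K0 K1 R0"
proof -
  note w = continuity_modulusD[OF cm]
  have "0 < \<Lambda> * \<phi> 1" using Lam[of 1] w(4)[of 1] by simp
  then have Lp: "0 < \<Lambda>" using phi[of 1] by (simp add: zero_less_mult_iff)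
  define k where "k = 1 / \<nu> + 1 / sqrt \<nu>"
  have k: "0 \<le> k" using nu by (simp add: k_def)
  have "high_frequency_estimate \<nu> \<omega> \<phi> L C0 T ((1 + 1 / \<nu>) * (1 + C0)) (L * \<Lambda> * (1 + k * T)) 1"
    unfolding high_frequency_estimate_def
  proof (intro allI impI ballI)
    fix B c y z l \<tau> t
    assume B: "0 \<le> B" and l: "1 < l" and tau: "0 \<le> \<tau>" "\<tau> \<le> T"
      and low: "\<forall>t\<in>{0..\<tau>}. \<nu> \<le> c t" and c0: "c 0 \<le> C0"
      and osc: "\<forall>s\<in>{0..\<tau>}. \<forall>t\<in>{0..\<tau>}. \<bar>c s - c t\<bar> \<le> L * (1 + B) * \<omega> \<bar>s - t\<bar>"
      and ode: "\<forall>t\<in>{0..\<tau>}. (y has_real_derivative z t) (at t within {0..\<tau>}) \<and>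
        (z has_real_derivative - (c t * l\<^sup>2 * y t)) (at t within {0..\<tau>})"
      and t: "t \<in> {0..\<tau>}"
    define \<Omega> where "\<Omega> = L * (1 + B) * \<omega> (1 / l)"
    define W where "W = L * (1 + B) * (\<Lambda> * \<phi> l)"
    have \<Omega>: "0 \<le> \<Omega>" using L B l w(5)[of "1 / l"] by (simp add: \<Omega>_def)
    have "L * (1 + B) * (l * \<omega> (1 / l)) \<le> W"
      unfolding W_def using L B l Lam[of l] by (intro mult_left_mono) auto
    then have lW: "l * \<Omega> \<le> W" by (simp add: \<Omega>_def mult_ac)
    have W: "\<Omega> \<le> W" using mult_right_mono[of 1 l \<Omega>] l \<Omega> lW by linarith
    have "(z t)\<^sup>2 + l\<^sup>2 * \<nu> * (y t)\<^sup>2 \<le>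
      ((z 0)\<^sup>2 + l\<^sup>2 * (c 0 + \<Omega> + 0) * (y 0)\<^sup>2) * exp ((\<Omega> / (1 / l * \<nu>) + l * (\<Omega> + 0) / sqrt \<nu>) * t)"
      unfolding \<Omega>_def
      by (rule energy_estimate_modulus[OF cm, where T = \<tau>]) (use osc low ode l nu t L B in auto)
    also have "\<Omega> / (1 / l * \<nu>) + l * (\<Omega> + 0) / sqrt \<nu> = k * (l * \<Omega>)"
      using l nu by (simp add: k_def field_simps)
    \<comment> \<open>The initial energy contains \<open>\<Omega>\<close>, which grows with
      \<open>B\<close> too; it is absorbed by \<open>1 + W \<le> exp W\<close>. This accounts for
      the summand 1 next to \<open>k * T\<close> in the final exponent.\<close>
    also have "((z 0)\<^sup>2 + l\<^sup>2 * (c 0 + \<Omega> + 0) * (y 0)\<^sup>2) * exp (k * (l * \<Omega>) * t) \<le>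
      ((1 + C0) * exp W * ((z 0)\<^sup>2 + l\<^sup>2 * (y 0)\<^sup>2)) * exp (k * W * T)"
    proof (rule mult_mono)
      have e: "1 \<le> exp W" "1 + W \<le> exp W" using W \<Omega> exp_ge_add_one_self[of W] by auto
      have "1 * 1 \<le> (1 + C0) * exp W" using e C0 by (intro mult_mono) auto
      then have 1: "1 \<le> (1 + C0) * exp W" by simp
      have "C0 * 1 \<le> C0 * exp W" using e C0 by (intro mult_left_mono) auto
      then have 2: "c 0 + \<Omega> \<le> (1 + C0) * exp W" using c0 e W unfolding distrib_right by linarith
      have "(z 0)\<^sup>2 * 1 + l\<^sup>2 * (y 0)\<^sup>2 * (c 0 + \<Omega>) \<le>
          (z 0)\<^sup>2 * ((1 + C0) * exp W) + l\<^sup>2 * (y 0)\<^sup>2 * ((1 + C0) * exp W)"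
        using 1 2 by (intro add_mono mult_left_mono) auto
      then show "(z 0)\<^sup>2 + l\<^sup>2 * (c 0 + \<Omega> + 0) * (y 0)\<^sup>2 \<le> (1 + C0) * exp W * ((z 0)\<^sup>2 + l\<^sup>2 * (y 0)\<^sup>2)"
        by (simp add: algebra_simps)
      show "exp (k * (l * \<Omega>) * t) \<le> exp (k * W * T)"
        using lW k t tau l \<Omega> order_trans[OF \<Omega> W] by (auto intro!: mult_mono)
      show "0 \<le> (1 + C0) * exp W * ((z 0)\<^sup>2 + l\<^sup>2 * (y 0)\<^sup>2)" using C0 by simp
    qed simp
    also have "\<dots> = (1 + C0) * exp (W * (1 + k * T)) * ((z 0)\<^sup>2 + l\<^sup>2 * (y 0)\<^sup>2)"
      by (simp add: exp_add algebra_simps)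
    also have "W * (1 + k * T) = L * \<Lambda> * (1 + k * T) * (1 + B) * \<phi> l"
      by (simp add: W_def mult_ac)
    finally have main: "(z t)\<^sup>2 + l\<^sup>2 * \<nu> * (y t)\<^sup>2 \<le> (1 + C0) *
      exp (L * \<Lambda> * (1 + k * T) * (1 + B) * \<phi> l) * ((z 0)\<^sup>2 + l\<^sup>2 * (y 0)\<^sup>2)" .
    have "l^3 * (y t)\<^sup>2 + l * (z t)\<^sup>2 \<le> l * ((1 + 1 / \<nu>) * ((z t)\<^sup>2 + l\<^sup>2 * \<nu> * (y t)\<^sup>2))"
    proof -
      have "l * ((1 + 1 / \<nu>) * ((z t)\<^sup>2 + l\<^sup>2 * \<nu> * (y t)\<^sup>2)) = l^3 * (y t)\<^sup>2 + l * (z t)\<^sup>2 +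
          (l^3 * \<nu> * (y t)\<^sup>2 + l * (z t)\<^sup>2 / \<nu>)"
        using nu by (simp add: field_simps power2_eq_square power3_eq_cube)
      moreover have "0 \<le> l^3 * \<nu> * (y t)\<^sup>2 + l * (z t)\<^sup>2 / \<nu>" using nu l by simp
      ultimately show ?thesis by linarith
    qed
    also have "\<dots> \<le> l * ((1 + 1 / \<nu>) * ((1 + C0) *
      exp (L * \<Lambda> * (1 + k * T) * (1 + B) * \<phi> l) * ((z 0)\<^sup>2 + l\<^sup>2 * (y 0)\<^sup>2)))"
      using l nu by (intro mult_left_mono main) auto
    also have "\<dots> = (1 + 1 / \<nu>) * (1 + C0) * exp (L * \<Lambda> * (1 + k * T) * (1 + B) * \<phi> l) *
      (l * ((z 0)\<^sup>2 + l\<^sup>2 * (y 0)\<^sup>2))"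
      by (simp only: mult_ac)
    also have "l * ((z 0)\<^sup>2 + l\<^sup>2 * (y 0)\<^sup>2) = l^3 * (y 0)\<^sup>2 + l * (z 0)\<^sup>2"
      by (simp add: algebra_simps power2_eq_square power3_eq_cube)
    finally show "l^3 * (y t)\<^sup>2 + l * (z t)\<^sup>2 \<le> (1 + 1 / \<nu>) * (1 + C0) *
      exp (L * \<Lambda> * (1 + k * T) * (1 + B) * \<phi> l) * (l^3 * (y 0)\<^sup>2 + l * (z 0)\<^sup>2)" .
  qed
  moreover have "0 \<le> (1 + 1 / \<nu>) * (1 + C0)" "0 \<le> L * \<Lambda> * (1 + k * T)"
    using nu C0 L Lp k T by auto
  ultimately show ?thesis by blast
qed

text \<open>Intermediate value theorem: the map has the value \<open>1 / sqrt (\<omega> 1)\<close>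
  at 1, and at \<open>b\<close> it is at least \<open>l\<close> because
  \<open>\<omega> (1 / b) \<le> \<omega> 1\<close>. The weakly hyperbolic hypothesis controls
  \<open>\<phi>\<close> along this map, so a given frequency has to be written as one of its
  values.\<close>

lemma exists_frequency_scale:
  assumes cm: "continuity_modulus \<omega>" and l: "1 / sqrt (\<omega> 1) < l"
  shows "\<exists>\<sigma>\<ge>1. \<sigma> / sqrt (\<omega> (1 / \<sigma>)) = l"
proof -
  note w = continuity_modulusD[OF cm]
  let ?h = "\<lambda>\<sigma>. \<sigma> / sqrt (\<omega> (1 / \<sigma>))"
  have w1: "0 < \<omega> 1" by (simp add: w)
  have l0: "0 < l" using l w1 by (meson less_trans divide_pos_pos zero_less_one real_sqrt_gt_zero)
  define b where "b = 1 + l * sqrt (\<omega> 1)"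
  have b: "1 \<le> b" using l0 w1 by (simp add: b_def)
  have "l \<le> b / sqrt (\<omega> 1)" using w1 by (simp add: b_def field_simps)
  also have "\<dots> \<le> ?h b"
    using b w1 w(4)[of "1/b"] w(2)[of "1/b" 1]
    by (intro divide_left_mono mult_pos_pos real_sqrt_le_mono) auto
  finally have "l \<le> ?h b" .
  moreover have "continuous_on {1..b} ?h"
  proof -
    have "continuous_on {1..b} (\<lambda>x. \<omega> (1 / x))"
      by (rule continuous_on_compose2[OF w(1)]) (auto intro!: continuous_intros)
    moreover have "sqrt (\<omega> (1 / x)) \<noteq> 0" if "x \<in> {1..b}" for x
      using w(4)[of "1 / x"] that by simp
    ultimately show ?thesis by (intro continuous_intros) auto
  qed
  ultimately have "\<exists>x\<ge>1. x \<le> b \<and> ?h x = l"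
    using b l by (intro IVT') auto
  then show ?thesis by blast
qed

text \<open>Write \<open>l = \<sigma> / sqrt v\<close> with
  \<open>v = \<omega> (1 / \<sigma>)\<close>. The coefficient may vanish, so the energy is raised by
  \<open>\<eta> = \<kappa> = v\<close>, and \<open>\<epsilon> = 1 / \<sigma>\<close>. With
  \<open>M = L * (1 + B)\<close> this balances the two errors: the first is
  \<open>M * \<sigma>\<close>, the second \<open>l * (M + 1) * sqrt v = (M + 1) * \<sigma>\<close>.
  The exponent is thus controlled by \<open>(1 + B) * \<sigma>\<close>, and
  \<open>\<sigma> \<le> \<Lambda> * \<phi> l\<close>.\<close>

lemma high_frequency_estimate_weak:
  assumes cm: "continuity_modulus \<omega>" and L: "0 \<le> L" and C0: "0 \<le> C0" and T: "0 \<le> T"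
    and phi: "\<And>x. 0 \<le> x \<Longrightarrow> 0 < \<phi> x"
    and Lam: "\<And>\<sigma>. 0 < \<sigma> \<Longrightarrow> \<sigma> \<le> \<Lambda> * \<phi> (\<sigma> / sqrt (\<omega> (1 / \<sigma>)))"
  shows "\<exists>K0\<ge>0. \<exists>K1\<ge>0. \<exists>R0. high_frequency_estimate 0 \<omega> \<phi> L C0 T K0 K1 R0"
proof -
  note w = continuity_modulusD[OF cm]
  let ?w = "\<omega> 1"
  have w1: "0 < ?w" by (simp add: w)
  have "0 < \<Lambda> * \<phi> (1 / sqrt (\<omega> 1))" using Lam[of 1] by simp
  then have Lp: "0 < \<Lambda>" using phi[of "1 / sqrt (\<omega> 1)"] w1 by (simp add: zero_less_mult_iff)
  \<comment> \<open>The three summands pay for the initial energy, for the Gronwall factor over time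
    \<open>T\<close>, and for removing the small weight \<open>v\<close> from the energy.\<close>
  define K1 where "K1 = \<Lambda> * ((L + 1) + (2 * L + 1) * T + 1)"
  define K0 where "K0 = (1 + 1 / ?w) * (1 + C0 + ?w)"
  have "high_frequency_estimate 0 \<omega> \<phi> L C0 T K0 K1 (1 / sqrt ?w)"
    unfolding high_frequency_estimate_def
  proof (intro allI impI ballI)
    fix B c y z l \<tau> t
    assume B: "0 \<le> B" and l: "1 / sqrt ?w < l" and tau: "0 \<le> \<tau>" "\<tau> \<le> T"
      and low: "\<forall>t\<in>{0..\<tau>}. 0 \<le> c t" and c0: "c 0 \<le> C0"
      and osc: "\<forall>s\<in>{0..\<tau>}. \<forall>t\<in>{0..\<tau>}. \<bar>c s - c t\<bar> \<le> L * (1 + B) * \<omega> \<bar>s - t\<bar>"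
      and ode: "\<forall>t\<in>{0..\<tau>}. (y has_real_derivative z t) (at t within {0..\<tau>}) \<and>
        (z has_real_derivative - (c t * l\<^sup>2 * y t)) (at t within {0..\<tau>})"
      and t: "t \<in> {0..\<tau>}"
    obtain \<sigma> where s1: "1 \<le> \<sigma>" and s: "\<sigma> / sqrt (\<omega> (1 / \<sigma>)) = l"
      using exists_frequency_scale[OF cm l] by blast
    have l0: "0 < l" using l w1 by (meson less_trans divide_pos_pos zero_less_one real_sqrt_gt_zero)
    define v where "v = \<omega> (1 / \<sigma>)"
    have v: "0 < v" using s1 by (simp add: v_def w)
    have vw: "v \<le> ?w" unfolding v_def using s1 by (intro w) auto
    \<comment> \<open>Lower bound for the weight: \<open>v\<close> is at least
      \<open>\<omega> 1 / (1 + \<sigma>)\<close>, so dividing by it costs a factor linear in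
      \<open>\<sigma>\<close>, later absorbed by \<open>exp W\<close>.\<close>
    have "\<omega> (\<sigma> * (1 / \<sigma>)) \<le> (1 + \<sigma>) * v"
      unfolding v_def using s1 by (intro continuity_modulus_mult cm) auto
    then have wv: "?w \<le> (1 + \<sigma>) * v" using s1 by simp
    have ls: "l * sqrt v = \<sigma>" using s v by (auto simp: v_def[symmetric] field_simps)
    define M where "M = L * (1 + B)"
    have M: "0 \<le> M" using L B by (simp add: M_def)
    define W where "W = (1 + B) * \<sigma>"
    have W1: "\<sigma> \<le> W" using B s1 by (simp add: W_def distrib_right)
    have W0: "0 \<le> W" using W1 s1 by simp
    have MW: "M * \<sigma> = L * W" by (simp add: M_def W_def)
    have M1: "M * 1 \<le> M * \<sigma>" using M s1 by (intro mult_left_mono) auto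
    have "(z t)\<^sup>2 + l\<^sup>2 * v * (y t)\<^sup>2 \<le>
      ((z 0)\<^sup>2 + l\<^sup>2 * (c 0 + M * v + v) * (y 0)\<^sup>2) *
        exp ((M * v / (1 / \<sigma> * v) + l * (M * v + v) / sqrt v) * t)"
      unfolding v_def
      by (rule energy_estimate_modulus[OF cm, where T = \<tau>])
        (use osc low ode l0 s1 v t M in \<open>auto simp: v_def M_def\<close>)
    also have "M * v / (1 / \<sigma> * v) + l * (M * v + v) / sqrt v = M * \<sigma> + (l * sqrt v) * (M + 1)"
      using v s1 by (simp add: field_simps)
    also have "\<dots> = 2 * (M * \<sigma>) + \<sigma>" by (simp add: ls algebra_simps)
    also have "((z 0)\<^sup>2 + l\<^sup>2 * (c 0 + M * v + v) * (y 0)\<^sup>2) * exp ((2 * (M * \<sigma>) + \<sigma>) * t) \<le>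
      ((1 + C0 + ?w) * exp ((L + 1) * W) * ((z 0)\<^sup>2 + l\<^sup>2 * (y 0)\<^sup>2)) * exp ((2 * L + 1) * W * T)"
    proof (rule mult_mono)
      let ?e = "exp ((L + 1) * W)"
      have LW: "0 \<le> (L + 1) * W" using L W0 by simp
      have e: "1 \<le> ?e" "(L + 1) * W \<le> ?e"
        using LW exp_ge_add_one_self[of "(L + 1) * W"] by (simp, linarith)
      have Ce: "C0 * 1 \<le> C0 * ?e" using e C0 by (intro mult_left_mono) auto
      have "M * v + v = (M + 1) * v" by (simp add: algebra_simps)
      also have "\<dots> \<le> (M + 1) * ?w" using vw M by (intro mult_left_mono) auto
      also have "M + 1 \<le> (L + 1) * W" using M1 MW W1 s1 by (simp add: distrib_right)
      also note e(2)
      finally have 3: "M * v + v \<le> ?w * ?e" using w1 by (simp add: mult.commute mult_left_mono)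
      have 0: "(1 + C0 + ?w) * ?e = ?e + C0 * ?e + ?w * ?e" by (simp add: algebra_simps)
      have we: "0 \<le> ?w * ?e" using w1 by simp
      have 1: "1 \<le> (1 + C0 + ?w) * ?e" unfolding 0 using Ce C0 e we by linarith
      have 2: "c 0 + M * v + v \<le> (1 + C0 + ?w) * ?e"
        unfolding 0 using 3 c0 e Ce by simp
      have "(z 0)\<^sup>2 * 1 + l\<^sup>2 * (y 0)\<^sup>2 * (c 0 + M * v + v) \<le>
          (z 0)\<^sup>2 * ((1 + C0 + ?w) * ?e) + l\<^sup>2 * (y 0)\<^sup>2 * ((1 + C0 + ?w) * ?e)"
        using 1 2 by (intro add_mono mult_left_mono) auto
      then show "(z 0)\<^sup>2 + l\<^sup>2 * (c 0 + M * v + v) * (y 0)\<^sup>2 \<le>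
          (1 + C0 + ?w) * ?e * ((z 0)\<^sup>2 + l\<^sup>2 * (y 0)\<^sup>2)"
        by (simp add: algebra_simps)
      have "(2 * (M * \<sigma>) + \<sigma>) * t \<le> (2 * L + 1) * W * T"
        using MW W1 t tau L W0 by (intro mult_mono) (auto simp: distrib_right)
      then show "exp ((2 * (M * \<sigma>) + \<sigma>) * t) \<le> exp ((2 * L + 1) * W * T)" by simp
      show "0 \<le> (1 + C0 + ?w) * ?e * ((z 0)\<^sup>2 + l\<^sup>2 * (y 0)\<^sup>2)" using C0 w1 by simp
    qed simp
    also have "\<dots> = (1 + C0 + ?w) * exp (W * ((L + 1) + (2 * L + 1) * T)) * ((z 0)\<^sup>2 + l\<^sup>2 * (y 0)\<^sup>2)"
      by (simp add: exp_add algebra_simps)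
    finally have main: "(z t)\<^sup>2 + l\<^sup>2 * v * (y t)\<^sup>2 \<le>
      (1 + C0 + ?w) * exp (W * ((L + 1) + (2 * L + 1) * T)) * ((z 0)\<^sup>2 + l\<^sup>2 * (y 0)\<^sup>2)" .
    have "(z t)\<^sup>2 + l\<^sup>2 * (y t)\<^sup>2 \<le> (1 + 1 / ?w) * (1 + \<sigma>) * ((z t)\<^sup>2 + l\<^sup>2 * v * (y t)\<^sup>2)"
    proof -
      have "1 * 1 \<le> (1 + 1 / ?w) * (1 + \<sigma>)" using w1 s1 by (intro mult_mono) auto
      then have 1: "1 * (z t)\<^sup>2 \<le> (1 + 1 / ?w) * (1 + \<sigma>) * (z t)\<^sup>2" by (intro mult_right_mono) auto
      have "1 \<le> 1 / ?w * ((1 + \<sigma>) * v)" using wv w1 by (simp add: field_simps)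
      also have "\<dots> \<le> (1 + 1 / ?w) * ((1 + \<sigma>) * v)"
        using s1 v by (intro mult_right_mono) auto
      finally have "1 * (l\<^sup>2 * (y t)\<^sup>2) \<le> (1 + 1 / ?w) * ((1 + \<sigma>) * v) * (l\<^sup>2 * (y t)\<^sup>2)"
        by (intro mult_right_mono) auto
      then have "(z t)\<^sup>2 + l\<^sup>2 * (y t)\<^sup>2 \<le> (1 + 1 / ?w) * (1 + \<sigma>) * (z t)\<^sup>2 +
         (1 + 1 / ?w) * ((1 + \<sigma>) * v) * (l\<^sup>2 * (y t)\<^sup>2)" using 1 by linarith
      also have "\<dots> = (1 + 1 / ?w) * (1 + \<sigma>) * ((z t)\<^sup>2 + l\<^sup>2 * v * (y t)\<^sup>2)"
        unfolding distrib_left[of "(1 + 1 / ?w) * (1 + \<sigma>)"] by (simp only: mult_ac)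
      finally show ?thesis .
    qed
    also have "\<dots> \<le> (1 + 1 / ?w) * exp W * ((z t)\<^sup>2 + l\<^sup>2 * v * (y t)\<^sup>2)"
    proof -
      have "1 + \<sigma> \<le> exp W" using W1 exp_ge_add_one_self[of W] by linarith
      then show ?thesis using w1 v by (intro mult_right_mono mult_left_mono) auto
    qed
    also have "\<dots> \<le> (1 + 1 / ?w) * exp W * ((1 + C0 + ?w) *
        exp (W * ((L + 1) + (2 * L + 1) * T)) * ((z 0)\<^sup>2 + l\<^sup>2 * (y 0)\<^sup>2))"
      using w1 by (intro main mult_left_mono) auto
    also have "\<dots> = K0 * exp (W * ((L + 1) + (2 * L + 1) * T + 1)) * ((z 0)\<^sup>2 + l\<^sup>2 * (y 0)\<^sup>2)"
      unfolding K0_def distrib_left[of W _ 1] exp_add mult_1_right by (simp only: mult_ac)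
    also have "\<dots> \<le> K0 * exp (K1 * (1 + B) * \<phi> l) * ((z 0)\<^sup>2 + l\<^sup>2 * (y 0)\<^sup>2)"
    proof -
      have "W \<le> (1 + B) * (\<Lambda> * \<phi> l)"
        unfolding W_def using Lam[of \<sigma>] s s1 B by (intro mult_left_mono) auto
      then have "W * ((L + 1) + (2 * L + 1) * T + 1) \<le> (1 + B) * (\<Lambda> * \<phi> l) * ((L + 1) + (2 * L + 1) * T + 1)"
        using L T by (intro mult_right_mono) auto
      also have "\<dots> = K1 * (1 + B) * \<phi> l" by (simp only: K1_def mult_ac)
      finally show ?thesis using w1 C0 by (intro mult_right_mono mult_left_mono) (auto simp: K0_def)
    qed
    finally have "l * ((z t)\<^sup>2 + l\<^sup>2 * (y t)\<^sup>2) \<le>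
        l * (K0 * exp (K1 * (1 + B) * \<phi> l) * ((z 0)\<^sup>2 + l\<^sup>2 * (y 0)\<^sup>2))"
      using l0 by (intro mult_left_mono) auto
    then show "l^3 * (y t)\<^sup>2 + l * (z t)\<^sup>2 \<le>
        K0 * exp (K1 * (1 + B) * \<phi> l) * (l^3 * (y 0)\<^sup>2 + l * (z 0)\<^sup>2)"
      by (simp add: algebra_simps power2_eq_square power3_eq_cube)
  qed
  moreover have "0 \<le> K0" "0 \<le> K1" using w1 C0 L Lp T by (auto simp: K0_def K1_def)
  ultimately show ?thesis by blast
qed

section \<open>Finitely many modes\<close>

definition stiffness :: "(nat \<Rightarrow> real) \<Rightarrow> nat \<Rightarrow> (nat \<Rightarrow> real \<Rightarrow> real) \<Rightarrow> real \<Rightarrow> real" where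
  "stiffness l N U t = (\<Sum>k<N. (l k)\<^sup>2 * (U k t)\<^sup>2)"

text \<open>Conservation of the Hamiltonian is part of the notion because the a priori estimates
  start from it. The potential energy is the primitive of \<open>\<mu>\<close> evaluated at the
  stiffness.\<close>

definition galerkin_solution ::
  "(real \<Rightarrow> real) \<Rightarrow> (nat \<Rightarrow> real) \<Rightarrow> (nat \<Rightarrow> real) \<Rightarrow> (nat \<Rightarrow> real) \<Rightarrow> nat \<Rightarrow> real \<Rightarrow>
     (nat \<Rightarrow> real \<Rightarrow> real) \<Rightarrow> (nat \<Rightarrow> real \<Rightarrow> real) \<Rightarrow> bool" where
  "galerkin_solution \<mu> l a b N T U V \<longleftrightarrow>
     (\<forall>k<N. U k 0 = a k \<and> V k 0 = b k) \<and>
     (\<forall>t\<in>{0..T}. \<forall>k<N. (U k has_real_derivative V k t) (at t within {0..T}) \<and>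
        (V k has_real_derivative - (\<mu> (stiffness l N U t) * (l k)\<^sup>2 * U k t)) (at t within {0..T})) \<and>
     (\<forall>t\<in>{0..T}. (\<Sum>k<N. (V k t)\<^sup>2) + integral {0..stiffness l N U t} \<mu> =
        (\<Sum>k<N. (b k)\<^sup>2) + integral {0..stiffness l N U 0} \<mu>)"

lemma stiffness_nonneg: "0 \<le> stiffness l N U t"
  by (simp add: stiffness_def sum_nonneg)

lemma stiffness_has_real_derivative:
  assumes "\<And>k. k < N \<Longrightarrow> (U k has_real_derivative V k t) (at t within S)"
  shows "(stiffness l N U has_real_derivative (\<Sum>k<N. 2 * (l k)\<^sup>2 * U k t * V k t)) (at t within S)"
  unfolding stiffness_def[abs_def]
  by (intro DERIV_sum) (auto intro!: derivative_eq_intros assms simp: power2_eq_square)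

text \<open>A plain Lipschitz bound would not do. That the difference vanishes once the smaller
  number \<open>p\<close> reaches \<open>Q\<close> is what later controls the product of a
  difference of coefficients with a component that is itself unbounded.\<close>

lemma min_square_diff_le:
  fixes p q Q :: real
  assumes "0 \<le> p" "p \<le> q" "0 \<le> Q"
  shows "\<bar>min (p\<^sup>2) (Q\<^sup>2) - min (q\<^sup>2) (Q\<^sup>2)\<bar> \<le> (if p < Q then 2 * Q * (q - p) else 0)"
proof (cases "p < Q")
  case False
  then have "Q\<^sup>2 \<le> p\<^sup>2" "Q\<^sup>2 \<le> q\<^sup>2" using assms by (auto intro!: power_mono)
  then show ?thesis using False by simp
next
  case True
  define r where "r = min q Q"
  have "p \<le> r" "r \<le> q" "r \<le> Q" using True assms by (auto simp: r_def)
  have "min (q\<^sup>2) (Q\<^sup>2) = r\<^sup>2"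
    using assms by (auto simp: r_def min_def power_mono dest: power_mono[of Q q 2] antisym)
  moreover have "min (p\<^sup>2) (Q\<^sup>2) = p\<^sup>2" using True assms by (simp add: power_mono)
  moreover have "r\<^sup>2 - p\<^sup>2 = (r + p) * (r - p)" by (simp add: power2_eq_square algebra_simps)
  moreover have "(r + p) * (r - p) \<le> (2 * Q) * (q - p)"
    using \<open>p \<le> r\<close> \<open>r \<le> q\<close> \<open>r \<le> Q\<close> assms True by (intro mult_mono) auto
  moreover have "p\<^sup>2 \<le> r\<^sup>2" using \<open>p \<le> r\<close> assms by (simp add: power_mono)
  ultimately show ?thesis using True by simp
qed

text \<open>With \<open>q\<close> the square root of the stiffness, assume
  \<open>q x \<le> q y\<close> and attach the difference of coefficients to the smaller point
  \<open>x\<close>. Either \<open>q x < Q\<close>, and then \<open>l k * \<bar>x k\<bar>\<close> is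
  below \<open>Q\<close>, or both coefficients are frozen and the difference is 0. This makes the
  force globally Lipschitz although it is not linear.\<close>

lemma truncated_force_lipschitz:
  fixes \<mu> :: "real \<Rightarrow> real" and l x y :: "nat \<Rightarrow> real"
  assumes mu0: "\<And>x. 0 \<le> x \<Longrightarrow> 0 \<le> \<mu> x"
    and lip: "\<And>x y. 0 \<le> x \<Longrightarrow> 0 \<le> y \<Longrightarrow> \<bar>\<mu> x - \<mu> y\<bar> \<le> K * \<bar>x - y\<bar>"
    and l: "\<And>k. 0 \<le> l k" and Q: "0 \<le> Q" and k: "k < N" and A: "A = (\<Sum>j<N. l j)"
  shows "\<bar>\<mu> (min (\<Sum>j<N. (l j)\<^sup>2 * (x j)\<^sup>2) (Q\<^sup>2)) * (l k)\<^sup>2 * x k -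
           \<mu> (min (\<Sum>j<N. (l j)\<^sup>2 * (y j)\<^sup>2) (Q\<^sup>2)) * (l k)\<^sup>2 * y k\<bar>
         \<le> A\<^sup>2 * (3 * K * Q\<^sup>2 + \<mu> 0) * (\<Sum>j<N. \<bar>x j - y j\<bar>)"
proof -
  have K: "0 \<le> K" using lip[of 0 1] by simp
  have lA: "l j \<le> A" if "j < N" for j using that l unfolding A by (intro member_le_sum) auto
  have A0: "0 \<le> A" using l by (simp add: A sum_nonneg)
  define q where "q x = L2_set (\<lambda>j. l j * x j) {..<N}" for x
  have q0: "0 \<le> q x" for x by (simp add: q_def)
  have q2: "(\<Sum>j<N. (l j)\<^sup>2 * (x j)\<^sup>2) = (q x)\<^sup>2" for x
    by (simp add: q_def L2_set_def power_mult_distrib sum_nonneg)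
  have qle: "q x - q y \<le> A * (\<Sum>j<N. \<bar>x j - y j\<bar>)" for x y
  proof -
    have "q x = L2_set (\<lambda>j. l j * y j + l j * (x j - y j)) {..<N}"
      by (simp add: q_def algebra_simps)
    also have "\<dots> \<le> q y + L2_set (\<lambda>j. l j * (x j - y j)) {..<N}"
      unfolding q_def by (rule L2_set_triangle_ineq)
    finally have "q x - q y \<le> L2_set (\<lambda>j. l j * (x j - y j)) {..<N}" by simp
    also have "\<dots> \<le> (\<Sum>j<N. \<bar>l j * (x j - y j)\<bar>)" by (rule L2_set_le_sum_abs)
    also have "\<dots> \<le> (\<Sum>j<N. A * \<bar>x j - y j\<bar>)"
      using l lA by (intro sum_mono) (auto simp: abs_mult intro!: mult_right_mono)
    finally show ?thesis by (simp add: sum_distrib_left)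
  qed
  have lk: "l k * \<bar>x k\<bar> \<le> q x" for x
  proof -
    have "\<bar>l k * x k\<bar> \<le> L2_set (\<lambda>j. \<bar>l j * x j\<bar>) {..<N}"
      using k by (intro member_le_L2_set) auto
    then show ?thesis using l[of k] by (simp add: q_def L2_set_def abs_mult power_mult_distrib)
  qed
  let ?g = "\<lambda>x. \<mu> (min ((q x)\<^sup>2) (Q\<^sup>2))"
  have gmax: "\<bar>?g x\<bar> \<le> \<mu> 0 + K * Q\<^sup>2" for x
  proof -
    have "?g x \<le> \<mu> 0 + K * \<bar>min ((q x)\<^sup>2) (Q\<^sup>2) - 0\<bar>"
      using lip[of "min ((q x)\<^sup>2) (Q\<^sup>2)" 0] by (simp add: abs_le_iff)
    also have "\<dots> \<le> \<mu> 0 + K * Q\<^sup>2" using K by (intro add_left_mono mult_left_mono) auto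
    finally show ?thesis using mu0[of "min ((q x)\<^sup>2) (Q\<^sup>2)"] by simp
  qed
  have *: "\<bar>?g x * (l k)\<^sup>2 * x k - ?g y * (l k)\<^sup>2 * y k\<bar> \<le>
      A\<^sup>2 * (3 * K * Q\<^sup>2 + \<mu> 0) * (\<Sum>j<N. \<bar>x j - y j\<bar>)" if le: "q x \<le> q y" for x y
  proof -
    let ?D = "\<Sum>j<N. \<bar>x j - y j\<bar>"
    have D: "0 \<le> ?D" "\<bar>x k - y k\<bar> \<le> ?D" using k by (auto intro: sum_nonneg member_le_sum)
    have "\<bar>?g x - ?g y\<bar> \<le> K * \<bar>min ((q x)\<^sup>2) (Q\<^sup>2) - min ((q y)\<^sup>2) (Q\<^sup>2)\<bar>" by (intro lip) auto
    also have "\<dots> \<le> K * (if q x < Q then 2 * Q * (q y - q x) else 0)"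
      by (intro mult_left_mono min_square_diff_le q0 le Q K)
    finally have 1: "\<bar>?g x - ?g y\<bar> \<le> K * (if q x < Q then 2 * Q * (q y - q x) else 0)" .
    have "\<bar>?g x - ?g y\<bar> * (l k * \<bar>x k\<bar>) \<le> 2 * K * Q\<^sup>2 * (q y - q x)"
    proof (cases "q x < Q")
      case True
      then have "\<bar>?g x - ?g y\<bar> * (l k * \<bar>x k\<bar>) \<le> (K * (2 * Q * (q y - q x))) * Q"
        using 1 lk[of x] l[of k] by (intro mult_mono) auto
      then show ?thesis by (simp add: power2_eq_square mult_ac)
    next
      case False
      then have "\<bar>?g x - ?g y\<bar> = 0" using 1 by simp
      then show ?thesis using le K by simp
    qed
    also have "\<dots> \<le> 2 * K * Q\<^sup>2 * (A * ?D)"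
      using qle[of y x] K by (intro mult_left_mono) (auto simp: abs_minus_commute)
    finally have 2: "\<bar>?g x - ?g y\<bar> * (l k * \<bar>x k\<bar>) \<le> 2 * K * Q\<^sup>2 * (A * ?D)" .
    have "\<bar>?g y\<bar> * (l k * \<bar>x k - y k\<bar>) \<le> (\<mu> 0 + K * Q\<^sup>2) * (A * ?D)"
      using gmax[of y] lA[OF k] D l[of k] A0 K mu0[of 0] by (intro mult_mono) auto
    then have 3: "\<bar>?g x - ?g y\<bar> * (l k * \<bar>x k\<bar>) + \<bar>?g y\<bar> * (l k * \<bar>x k - y k\<bar>) \<le>
        (3 * K * Q\<^sup>2 + \<mu> 0) * (A * ?D)"
      using 2 by (simp add: algebra_simps)
    have "?g x * (l k)\<^sup>2 * x k - ?g y * (l k)\<^sup>2 * y k =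
        l k * ((?g x - ?g y) * (l k * x k) + ?g y * (l k * (x k - y k)))"
      by (simp add: power2_eq_square algebra_simps)
    also have "\<bar>\<dots>\<bar> \<le> l k * (\<bar>?g x - ?g y\<bar> * (l k * \<bar>x k\<bar>) + \<bar>?g y\<bar> * (l k * \<bar>x k - y k\<bar>))"
      unfolding abs_mult using l[of k]
      by (simp add: mult_left_mono order_trans[OF abs_triangle_ineq] abs_mult)
    also have "\<dots> \<le> A * ((3 * K * Q\<^sup>2 + \<mu> 0) * (A * ?D))"
      using 3 lA[OF k] l[of k] A0 K mu0[of 0] D by (intro mult_mono) auto
    finally show ?thesis by (simp add: power2_eq_square mult_ac)
  qed
  show ?thesis
  proof (cases "q x \<le> q y")
    case True
    then show ?thesis unfolding q2 by (rule *)
  next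
    case False
    then show ?thesis unfolding q2 using *[of y x] by (simp add: abs_minus_commute)
  qed
qed

text \<open>The argument of \<open>\<mu>\<close> is truncated at \<open>Q\<^sup>2\<close>, which
  makes the force globally Lipschitz. The Hamiltonian and Gronwall's inequality then keep the
  stiffness below \<open>Q\<^sup>2\<close> on [0, T], so the truncation is never active
  there.\<close>

lemma galerkin_exists:
  fixes \<mu> :: "real \<Rightarrow> real" and l a b :: "nat \<Rightarrow> real"
  assumes mu0: "\<And>x. 0 \<le> x \<Longrightarrow> 0 \<le> \<mu> x"
    and lip: "\<And>x y. 0 \<le> x \<Longrightarrow> 0 \<le> y \<Longrightarrow> \<bar>\<mu> x - \<mu> y\<bar> \<le> K * \<bar>x - y\<bar>"
    and l: "\<And>k. 0 \<le> l k" and T: "0 \<le> T"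
  shows "\<exists>U V. galerkin_solution \<mu> l a b N T U V"
proof -
  have K: "0 \<le> K" using lip[of 0 1] by simp
  have cmu: "continuous_on {0..} \<mu>"
    by (rule lipschitz_on_continuous_on[of K])
      (use lip K in \<open>auto simp: lipschitz_on_def dist_real_def\<close>)
  define s0 where "s0 = (\<Sum>k<N. (l k)\<^sup>2 * (a k)\<^sup>2)"
  have s0: "0 \<le> s0" by (simp add: s0_def sum_nonneg)
  \<comment> \<open>\<open>H0\<close> bounds the Hamiltonian and hence the velocities, Gronwall's
    inequality turns this into a bound on the displacements, and the sum of the squared frequencies
    into the bound \<open>P\<close> on the stiffness. \<open>P\<close> may depend on
    \<open>N\<close>: it serves only the existence of one approximation.\<close>
  define H0 where "H0 = (\<Sum>k<N. (b k)\<^sup>2) + s0 * (\<mu> 0 + K * s0)"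
  define P where "P = (\<Sum>k<N. (l k)\<^sup>2) * (((\<Sum>k<N. (a k)\<^sup>2) + H0 * T) * exp (1 * T))"
  have H0: "0 \<le> H0" using s0 mu0[of 0] K by (simp add: H0_def sum_nonneg)
  have P: "0 \<le> P" using H0 T by (simp add: P_def sum_nonneg)
  define Q where "Q = sqrt P"
  have Q: "0 \<le> Q" "Q\<^sup>2 = P" using P by (auto simp: Q_def)
  define \<mu>' where "\<mu>' x = \<mu> (min x (Q\<^sup>2))" for x
  have cmu': "continuous_on {0..} \<mu>'"
    unfolding \<mu>'_def by (rule continuous_on_compose2[OF cmu]) (auto intro!: continuous_intros)
  have mu'0: "0 \<le> \<mu>' x" if "0 \<le> x" for x using that by (auto simp: \<mu>'_def intro: mu0)
  define A where "A = (\<Sum>j<N. l j)"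
  \<comment> \<open>First-order form of the system: the entries below \<open>N\<close> are the
    displacements, the next \<open>N\<close> the velocities.\<close>
  define F where "F t x i = (if i < N then x (N + i) else
     - (\<mu>' (\<Sum>j<N. (l j)\<^sup>2 * (x j)\<^sup>2) * (l (i - N))\<^sup>2 * x (i - N)))"
    for t :: real and x :: "nat \<Rightarrow> real" and i
  define C where "C = 1 + A\<^sup>2 * (3 * K * Q\<^sup>2 + \<mu> 0)"
  have C1: "1 \<le> C" using K mu0[of 0] by (simp add: C_def)
  have "\<exists>x. \<forall>i<N+N. x i 0 = (if i < N then a i else b (i - N)) \<and>
         (\<forall>t\<ge>0. (x i has_real_derivative F t (\<lambda>j. x j t) i) (at t within {0..}))"
  proof (rule picard_global[where K = "\<lambda>_. C"])
    fix t and x y :: "nat \<Rightarrow> real" and i assume i: "i < N + N"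
    let ?D = "\<Sum>j<N+N. \<bar>x j - y j\<bar>"
    show "\<bar>F t x i - F t y i\<bar> \<le> C * ?D"
    proof (cases "i < N")
      case True
      then have "\<bar>x (N + i) - y (N + i)\<bar> \<le> ?D"
        by (intro member_le_sum[of _ _ "\<lambda>j. \<bar>x j - y j\<bar>"]) auto
      also have "1 * ?D \<le> C * ?D" by (intro mult_right_mono C1 sum_nonneg) auto
      finally show ?thesis using True by (simp add: F_def)
    next
      case False
      then have k: "i - N < N" using i by simp
      have "\<bar>F t x i - F t y i\<bar> \<le> A\<^sup>2 * (3 * K * Q\<^sup>2 + \<mu> 0) * (\<Sum>j<N. \<bar>x j - y j\<bar>)"
        using truncated_force_lipschitz[OF mu0 lip l Q(1) k A_def, of x y] False
        by (simp add: F_def \<mu>'_def abs_minus_commute)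
      also have "\<dots> \<le> C * ?D"
        using K mu0[of 0] by (intro mult_mono sum_mono2 sum_nonneg) (auto simp: C_def)
      finally show ?thesis .
    qed
  next
    fix x :: "nat \<Rightarrow> real \<Rightarrow> real" and i assume x: "\<And>j. continuous_on {0..} (x j)" and "i < N + N"
    have "continuous_on {0..} (\<lambda>t. \<mu>' (\<Sum>j<N. (l j)\<^sup>2 * (x j t)\<^sup>2))"
      by (rule continuous_on_compose2[OF cmu'])
        (auto intro!: continuous_intros x sum_nonneg)
    then show "continuous_on {0..} (\<lambda>t. F t (\<lambda>j. x j t) i)"
      unfolding F_def using x by (cases "i < N") (auto intro!: continuous_intros)
  qed (use C1 in \<open>auto simp: F_def\<close>)
  then obtain x where x0: "\<And>i. i < N+N \<Longrightarrow> x i 0 = (if i < N then a i else b (i - N))"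
    and x': "\<And>i t. i < N+N \<Longrightarrow> 0 \<le> t \<Longrightarrow> (x i has_real_derivative F t (\<lambda>j. x j t) i) (at t within {0..})"
    by blast
  define U where "U = x"
  define V where "V k = x (N + k)" for k
  let ?s = "stiffness l N U"
  have U': "(U k has_real_derivative V k t) (at t within {0..})" if "k < N" "0 \<le> t" for k t
    using x'[of k t] that by (simp add: U_def V_def F_def)
  have V': "(V k has_real_derivative - (\<mu>' (?s t) * (l k)\<^sup>2 * U k t)) (at t within {0..})"
    if "k < N" "0 \<le> t" for k t
    using x'[of "N + k" t] that by (simp add: U_def V_def F_def stiffness_def)
  have ini: "U k 0 = a k" "V k 0 = b k" if "k < N" for k
    using x0[of k] x0[of "N + k"] that by (auto simp: U_def V_def)
  have s00: "?s 0 = s0" using ini by (simp add: stiffness_def s0_def)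
  have s': "(?s has_real_derivative (\<Sum>k<N. 2 * (l k)\<^sup>2 * U k t * V k t)) (at t within {0..})"
    if "0 \<le> t" for t by (rule stiffness_has_real_derivative) (use U' that in auto)
  let ?I = "\<lambda>x. integral {0..x} \<mu>'"
  let ?H = "\<lambda>t. (\<Sum>k<N. (V k t)\<^sup>2) + ?I (?s t)"
  have "(?H has_real_derivative 0) (at t within {0..})" if t: "t \<in> {0..}" for t
  proof -
    have "(?I has_real_derivative \<mu>' (?s t)) (at (?s t) within ?s ` {0..})"
      by (rule DERIV_subset[OF has_real_derivative_integral_Ici[OF cmu' stiffness_nonneg]])
        (auto simp: stiffness_nonneg)
    then have "(?I \<circ> ?s has_real_derivative \<mu>' (?s t) * (\<Sum>k<N. 2 * (l k)\<^sup>2 * U k t * V k t))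
        (at t within {0..})"
      using t by (intro DERIV_image_chain s') auto
    moreover have "((\<lambda>t. \<Sum>k<N. (V k t)\<^sup>2) has_real_derivative
        (\<Sum>k<N. 2 * V k t * (- (\<mu>' (?s t) * (l k)\<^sup>2 * U k t)))) (at t within {0..})"
      using t by (intro DERIV_sum) (auto intro!: derivative_eq_intros V')
    ultimately have "((\<lambda>t. (\<Sum>k<N. (V k t)\<^sup>2) + (?I \<circ> ?s) t) has_real_derivative
        (\<Sum>k<N. 2 * V k t * (- (\<mu>' (?s t) * (l k)\<^sup>2 * U k t))) +
        \<mu>' (?s t) * (\<Sum>k<N. 2 * (l k)\<^sup>2 * U k t * V k t)) (at t within {0..})"
      by (intro DERIV_add)
    moreover have "(\<Sum>k<N. 2 * V k t * (- (\<mu>' (?s t) * (l k)\<^sup>2 * U k t))) +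
        \<mu>' (?s t) * (\<Sum>k<N. 2 * (l k)\<^sup>2 * U k t * V k t) = 0"
      unfolding sum_distrib_left sum.distrib[symmetric] by (intro sum.neutral) (simp add: mult_ac)
    ultimately show ?thesis by simp
  qed
  then have "\<exists>c. \<forall>t\<in>{0..}. ?H t = c"
    by (intro has_field_derivative_zero_constant) auto
  then have H: "?H t = ?H 0" if "0 \<le> t" for t using that by fastforce
  have I0: "0 \<le> ?I x" if "0 \<le> x" for x
    by (intro integral_nonneg integrable_continuous_real continuous_on_subset[OF cmu'])
      (use mu'0 in auto)
  \<comment> \<open>This bound must not involve \<open>Q\<close>, since \<open>Q\<close> was chosen
    in terms of \<open>H0\<close>: below \<open>s0\<close> the truncated coefficient is at most
    \<open>\<mu> 0 + K * s0\<close> for every \<open>Q\<close>.\<close>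
  have "?I s0 \<le> integral {0..s0} (\<lambda>_. \<mu> 0 + K * s0)"
  proof (intro integral_le integrable_continuous_real continuous_on_subset[OF cmu'])
    fix x assume x: "x \<in> {0..s0}"
    have "\<mu>' x \<le> \<mu> 0 + K * \<bar>min x (Q\<^sup>2) - 0\<bar>"
      unfolding \<mu>'_def using lip[of "min x (Q\<^sup>2)" 0] x by (simp add: abs_le_iff)
    also have "\<dots> \<le> \<mu> 0 + K * s0" using K x by (intro add_left_mono mult_left_mono) auto
    finally show "\<mu>' x \<le> \<mu> 0 + K * s0" .
  qed auto
  then have "?H 0 \<le> H0" using ini s0 by (simp add: s00 H0_def)
  then have Vle: "(\<Sum>k<N. (V k t)\<^sup>2) \<le> H0" if "0 \<le> t" for t
    using H[OF that] I0[OF stiffness_nonneg[of l N U t]] by linarith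
  have sP: "?s t \<le> Q\<^sup>2" if t: "t \<in> {0..T}" for t
  proof -
    have "(\<Sum>k<N. (U k t)\<^sup>2) \<le> ((\<Sum>k<N. (U k 0)\<^sup>2) + H0 * t) * exp (1 * t)"
    proof (rule gronwall[where E' = "\<lambda>t. \<Sum>k<N. 2 * U k t * V k t" and T = T])
      fix r assume r: "r \<in> {0..T}"
      show "((\<lambda>t. \<Sum>k<N. (U k t)\<^sup>2) has_real_derivative (\<Sum>k<N. 2 * U k r * V k r)) (at r within {0..T})"
        using r by (intro DERIV_sum) (auto intro!: derivative_eq_intros DERIV_subset[OF U'])
      have "(\<Sum>k<N. 2 * U k r * V k r) \<le> (\<Sum>k<N. (U k r)\<^sup>2 + (V k r)\<^sup>2)"
        by (intro sum_mono sum_squares_bound)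
      then show "(\<Sum>k<N. 2 * U k r * V k r) \<le> 1 * (\<Sum>k<N. (U k r)\<^sup>2) + H0"
        using Vle[of r] r by (simp add: sum.distrib)
    qed (use H0 t in auto)
    also have "\<dots> \<le> ((\<Sum>k<N. (a k)\<^sup>2) + H0 * T) * exp (1 * T)"
      using t ini H0 T
      by (intro mult_mono add_mono mult_left_mono add_nonneg_nonneg mult_nonneg_nonneg sum_nonneg) auto
    finally have U2: "(\<Sum>k<N. (U k t)\<^sup>2) \<le> ((\<Sum>k<N. (a k)\<^sup>2) + H0 * T) * exp (1 * T)" .
    have "?s t \<le> (\<Sum>k<N. (\<Sum>k<N. (l k)\<^sup>2) * (U k t)\<^sup>2)"
      unfolding stiffness_def by (intro sum_mono mult_right_mono member_le_sum) auto
    also have "\<dots> = (\<Sum>k<N. (l k)\<^sup>2) * (\<Sum>k<N. (U k t)\<^sup>2)" by (simp add: sum_distrib_left)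
    also have "\<dots> \<le> P" unfolding P_def by (intro mult_left_mono U2 sum_nonneg) auto
    finally show ?thesis by (simp add: Q)
  qed
  have eq: "\<mu>' x = \<mu> x" if "x \<le> Q\<^sup>2" for x using that by (simp add: \<mu>'_def)
  have I_eq: "?I (?s t) = integral {0..?s t} \<mu>" if "t \<in> {0..T}" for t
    using sP[OF that] by (intro integral_cong eq) auto
  have "galerkin_solution \<mu> l a b N T U V"
    unfolding galerkin_solution_def
  proof (intro conjI ballI allI impI)
    fix k t assume t: "t \<in> {0..T}" and k: "k < N"
    show "(U k has_real_derivative V k t) (at t within {0..T})"
      using U'[OF k, of t] t by (auto intro: DERIV_subset)
    show "(V k has_real_derivative - (\<mu> (?s t) * (l k)\<^sup>2 * U k t)) (at t within {0..T})"
      using V'[OF k, of t] t eq[OF sP[OF t]] by (auto intro: DERIV_subset)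
  next
    fix t assume t: "t \<in> {0..T}"
    then show "(\<Sum>k<N. (V k t)\<^sup>2) + integral {0..?s t} \<mu> =
        (\<Sum>k<N. (b k)\<^sup>2) + integral {0..?s 0} \<mu>"
      using H[of t] I_eq[OF t] I_eq[of 0] T ini by simp
  qed (use ini in auto)
  then show ?thesis by blast
qed

section \<open>A priori estimates\<close>

text \<open>Bootstrap: at the first time where \<open>\<bar>g\<bar>\<close> equals \<open>B\<close>,
  the weak bound holds on the whole interval up to it, and \<open>step\<close> improves it to a
  strict one at that very time.\<close>

lemma first_exit:
  fixes g :: "real \<Rightarrow> real"
  assumes g: "continuous_on {0..T} g" and g0: "\<bar>g 0\<bar> < B"
    and step: "\<And>\<tau>. \<tau> \<in> {0..T} \<Longrightarrow> \<forall>t\<in>{0..\<tau>}. \<bar>g t\<bar> \<le> B \<Longrightarrow> \<bar>g \<tau>\<bar> < B"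
  shows "\<forall>t\<in>{0..T}. \<bar>g t\<bar> < B"
proof (rule ccontr)
  let ?S = "{0..T} \<inter> (\<lambda>t. \<bar>g t\<bar>) -` {B..}"
  assume "\<not> ?thesis"
  then have ne: "?S \<noteq> {}" by (auto simp: not_less)
  have "closed ?S"
    by (intro continuous_closed_preimage continuous_intros g)
  then have "compact ?S"
    by (metis compact_Icc compact_Int_closed inf.left_idem)
  then obtain \<tau> where tau: "\<tau> \<in> ?S" and min: "\<And>t. t \<in> ?S \<Longrightarrow> \<tau> \<le> t"
    using compact_attains_inf[OF _ ne] by blast
  have "continuous_on {0..\<tau>} (\<lambda>t. \<bar>g t\<bar>)"
    using tau by (intro continuous_intros continuous_on_subset[OF g]) auto
  then obtain x where x: "0 \<le> x" "x \<le> \<tau>" "\<bar>g x\<bar> = B"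
    using IVT'[of "\<lambda>t. \<bar>g t\<bar>" 0 B \<tau>] tau g0 by auto
  then have "x = \<tau>" using min[of x] tau by auto
  then have eq: "\<bar>g \<tau>\<bar> = B" using x by simp
  have "\<bar>g t\<bar> \<le> B" if "t \<in> {0..\<tau>}" for t
  proof (cases "t = \<tau>")
    case False
    then show ?thesis using min[of t] that tau by force
  qed (use eq in simp)
  then show False using step[of \<tau>] tau eq by auto
qed

lemma summable_if_summable_on:
  fixes f :: "nat \<Rightarrow> real"
  assumes "f summable_on S" and "\<And>k. k \<in> S \<Longrightarrow> 0 \<le> f k"
  shows "summable (\<lambda>k. if k \<in> S then f k else 0)"
proof -
  have "(\<lambda>k. if k \<in> S then f k else 0) summable_on UNIV"
    using assms(1) by (subst summable_on_cong_neutral[where T = S and g = f]) auto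
  then show ?thesis by (rule summable_on_imp_summable)
qed

text \<open>Both cases of the theorem in terms of Fourier coefficients: \<open>a\<close> and
  \<open>b\<close> are those of the data, \<open>l\<close> the frequencies, and \<open>p + 1\<close>
  is the exponent of the space of data. The strictly hyperbolic case has \<open>p = 1\<close>, the
  weakly hyperbolic one \<open>p = 2\<close> and \<open>\<nu> = 0\<close>. Assumption
  \<open>hf\<close> hides which energy estimate is in force, so that what follows is common to
  both.\<close>

locale kirchhoff_data =
  fixes a b l :: "nat \<Rightarrow> real" and \<omega> m \<phi> :: "real \<Rightarrow> real" and \<rho> :: "nat \<Rightarrow> real"
    and L \<nu> :: real and p :: nat
  assumes cm: "continuity_modulus \<omega>"
    and L: "0 \<le> L" and nu: "0 \<le> \<nu>" and l: "\<And>k. 0 \<le> l k"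
    and phi: "\<And>x. 0 \<le> x \<Longrightarrow> 0 < \<phi> x"
    and m_low: "\<And>x. 0 \<le> x \<Longrightarrow> \<nu> \<le> m x"
    and m_mod: "\<And>x y. 0 \<le> x \<Longrightarrow> 0 \<le> y \<Longrightarrow> \<bar>m x - m y\<bar> \<le> L * \<omega> \<bar>x - y\<bar>"
    and sum_a: "summable (\<lambda>k. (a k)\<^sup>2)" and sum_b: "summable (\<lambda>k. (b k)\<^sup>2)"
    and low_a: "\<And>r R. 0 < r \<Longrightarrow> (\<lambda>k. l k * (a k)\<^sup>2 * exp (r * \<phi> (l k))) summable_on {k. l k \<le> R}"
    and low_b: "\<And>r R. 0 < r \<Longrightarrow> (\<lambda>k. l k * (b k)\<^sup>2 * exp (r * \<phi> (l k))) summable_on {k. l k \<le> R}"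
    and rho: "filterlim \<rho> at_top sequentially"
    and high_a: "\<And>n. (\<lambda>k. l k ^ 3 * (a k)\<^sup>2 * exp (\<rho> n ^ (p + 1) * \<phi> (l k))) summable_on {k. l k > \<rho> n}"
    and high_a_le: "\<And>n. (\<Sum>\<^sub>\<infinity>k\<in>{k. l k > \<rho> n}. l k ^ 3 * (a k)\<^sup>2 * exp (\<rho> n ^ (p + 1) * \<phi> (l k))) \<le> \<rho> n"
    and high_b: "\<And>n. (\<lambda>k. l k * (b k)\<^sup>2 * exp (\<rho> n ^ (p + 1) * \<phi> (l k))) summable_on {k. l k > \<rho> n}"
    and high_b_le: "\<And>n. (\<Sum>\<^sub>\<infinity>k\<in>{k. l k > \<rho> n}. l k * (b k)\<^sup>2 * exp (\<rho> n ^ (p + 1) * \<phi> (l k))) \<le> \<rho> n"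
    and p: "p = 2 \<or> p = 1 \<and> 0 < \<nu>"
    and hf: "\<And>C0 T. 0 \<le> C0 \<Longrightarrow> 0 \<le> T \<Longrightarrow>
       \<exists>K0\<ge>0. \<exists>K1\<ge>0. \<exists>R0. high_frequency_estimate \<nu> \<omega> \<phi> L C0 T K0 K1 R0"
begin

lemmas w = continuity_modulusD[OF cm]

lemma rho_large: "\<exists>n. C \<le> \<rho> n"
  using rho unfolding filterlim_at_top eventually_sequentially by blast

text \<open>The weight joins the exponents 3/4 and 1/4 for the initial position with 1/4 for the
  initial velocity: the solution must also lie in the space with exponent 1/4, and at small
  frequencies the third power does not control the first.\<close>

definition D :: "nat \<Rightarrow> real" where
  "D k = (l k ^ 3 + l k) * (a k)\<^sup>2 + l k * (b k)\<^sup>2"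

lemma D_nonneg: "0 \<le> D k"
  using l[of k] by (simp add: D_def)

text \<open>Every exponent \<open>r\<close> is reached by taking \<open>n\<close> with
  \<open>\<rho> n \<ge> max r 1\<close>: beyond \<open>\<rho> n\<close> the data have the exponent
  \<open>\<rho> n ^ (p + 1)\<close>, and up to \<open>\<rho> n\<close> the low-frequency condition
  applies.\<close>

lemma D_summable:
  assumes r: "0 \<le> r"
  shows "summable (\<lambda>k. D k * exp (r * \<phi> (l k)))"
proof -
  obtain n where n: "max r 1 \<le> \<rho> n" using rho_large by blast
  define R where "R = \<rho> n"
  have R: "1 \<le> R" "r \<le> R" using n by (auto simp: R_def)
  have "r \<le> R ^ (p + 1)" using R power_increasing[of 1 "p + 1" R] by (simp del: power_Suc)
  then have er: "exp (r * \<phi> (l k)) \<le> exp (R ^ (p + 1) * \<phi> (l k))" for k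
    using phi[OF l[of k]] by (simp add: mult_right_mono)
  \<comment> \<open>The low-frequency condition asks for a positive exponent, while \<open>r\<close>
    may be 0.\<close>
  have er1: "exp (r * \<phi> (l k)) \<le> exp ((r + 1) * \<phi> (l k))" for k
    using phi[OF l[of k]] by (simp add: mult_right_mono)
  let ?fa = "\<lambda>k. if l k \<le> R then l k * (a k)\<^sup>2 * exp ((r + 1) * \<phi> (l k)) else 0"
  let ?fb = "\<lambda>k. if l k \<le> R then l k * (b k)\<^sup>2 * exp ((r + 1) * \<phi> (l k)) else 0"
  let ?ga = "\<lambda>k. if R < l k then l k ^ 3 * (a k)\<^sup>2 * exp (R ^ (p + 1) * \<phi> (l k)) else 0"
  let ?gb = "\<lambda>k. if R < l k then l k * (b k)\<^sup>2 * exp (R ^ (p + 1) * \<phi> (l k)) else 0"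
  have sa: "summable ?fa" "summable ?fb"
    using summable_if_summable_on[OF low_a[of "r + 1" R]]
      summable_if_summable_on[OF low_b[of "r + 1" R]] r l by auto
  have sg: "summable ?ga" "summable ?gb"
    using summable_if_summable_on[OF high_a[of n]] summable_if_summable_on[OF high_b[of n]]
    unfolding R_def by (simp_all add: l)
  have "summable (\<lambda>k. (1 + R\<^sup>2) * ?fa k + ?fb k + 2 * ?ga k + ?gb k)"
    by (intro summable_add summable_mult sa sg)
  then show ?thesis
  proof (rule summable_comparison_test'[where N = 0])
    fix k
    let ?e = "exp (r * \<phi> (l k))" and ?e1 = "exp ((r + 1) * \<phi> (l k))"
    let ?eR = "exp (R ^ (p + 1) * \<phi> (l k))"
    have "D k * ?e \<le> (1 + R\<^sup>2) * ?fa k + ?fb k + 2 * ?ga k + ?gb k"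
    proof (cases "l k \<le> R")
      case True
      have "l k ^ 3 = l k * (l k)\<^sup>2" by (simp add: power2_eq_square power3_eq_cube)
      also have "\<dots> \<le> l k * R\<^sup>2" using l[of k] True by (intro mult_left_mono power_mono) auto
      finally have "(l k ^ 3 + l k) * (a k)\<^sup>2 \<le> (1 + R\<^sup>2) * l k * (a k)\<^sup>2"
        by (intro mult_right_mono) (auto simp: algebra_simps)
      then have "D k \<le> (1 + R\<^sup>2) * l k * (a k)\<^sup>2 + l k * (b k)\<^sup>2" by (simp add: D_def)
      then have "D k * ?e \<le> ((1 + R\<^sup>2) * l k * (a k)\<^sup>2 + l k * (b k)\<^sup>2) * ?e1"
        using er1[of k] l[of k] by (intro mult_mono) auto
      then show ?thesis using True by (simp add: distrib_right mult.assoc)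
    next
      case False
      then have l1: "1 \<le> l k" using R by simp
      have "l k ^ 1 \<le> l k ^ 3" by (intro power_increasing l1) auto
      then have "(l k ^ 3 + l k) * (a k)\<^sup>2 \<le> 2 * l k ^ 3 * (a k)\<^sup>2"
        by (intro mult_right_mono) auto
      then have "D k \<le> 2 * l k ^ 3 * (a k)\<^sup>2 + l k * (b k)\<^sup>2" by (simp add: D_def)
      then have "D k * ?e \<le> (2 * l k ^ 3 * (a k)\<^sup>2 + l k * (b k)\<^sup>2) * ?eR"
        using er[of k] l[of k] by (intro mult_mono) auto
      then show ?thesis using False by (simp add: distrib_right mult.assoc)
    qed
    then show "norm (D k * ?e) \<le> (1 + R\<^sup>2) * ?fa k + ?fb k + 2 * ?ga k + ?gb k"
      using D_nonneg[of k] by (simp add: abs_mult)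
  qed
qed

text \<open>Interpolation: the norms with exponents 0 and 3/4 together control the exponent 1/2,
  that is, the stiffness.\<close>

lemma l2_le: "(l k)\<^sup>2 \<le> 1 + l k ^ 3"
proof (cases "l k \<le> 1")
  case True
  then have "(l k)\<^sup>2 \<le> 1" using l[of k] by (simp add: power_le_one)
  then show ?thesis using zero_le_power[OF l[of k], of 3] by linarith
next
  case False
  then have "(l k)\<^sup>2 \<le> l k ^ 3" by (intro power_increasing) auto
  then show ?thesis by simp
qed

lemma S0_summable: "summable (\<lambda>k. (l k)\<^sup>2 * (a k)\<^sup>2)"
proof (rule summable_comparison_test'[where N = 0])
  show "summable (\<lambda>k. (a k)\<^sup>2 + D k)"
    using D_summable[of 0] by (intro summable_add sum_a) simp
  fix k
  have "(l k)\<^sup>2 * (a k)\<^sup>2 \<le> (1 + l k ^ 3) * (a k)\<^sup>2" by (intro mult_right_mono l2_le) auto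
  also have "\<dots> \<le> (a k)\<^sup>2 + D k" using l[of k] by (simp add: D_def algebra_simps)
  finally show "norm ((l k)\<^sup>2 * (a k)\<^sup>2) \<le> (a k)\<^sup>2 + D k" by simp
qed

text \<open>These three constants bound the initial stiffness, the initial coefficient and the
  Hamiltonian, uniformly over the number of modes and the admissible nonlinearities.\<close>

definition S0 :: real where "S0 = (\<Sum>k. (l k)\<^sup>2 * (a k)\<^sup>2)"
definition C0 :: real where "C0 = m 0 + L * \<omega> S0 + L * \<omega> 1"
definition H0 :: real where "H0 = (\<Sum>k. (b k)\<^sup>2) + S0 * C0"

text \<open>The first branch bounds the sum of the squares of all \<open>U k\<close> and
  \<open>V k\<close>; the second, where \<open>\<nu>\<close> is positive, bounds the stiffness plus
  the sum of the squares of all \<open>V k\<close>.\<close>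

definition low_const :: "real \<Rightarrow> real" where
  "low_const T = (if p = 2 then ((\<Sum>k. (a k)\<^sup>2) + H0 * T) * exp T + H0 else H0 / \<nu> + H0)"

text \<open>The class contains \<open>m\<close> and its averages over lengths up to 1, which
  explains \<open>\<omega> 1\<close>. The a priori bounds are uniform over it.\<close>

definition admissible :: "(real \<Rightarrow> real) \<Rightarrow> bool" where
  "admissible \<mu> \<longleftrightarrow> (\<forall>x\<ge>0. \<nu> \<le> \<mu> x \<and> \<bar>\<mu> x - m x\<bar> \<le> L * \<omega> 1) \<and>
     (\<forall>x\<ge>0. \<forall>y\<ge>0. \<bar>\<mu> x - \<mu> y\<bar> \<le> L * \<omega> \<bar>x - y\<bar>)"

lemma S0_nonneg: "0 \<le> S0"
  unfolding S0_def by (intro suminf_nonneg S0_summable) auto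

lemma C0_nonneg: "0 \<le> C0"
  using m_low[of 0] nu L w(5)[OF S0_nonneg] w(5)[of 1] by (simp add: C0_def)

lemma H0_nonneg: "0 \<le> H0"
  using S0_nonneg C0_nonneg sum_b by (simp add: H0_def suminf_nonneg)

lemma admissible_continuous:
  assumes "admissible \<mu>"
  shows "continuous_on {0..} \<mu>"
  unfolding continuous_on
proof
  fix x :: real assume x: "x \<in> {0..}"
  have "continuous_on {0..} (\<lambda>s. L * \<omega> \<bar>s - x\<bar>)"
    by (intro continuous_intros continuous_on_compose2[OF w(1)]) auto
  then have "((\<lambda>s. L * \<omega> \<bar>s - x\<bar>) \<longlongrightarrow> 0) (at x within {0..})"
    using x w(3) unfolding continuous_on by (force dest: bspec[of _ _ x])
  then have "((\<lambda>s. \<mu> s - \<mu> x) \<longlongrightarrow> 0) (at x within {0..})"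
    by (rule Lim_null_comparison[rotated])
      (use assms x in \<open>auto simp: eventually_at_filter admissible_def\<close>)
  then show "(\<mu> \<longlongrightarrow> \<mu> x) (at x within {0..})" by (simp add: LIM_zero_iff)
qed

lemma admissible_m: "admissible m"
  using m_low m_mod L w(5)[of 1] by (simp add: admissible_def)

lemma admissible_le_C0:
  assumes "admissible \<mu>" "0 \<le> x" "x \<le> S0"
  shows "\<mu> x \<le> C0"
proof -
  have "\<mu> x \<le> m x + L * \<omega> 1" using assms unfolding admissible_def by (auto simp: abs_le_iff)
  moreover have "m x \<le> m 0 + L * \<omega> \<bar>x - 0\<bar>" using m_mod[of x 0] assms by (simp add: abs_le_iff)
  moreover have "L * \<omega> \<bar>x - 0\<bar> \<le> L * \<omega> S0" using assms L by (intro mult_left_mono w) auto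
  ultimately show ?thesis by (simp add: C0_def)
qed

section \<open>Estimates for a single Galerkin solution\<close>

context
  fixes \<mu> N T U V
  assumes adm: "admissible \<mu>" and sol: "galerkin_solution \<mu> l a b N T U V" and T: "0 \<le> T"
begin

abbreviation "stiff \<equiv> stiffness l N U"

lemma galerkin_initial: "k < N \<Longrightarrow> U k 0 = a k" "k < N \<Longrightarrow> V k 0 = b k"
  using sol by (auto simp: galerkin_solution_def)

lemma s0_le: "stiff 0 \<le> S0"
proof -
  have "stiff 0 = (\<Sum>k<N. (l k)\<^sup>2 * (a k)\<^sup>2)" by (simp add: stiffness_def galerkin_initial)
  also have "\<dots> \<le> S0" unfolding S0_def by (intro sum_le_suminf S0_summable) auto
  finally show ?thesis .
qed

lemma galerkin_derivs:
  assumes "t \<in> {0..\<tau>}" "\<tau> \<le> T" "k < N"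
  shows "(U k has_real_derivative V k t) (at t within {0..\<tau>})"
    "(V k has_real_derivative - (\<mu> (stiff t) * (l k)\<^sup>2 * U k t)) (at t within {0..\<tau>})"
proof -
  have t: "t \<in> {0..T}" and sub: "{0..\<tau>} \<subseteq> {0..T}" using assms by auto
  have "(U k has_real_derivative V k t) (at t within {0..T})"
    "(V k has_real_derivative - (\<mu> (stiff t) * (l k)\<^sup>2 * U k t)) (at t within {0..T})"
    using sol t assms(3) unfolding galerkin_solution_def by blast+
  then show "(U k has_real_derivative V k t) (at t within {0..\<tau>})"
    "(V k has_real_derivative - (\<mu> (stiff t) * (l k)\<^sup>2 * U k t)) (at t within {0..\<tau>})"
    using sub DERIV_subset by blast+
qed

text \<open>Conservation of the Hamiltonian together with \<open>\<mu> \<ge> \<nu>\<close> gives the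
  first two bounds. The second is void for \<open>\<nu> = 0\<close>; then the third, obtained from
  the velocities by Gronwall's inequality, takes its place, at the price of depending on
  \<open>T\<close>.\<close>

lemma energy_bounds:
  assumes t: "t \<in> {0..T}"
  shows "(\<Sum>k<N. (V k t)\<^sup>2) \<le> H0" "\<nu> * stiff t \<le> H0"
    "(\<Sum>k<N. (U k t)\<^sup>2) \<le> ((\<Sum>k. (a k)\<^sup>2) + H0 * T) * exp T"
proof -
  note c = continuous_on_subset[OF admissible_continuous[OF adm]]
  have Ic: "integral {0..stiff t} (\<lambda>_. x) = stiff t * x" for t x
    using stiffness_nonneg[of l N U t] by simp
  have b: "(\<Sum>k<N. (b k)\<^sup>2) \<le> (\<Sum>k. (b k)\<^sup>2)" using sum_b by (intro sum_le_suminf) auto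
  have "integral {0..stiff 0} \<mu> \<le> integral {0..stiff 0} (\<lambda>_. C0)"
    using s0_le by (intro integral_le integrable_continuous_real c) (auto intro: admissible_le_C0[OF adm])
  also have "\<dots> \<le> S0 * C0" unfolding Ic using s0_le C0_nonneg by (intro mult_right_mono)
  finally have I0: "integral {0..stiff 0} \<mu> \<le> S0 * C0" .
  have H: "(\<Sum>k<N. (V k t)\<^sup>2) + \<nu> * stiff t \<le> H0" if "t \<in> {0..T}" for t
  proof -
    have "integral {0..stiff t} (\<lambda>_. \<nu>) \<le> integral {0..stiff t} \<mu>"
      using adm by (intro integral_le integrable_continuous_real c) (auto simp: admissible_def)
    then have "\<nu> * stiff t \<le> integral {0..stiff t} \<mu>" unfolding Ic by (simp only: mult.commute)
    moreover have "(\<Sum>k<N. (V k t)\<^sup>2) + integral {0..stiff t} \<mu> =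
        (\<Sum>k<N. (b k)\<^sup>2) + integral {0..stiff 0} \<mu>"
      using sol that unfolding galerkin_solution_def by blast
    ultimately show ?thesis using I0 b unfolding H0_def by linarith
  qed
  have V: "(\<Sum>k<N. (V k t)\<^sup>2) \<le> H0" if "t \<in> {0..T}" for t
  proof -
    have "0 \<le> \<nu> * stiff t" using nu stiffness_nonneg[of l N U] by simp
    then show ?thesis using H[OF that] by linarith
  qed
  show "(\<Sum>k<N. (V k t)\<^sup>2) \<le> H0" by (rule V[OF t])
  show "\<nu> * stiff t \<le> H0" using H[OF t] sum_nonneg[of "{..<N}" "\<lambda>k. (V k t)\<^sup>2"] by simp
  have "(\<Sum>k<N. (U k t)\<^sup>2) \<le> ((\<Sum>k<N. (U k 0)\<^sup>2) + H0 * t) * exp (1 * t)"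
  proof (rule gronwall[where E' = "\<lambda>t. \<Sum>k<N. 2 * U k t * V k t" and T = T])
    fix r assume r: "r \<in> {0..T}"
    show "((\<lambda>t. \<Sum>k<N. (U k t)\<^sup>2) has_real_derivative (\<Sum>k<N. 2 * U k r * V k r)) (at r within {0..T})"
      using r by (intro DERIV_sum) (auto intro!: derivative_eq_intros galerkin_derivs)
    have "(\<Sum>k<N. 2 * U k r * V k r) \<le> (\<Sum>k<N. (U k r)\<^sup>2 + (V k r)\<^sup>2)"
      by (intro sum_mono sum_squares_bound)
    then show "(\<Sum>k<N. 2 * U k r * V k r) \<le> 1 * (\<Sum>k<N. (U k r)\<^sup>2) + H0"
      using V[of r] r by (simp add: sum.distrib)
  qed (use H0_nonneg t in auto)
  also have "\<dots> \<le> ((\<Sum>k. (a k)\<^sup>2) + H0 * T) * exp T"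
  proof (intro mult_mono add_mono mult_left_mono)
    show "(\<Sum>k<N. (U k 0)\<^sup>2) \<le> (\<Sum>k. (a k)\<^sup>2)"
      using sum_a by (simp add: galerkin_initial sum_le_suminf)
    show "0 \<le> (\<Sum>k. (a k)\<^sup>2) + H0 * T" using sum_a H0_nonneg T by (simp add: suminf_nonneg)
  qed (use t H0_nonneg in auto)
  finally show "(\<Sum>k<N. (U k t)\<^sup>2) \<le> ((\<Sum>k. (a k)\<^sup>2) + H0 * T) * exp T" .
qed

text \<open>With \<open>p = 2\<close> only \<open>U k\<close> and \<open>V k\<close> are controlled,
  and both factors \<open>l k\<close> are spent as \<open>R\<^sup>2\<close>. With
  \<open>p = 1\<close> the stiffness is controlled too: one factor goes with \<open>U k\<close>, and
  a single \<open>R\<close> remains.\<close>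

lemma low_frequency_bound:
  assumes t: "t \<in> {0..T}" and R: "1 \<le> R"
  shows "(\<Sum>k | k < N \<and> l k \<le> R. \<bar>2 * (l k)\<^sup>2 * U k t * V k t\<bar>) \<le> low_const T * R ^ p"
proof -
  let ?S = "{k. k < N \<and> l k \<le> R}"
  have S: "?S \<subseteq> {..<N}" "finite ?S" by auto
  show ?thesis
  proof (cases "p = 2")
    case True
    have "(\<Sum>k\<in>?S. \<bar>2 * (l k)\<^sup>2 * U k t * V k t\<bar>) \<le> (\<Sum>k\<in>?S. R\<^sup>2 * ((U k t)\<^sup>2 + (V k t)\<^sup>2))"
    proof (rule sum_mono)
      fix k assume k: "k \<in> ?S"
      have "\<bar>2 * (l k)\<^sup>2 * U k t * V k t\<bar> = (l k)\<^sup>2 * (2 * \<bar>U k t\<bar> * \<bar>V k t\<bar>)"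
        by (simp add: abs_mult)
      also have "\<dots> \<le> R\<^sup>2 * (\<bar>U k t\<bar>\<^sup>2 + \<bar>V k t\<bar>\<^sup>2)"
        using k l[of k] by (intro mult_mono power_mono sum_squares_bound) auto
      finally show "\<bar>2 * (l k)\<^sup>2 * U k t * V k t\<bar> \<le> R\<^sup>2 * ((U k t)\<^sup>2 + (V k t)\<^sup>2)" by simp
    qed
    also have "\<dots> \<le> (\<Sum>k<N. R\<^sup>2 * ((U k t)\<^sup>2 + (V k t)\<^sup>2))" by (intro sum_mono2 S) auto
    also have "\<dots> = R\<^sup>2 * ((\<Sum>k<N. (U k t)\<^sup>2) + (\<Sum>k<N. (V k t)\<^sup>2))"
      by (simp add: sum.distrib sum_distrib_left distrib_left)
    also have "\<dots> \<le> R\<^sup>2 * low_const T"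
      using energy_bounds[OF t] unfolding low_const_def if_P[OF True]
      by (intro mult_left_mono add_mono) auto
    finally show ?thesis using True by (simp add: mult.commute)
  next
    case False
    with p have p1: "p = 1" and nu0: "0 < \<nu>" by auto
    have "(\<Sum>k\<in>?S. \<bar>2 * (l k)\<^sup>2 * U k t * V k t\<bar>) \<le> (\<Sum>k\<in>?S. R * ((l k)\<^sup>2 * (U k t)\<^sup>2 + (V k t)\<^sup>2))"
    proof (rule sum_mono)
      fix k assume k: "k \<in> ?S"
      have "\<bar>2 * (l k)\<^sup>2 * U k t * V k t\<bar> = l k * (2 * \<bar>l k * U k t\<bar> * \<bar>V k t\<bar>)"
        using l[of k] by (simp add: abs_mult power2_eq_square)
      also have "\<dots> \<le> R * (\<bar>l k * U k t\<bar>\<^sup>2 + \<bar>V k t\<bar>\<^sup>2)"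
        using k l[of k] R by (intro mult_mono sum_squares_bound) auto
      finally show "\<bar>2 * (l k)\<^sup>2 * U k t * V k t\<bar> \<le> R * ((l k)\<^sup>2 * (U k t)\<^sup>2 + (V k t)\<^sup>2)"
        by (simp add: power_mult_distrib)
    qed
    also have "\<dots> \<le> (\<Sum>k<N. R * ((l k)\<^sup>2 * (U k t)\<^sup>2 + (V k t)\<^sup>2))"
      using R by (intro sum_mono2 S) auto
    also have "\<dots> = R * (stiff t + (\<Sum>k<N. (V k t)\<^sup>2))"
      by (simp add: stiffness_def sum.distrib sum_distrib_left distrib_left)
    also have "\<dots> \<le> R * low_const T"
      using energy_bounds[OF t] nu0 R unfolding low_const_def if_not_P[OF False]
      by (intro mult_left_mono add_mono) (auto simp: field_simps)
    finally show ?thesis using p1 by (simp add: mult.commute)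
  qed
qed

lemma coefficient_modulus:
  assumes B: "0 \<le> B" and lip: "\<forall>x\<in>{0..\<tau>}. \<forall>y\<in>{0..\<tau>}. \<bar>stiff x - stiff y\<bar> \<le> B * \<bar>x - y\<bar>"
    and xy: "x \<in> {0..\<tau>}" "y \<in> {0..\<tau>}"
  shows "\<bar>\<mu> (stiff x) - \<mu> (stiff y)\<bar> \<le> L * (1 + B) * \<omega> \<bar>x - y\<bar>"
proof -
  have "\<bar>\<mu> (stiff x) - \<mu> (stiff y)\<bar> \<le> L * \<omega> \<bar>stiff x - stiff y\<bar>"
    using adm by (auto simp: admissible_def stiffness_nonneg)
  also have "\<omega> \<bar>stiff x - stiff y\<bar> \<le> \<omega> (B * \<bar>x - y\<bar>)" using lip xy by (intro w) auto
  also have "\<dots> \<le> (1 + B) * \<omega> \<bar>x - y\<bar>" by (intro continuity_modulus_mult cm B) auto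
  finally show ?thesis using L by (simp add: mult_left_mono mult.assoc)
qed

lemma high_frequency_bound:
  assumes hf: "high_frequency_estimate \<nu> \<omega> \<phi> L C0 T K0 K1 R0"
    and B: "0 \<le> B" and lip: "\<forall>x\<in>{0..\<tau>}. \<forall>y\<in>{0..\<tau>}. \<bar>stiff x - stiff y\<bar> \<le> B * \<bar>x - y\<bar>"
    and tau: "\<tau> \<le> T" and t: "t \<in> {0..\<tau>}" and k: "k < N" "R0 < l k"
  shows "l k ^ 3 * (U k t)\<^sup>2 + l k * (V k t)\<^sup>2 \<le>
    K0 * exp (K1 * (1 + B) * \<phi> (l k)) * (l k ^ 3 * (a k)\<^sup>2 + l k * (b k)\<^sup>2)"
proof -
  have 1: "\<forall>t\<in>{0..\<tau>}. \<nu> \<le> \<mu> (stiff t)" using adm by (simp add: admissible_def stiffness_nonneg)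
  have 2: "\<mu> (stiff 0) \<le> C0" by (intro admissible_le_C0 adm s0_le stiffness_nonneg)
  have 3: "\<forall>x\<in>{0..\<tau>}. \<forall>y\<in>{0..\<tau>}. \<bar>\<mu> (stiff x) - \<mu> (stiff y)\<bar> \<le> L * (1 + B) * \<omega> \<bar>x - y\<bar>"
    using coefficient_modulus[OF B lip] by blast
  have 4: "\<forall>t\<in>{0..\<tau>}. (U k has_real_derivative V k t) (at t within {0..\<tau>}) \<and>
        (V k has_real_derivative - (\<mu> (stiff t) * (l k)\<^sup>2 * U k t)) (at t within {0..\<tau>})"
    using galerkin_derivs tau k by blast
  have "0 \<le> \<tau>" using t by simp
  then have "\<forall>t\<in>{0..\<tau>}. l k ^ 3 * (U k t)\<^sup>2 + l k * (V k t)\<^sup>2 \<le>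
    K0 * exp (K1 * (1 + B) * \<phi> (l k)) * (l k ^ 3 * (U k 0)\<^sup>2 + l k * (V k 0)\<^sup>2)"
    by (intro hf[unfolded high_frequency_estimate_def, THEN spec, of B, THEN spec,
          of "\<lambda>t. \<mu> (stiff t)", THEN spec, of "U k", THEN spec, of "V k", THEN spec, of "l k",
          THEN spec, of \<tau>, THEN mp, THEN mp, THEN mp, THEN mp, THEN mp, THEN mp, THEN mp, THEN mp]
        B k(2) tau 1 2 3 4)
  then show ?thesis using t galerkin_initial k by simp
qed

text \<open>The stiffness cannot become steeper than \<open>B\<close>: as long as it is not, the components
  above \<open>\<rho> n\<close> contribute at most \<open>2 * K0 * \<rho> n\<close> to its derivative, by the choice of the
  data, and those below at most \<open>low_const T * \<rho> n ^ p\<close>.\<close>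

lemma stiffness_lipschitz:
  assumes hf: "high_frequency_estimate \<nu> \<omega> \<phi> L C0 T K0 K1 R0"
    and K0: "0 \<le> K0"
    and n: "1 \<le> \<rho> n" "R0 \<le> \<rho> n" and B: "0 < B"
    and BK: "(low_const T + 2 * K0) * \<rho> n ^ p < B"
    and K1B: "K1 * (1 + B) \<le> \<rho> n ^ (p + 1)"
  shows "\<forall>x\<in>{0..T}. \<forall>y\<in>{0..T}. \<bar>stiff x - stiff y\<bar> \<le> B * \<bar>x - y\<bar>"
proof -
  let ?R = "\<rho> n"
  let ?g = "\<lambda>t. \<Sum>k<N. 2 * (l k)\<^sup>2 * U k t * V k t"
  have s': "(stiff has_real_derivative ?g t) (at t within {0..\<tau>})" if "t \<in> {0..\<tau>}" "\<tau> \<le> T" for t \<tau>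
    by (rule stiffness_has_real_derivative) (use that galerkin_derivs in blast)
  have cU: "continuous_on {0..T} (U k)" "continuous_on {0..T} (V k)" if "k < N" for k
    using DERIV_continuous_on[of "{0..T}" "U k" "V k", OF galerkin_derivs(1)[OF _ order_refl that]]
      DERIV_continuous_on[of "{0..T}" "V k", OF galerkin_derivs(2)[OF _ order_refl that]] by auto
  have cg: "continuous_on {0..T} ?g" by (intro continuous_intros cU) auto
  have step: "\<bar>?g \<tau>\<bar> < B" if tau: "\<tau> \<in> {0..T}"
    and lip: "\<forall>x\<in>{0..\<tau>}. \<forall>y\<in>{0..\<tau>}. \<bar>stiff x - stiff y\<bar> \<le> B * \<bar>x - y\<bar>" for \<tau>
  proof -
    let ?H = "{k. k < N \<and> ?R < l k}"
    have "\<bar>?g \<tau>\<bar> \<le> (\<Sum>k<N. \<bar>2 * (l k)\<^sup>2 * U k \<tau> * V k \<tau>\<bar>)" by (rule sum_abs)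
    also have "(\<Sum>k<N. \<bar>2 * (l k)\<^sup>2 * U k \<tau> * V k \<tau>\<bar>) =
        (\<Sum>k | k < N \<and> l k \<le> ?R. \<bar>2 * (l k)\<^sup>2 * U k \<tau> * V k \<tau>\<bar>) +
        (\<Sum>k\<in>?H. \<bar>2 * (l k)\<^sup>2 * U k \<tau> * V k \<tau>\<bar>)"
      by (subst sum.union_disjoint[symmetric]) (auto intro: sum.cong)
    also have "\<dots> \<le> low_const T * ?R ^ p + (\<Sum>k\<in>?H. \<bar>2 * (l k)\<^sup>2 * U k \<tau> * V k \<tau>\<bar>)"
      by (intro add_right_mono low_frequency_bound tau n)
    also have "(\<Sum>k\<in>?H. \<bar>2 * (l k)\<^sup>2 * U k \<tau> * V k \<tau>\<bar>) \<le>
        (\<Sum>k\<in>?H. K0 * (l k ^ 3 * (a k)\<^sup>2 * exp (?R ^ (p + 1) * \<phi> (l k)) +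
          l k * (b k)\<^sup>2 * exp (?R ^ (p + 1) * \<phi> (l k))))"
    proof (rule sum_mono)
      fix k assume k: "k \<in> ?H"
      have "\<bar>2 * (l k)\<^sup>2 * U k \<tau> * V k \<tau>\<bar> = l k * (2 * \<bar>l k * U k \<tau>\<bar> * \<bar>V k \<tau>\<bar>)"
        using l[of k] by (simp add: abs_mult power2_eq_square)
      also have "\<dots> \<le> l k * (\<bar>l k * U k \<tau>\<bar>\<^sup>2 + \<bar>V k \<tau>\<bar>\<^sup>2)"
        using l[of k] by (intro mult_left_mono sum_squares_bound) auto
      also have "\<dots> = l k ^ 3 * (U k \<tau>)\<^sup>2 + l k * (V k \<tau>)\<^sup>2"
        by (simp add: power_mult_distrib distrib_left power2_eq_square power3_eq_cube)
      also have "\<dots> \<le> K0 * exp (K1 * (1 + B) * \<phi> (l k)) * (l k ^ 3 * (a k)\<^sup>2 + l k * (b k)\<^sup>2)"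
        using tau k n B by (intro high_frequency_bound[OF hf _ lip]) auto
      \<comment> \<open>Here the loss \<open>K1 * (1 + B)\<close> is paid out of the exponent that
        the data grant above \<open>\<rho> n\<close>.\<close>
      also have "\<dots> \<le> K0 * exp (?R ^ (p + 1) * \<phi> (l k)) * (l k ^ 3 * (a k)\<^sup>2 + l k * (b k)\<^sup>2)"
        using K0 l[of k] phi[OF l[of k]] K1B
        by (intro mult_right_mono mult_left_mono) (auto intro!: mult_right_mono simp del: power_Suc)
      finally show "\<bar>2 * (l k)\<^sup>2 * U k \<tau> * V k \<tau>\<bar> \<le>
        K0 * (l k ^ 3 * (a k)\<^sup>2 * exp (?R ^ (p + 1) * \<phi> (l k)) +
          l k * (b k)\<^sup>2 * exp (?R ^ (p + 1) * \<phi> (l k)))"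
        by (simp only: distrib_left mult_ac)
    qed
    also have "\<dots> = K0 * ((\<Sum>k\<in>?H. l k ^ 3 * (a k)\<^sup>2 * exp (?R ^ (p + 1) * \<phi> (l k))) +
          (\<Sum>k\<in>?H. l k * (b k)\<^sup>2 * exp (?R ^ (p + 1) * \<phi> (l k))))"
      by (simp add: sum.distrib sum_distrib_left distrib_left)
    \<comment> \<open>These are partial sums of the series defining the space of data, so the bound
      \<open>\<rho> n\<close> is the same for every \<open>N\<close>.\<close>
    also have "\<dots> \<le> K0 * (?R + ?R)"
    proof (intro mult_left_mono add_mono K0)
      show "(\<Sum>k\<in>?H. l k ^ 3 * (a k)\<^sup>2 * exp (?R ^ (p + 1) * \<phi> (l k))) \<le> ?R"
        by (rule order_trans[OF finite_sum_le_infsum[OF high_a] high_a_le]) (use l in auto)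
      show "(\<Sum>k\<in>?H. l k * (b k)\<^sup>2 * exp (?R ^ (p + 1) * \<phi> (l k))) \<le> ?R"
        by (rule order_trans[OF finite_sum_le_infsum[OF high_b] high_b_le]) (use l in auto)
    qed
    also have "\<dots> = 2 * K0 * ?R" by simp
    also have "\<dots> \<le> 2 * K0 * ?R ^ p"
      using K0 n p power_increasing[of 1 p ?R] by (intro mult_left_mono) auto
    also have "low_const T * ?R ^ p + 2 * K0 * ?R ^ p = (low_const T + 2 * K0) * ?R ^ p"
      by (simp add: distrib_right)
    also note BK
    finally show ?thesis by simp
  qed
  have lip: "\<forall>x\<in>{0..\<tau>}. \<forall>y\<in>{0..\<tau>}. \<bar>stiff x - stiff y\<bar> \<le> B * \<bar>x - y\<bar>"
    if "\<tau> \<le> T" "\<forall>t\<in>{0..\<tau>}. \<bar>?g t\<bar> \<le> B" for \<tau>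
    using field_differentiable_bound[of "{0..\<tau>}" stiff ?g B] s' that by auto
  have "\<forall>t\<in>{0..T}. \<bar>?g t\<bar> < B"
  proof (rule first_exit[OF cg])
    \<comment> \<open>On the degenerate interval [0, 0] the Lipschitz assumption of
      \<open>step\<close> is trivial, so the bootstrap starts without further data.\<close>
    show "\<bar>?g 0\<bar> < B" by (rule step) (use T in auto)
    show "\<bar>?g \<tau>\<bar> < B" if "\<tau> \<in> {0..T}" "\<forall>t\<in>{0..\<tau>}. \<bar>?g t\<bar> \<le> B" for \<tau>
      using that by (intro step lip) auto
  qed
  then show ?thesis by (intro lip) (auto intro: less_imp_le)
qed

end

text \<open>The order of the quantifiers matters: \<open>B\<close>, \<open>P\<close> and
  \<open>Q\<close> depend on \<open>T\<close> but not on \<open>\<mu>\<close> or \<open>N\<close>.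
  The bound \<open>B\<close> gives equicontinuity of the stiffness, while \<open>P\<close> and
  \<open>Q\<close> serve as dominating series in the limit.\<close>

lemma a_priori:
  assumes T: "0 \<le> T"
  shows "\<exists>B P Q. 0 \<le> B \<and> (\<forall>k. 0 \<le> P k \<and> 0 \<le> Q k) \<and> (\<forall>r\<ge>0. summable (\<lambda>k. P k * exp (r * \<phi> (l k)))) \<and> summable Q \<and>
    (\<forall>\<mu> N U V. admissible \<mu> \<longrightarrow> galerkin_solution \<mu> l a b N T U V \<longrightarrow>
      (\<forall>x\<in>{0..T}. \<forall>y\<in>{0..T}. \<bar>stiffness l N U x - stiffness l N U y\<bar> \<le> B * \<bar>x - y\<bar>) \<and>
      (\<forall>t\<in>{0..T}. \<forall>k<N. (l k ^ 3 + l k) * (U k t)\<^sup>2 + l k * (V k t)\<^sup>2 \<le> P k \<and>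
         (U k t)\<^sup>2 + (V k t)\<^sup>2 \<le> Q k))"
proof -
  obtain K0 K1 R0 where K0: "0 \<le> K0" and K1: "0 \<le> K1"
    and hfe: "high_frequency_estimate \<nu> \<omega> \<phi> L C0 T K0 K1 R0"
    using hf[OF C0_nonneg T] by blast
  define K where "K = \<bar>low_const T\<bar> + 2 * K0 + 1"
  have K: "0 < K" using K0 by (simp add: K_def)
  \<comment> \<open>\<open>B\<close> will be \<open>2 * K * R ^ p\<close> with
    \<open>R = \<rho> n\<close>. As \<open>R ^ p \<ge> 1\<close>, the loss
    \<open>K1 * (1 + B)\<close> is at most \<open>K1 * (1 + 2 * K) * R ^ p\<close>, and one more
    power of \<open>R\<close> swallows the constant.\<close>
  obtain n where "max 1 (max R0 (K1 * (1 + 2 * K))) \<le> \<rho> n" using rho_large by blast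
  then have n: "1 \<le> \<rho> n" "R0 \<le> \<rho> n" "K1 * (1 + 2 * K) \<le> \<rho> n" by auto
  define R where "R = \<rho> n"
  define B where "B = 2 * K * R ^ p"
  have Rp: "1 \<le> R ^ p" using n by (simp add: R_def)
  have B: "0 < B" using K Rp by (simp add: B_def)
  have "(low_const T + 2 * K0) * R ^ p < (2 * K) * R ^ p"
    using Rp K0 by (intro mult_strict_right_mono) (auto simp: K_def abs_if)
  then have BK: "(low_const T + 2 * K0) * \<rho> n ^ p < B" by (simp add: B_def R_def)
  have "K1 * (1 + B) \<le> K1 * ((1 + 2 * K) * R ^ p)"
    using K1 Rp by (intro mult_left_mono) (auto simp: B_def distrib_right)
  also have "\<dots> = K1 * (1 + 2 * K) * R ^ p" by simp
  also have "\<dots> \<le> R * R ^ p" using n(3) Rp by (intro mult_right_mono) (auto simp: R_def)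
  finally have K1B: "K1 * (1 + B) \<le> \<rho> n ^ (p + 1)" by (simp add: R_def)
  define C where "C = C0 + L * (1 + B) * \<omega> T"
  have C: "0 \<le> C" using C0_nonneg L B w(5)[OF T] by (simp add: C_def)
  define M where "M = exp ((1 + C * R\<^sup>2) * T)"
  have M: "0 \<le> M" by (simp add: M_def)
  define q where "q = K1 * (1 + B)"
  have q: "0 \<le> q" using K1 B by (simp add: q_def)
  \<comment> \<open>Up to \<open>R\<close> the crude estimate is used, with constants depending on
    \<open>R\<close>; above, the estimate with loss \<open>q\<close>. There
    \<open>l k \<ge> 1\<close>, so the factor 2 makes room for the additional term
    \<open>l k * (U k t)\<^sup>2\<close>.\<close>
  define P where "P k = (if l k \<le> R then (2 + R\<^sup>2) * l k * (M * ((a k)\<^sup>2 + (b k)\<^sup>2))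
      else 2 * (K0 * exp (q * \<phi> (l k)) * (l k ^ 3 * (a k)\<^sup>2 + l k * (b k)\<^sup>2)))" for k
  \<comment> \<open>The weights bounded by \<open>P\<close> degenerate at frequency 0, so the
    unweighted squares need a bound of their own.\<close>
  define Q where "Q k = M * ((a k)\<^sup>2 + (b k)\<^sup>2) + P k" for k
  have P0: "0 \<le> P k" for k using l[of k] K0 M by (simp add: P_def)
  define X where "X = (2 + R\<^sup>2) * M + 2 * K0"
  have PX: "P k \<le> X * (D k * exp (q * \<phi> (l k)))" for k
  proof (cases "l k \<le> R")
    case True
    have e1: "1 \<le> exp (q * \<phi> (l k))" using q phi[OF l[of k]] by simp
    have "P k = ((2 + R\<^sup>2) * M) * (l k * ((a k)\<^sup>2 + (b k)\<^sup>2) * 1)" using True by (simp add: P_def)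
    also have "\<dots> \<le> X * (D k * exp (q * \<phi> (l k)))"
      using e1 l[of k] K0 M
      by (intro mult_mono) (auto simp: X_def D_def distrib_left distrib_right)
    finally show ?thesis .
  next
    case False
    have "P k = (2 * K0) * ((l k ^ 3 * (a k)\<^sup>2 + l k * (b k)\<^sup>2) * exp (q * \<phi> (l k)))"
      using False by (simp add: P_def)
    also have "\<dots> \<le> X * (D k * exp (q * \<phi> (l k)))"
      using l[of k] K0 M
      by (intro mult_mono) (auto simp: X_def D_def distrib_left distrib_right)
    finally show ?thesis .
  qed
  have sP: "summable (\<lambda>k. P k * exp (r * \<phi> (l k)))" if "0 \<le> r" for r
  proof (rule summable_comparison_test'[where N = 0])
    \<comment> \<open>The loss \<open>q\<close> is a fixed number and the data admit every exponent,
      so \<open>q + r\<close> is available.\<close>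
    show "summable (\<lambda>k. X * (D k * exp ((q + r) * \<phi> (l k))))"
      using q that by (intro summable_mult D_summable) auto
    fix k
    have "P k * exp (r * \<phi> (l k)) \<le> X * (D k * exp (q * \<phi> (l k))) * exp (r * \<phi> (l k))"
      by (intro mult_right_mono PX) auto
    also have "\<dots> = X * (D k * exp ((q + r) * \<phi> (l k)))" by (simp add: distrib_right exp_add)
    finally show "norm (P k * exp (r * \<phi> (l k))) \<le> X * (D k * exp ((q + r) * \<phi> (l k)))"
      using P0[of k] by simp
  qed
  have sQ: "summable Q"
    unfolding Q_def using sP[of 0] by (intro summable_add summable_mult sum_a sum_b) simp
  have Q0: "0 \<le> Q k" for k using P0[of k] M by (simp add: Q_def)
  show ?thesis
  proof (rule exI[of _ B], rule exI[of _ P], rule exI[of _ Q], intro conjI allI impI)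
    fix \<mu> N U V assume adm: "admissible \<mu>" and sol: "galerkin_solution \<mu> l a b N T U V"
    let ?s = "stiffness l N U"
    have lip: "\<forall>x\<in>{0..T}. \<forall>y\<in>{0..T}. \<bar>?s x - ?s y\<bar> \<le> B * \<bar>x - y\<bar>"
      by (rule stiffness_lipschitz[OF adm sol T hfe K0 n(1,2) B BK K1B])
    then show "\<forall>x\<in>{0..T}. \<forall>y\<in>{0..T}. \<bar>?s x - ?s y\<bar> \<le> B * \<bar>x - y\<bar>" .
    show "\<forall>t\<in>{0..T}. \<forall>k<N. (l k ^ 3 + l k) * (U k t)\<^sup>2 + l k * (V k t)\<^sup>2 \<le> P k \<and>
         (U k t)\<^sup>2 + (V k t)\<^sup>2 \<le> Q k"
    proof (intro ballI allI impI)
      fix t k assume t: "t \<in> {0..T}" and k: "k < N"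
      show "(l k ^ 3 + l k) * (U k t)\<^sup>2 + l k * (V k t)\<^sup>2 \<le> P k \<and> (U k t)\<^sup>2 + (V k t)\<^sup>2 \<le> Q k"
      proof (cases "l k \<le> R")
        case True
        have "\<bar>\<mu> (?s x)\<bar> \<le> C" if x: "x \<in> {0..T}" for x
        proof -
          have "\<mu> (?s x) \<le> \<mu> (?s 0) + L * (1 + B) * \<omega> \<bar>x - 0\<bar>"
            using coefficient_modulus[OF adm sol T _ lip x, of 0] B T by (simp add: abs_le_iff)
          also have "\<mu> (?s 0) \<le> C0"
            by (intro admissible_le_C0 adm s0_le[OF adm sol T] stiffness_nonneg)
          also have "L * (1 + B) * \<omega> \<bar>x - 0\<bar> \<le> L * (1 + B) * \<omega> T"
            using x L B by (intro mult_left_mono w) auto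
          finally have "\<mu> (?s x) \<le> C" by (simp add: C_def)
          moreover have "\<nu> \<le> \<mu> (?s x)" using adm by (simp add: admissible_def stiffness_nonneg)
          ultimately show ?thesis using nu by simp
        qed
        then have "(U k t)\<^sup>2 + (V k t)\<^sup>2 \<le> ((U k 0)\<^sup>2 + (V k 0)\<^sup>2) * exp ((1 + C * R\<^sup>2) * t)"
          using galerkin_derivs[OF adm sol T _ order_refl k] l[of k] True t
          by (intro crude_energy_estimate[where c = "\<lambda>t. \<mu> (?s t)" and l = "l k" and T = T]) auto
        also have "\<dots> \<le> ((U k 0)\<^sup>2 + (V k 0)\<^sup>2) * M"
          unfolding M_def using t C by (intro mult_left_mono) (auto intro!: mult_left_mono)
        finally have UV: "(U k t)\<^sup>2 + (V k t)\<^sup>2 \<le> M * ((a k)\<^sup>2 + (b k)\<^sup>2)"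
          using galerkin_initial[OF adm sol T k] by (simp add: mult.commute)
        have "l k ^ 3 = l k * (l k)\<^sup>2" by (simp add: power2_eq_square power3_eq_cube)
        also have "\<dots> \<le> l k * R\<^sup>2" using l[of k] True by (intro mult_left_mono power_mono) auto
        finally have l3: "l k ^ 3 + l k \<le> (2 + R\<^sup>2) * l k" using l[of k] by (simp add: algebra_simps)
        have "1 * l k \<le> (2 + R\<^sup>2) * l k" using l[of k] by (intro mult_right_mono) auto
        then have "(l k ^ 3 + l k) * (U k t)\<^sup>2 + l k * (V k t)\<^sup>2 \<le>
            (2 + R\<^sup>2) * l k * (U k t)\<^sup>2 + (2 + R\<^sup>2) * l k * (V k t)\<^sup>2"
          using l3 by (intro add_mono mult_right_mono) auto
        also have "\<dots> = (2 + R\<^sup>2) * l k * ((U k t)\<^sup>2 + (V k t)\<^sup>2)" by (simp only: distrib_left)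
        also have "\<dots> \<le> (2 + R\<^sup>2) * l k * (M * ((a k)\<^sup>2 + (b k)\<^sup>2))"
          using l[of k] by (intro mult_left_mono UV) auto
        finally have "(l k ^ 3 + l k) * (U k t)\<^sup>2 + l k * (V k t)\<^sup>2 \<le> P k" using True by (simp add: P_def)
        then show ?thesis using UV P0[of k] by (simp add: Q_def)
      next
        case False
        then have l1: "1 \<le> l k" using n by (simp add: R_def)
        have "l k ^ 3 * (U k t)\<^sup>2 + l k * (V k t)\<^sup>2 \<le>
            K0 * exp (q * \<phi> (l k)) * (l k ^ 3 * (a k)\<^sup>2 + l k * (b k)\<^sup>2)"
          unfolding q_def using False n B t k
          by (intro high_frequency_bound[OF adm sol T hfe _ lip]) (auto simp: R_def)
        then have P: "2 * (l k ^ 3 * (U k t)\<^sup>2 + l k * (V k t)\<^sup>2) \<le> P k" using False by (simp add: P_def)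
        have l3: "l k \<le> l k ^ 3" using power_increasing[of 1 3 "l k"] l1 by simp
        have i: "l k * (U k t)\<^sup>2 \<le> l k ^ 3 * (U k t)\<^sup>2" using l3 by (intro mult_right_mono) auto
        have ii: "1 * (U k t)\<^sup>2 \<le> l k * (U k t)\<^sup>2" "1 * (V k t)\<^sup>2 \<le> l k * (V k t)\<^sup>2"
          by (intro mult_right_mono l1 zero_le_power2)+
        have iii: "0 \<le> M * ((a k)\<^sup>2 + (b k)\<^sup>2)" using M by simp
        have iv: "0 \<le> l k ^ 3 * (U k t)\<^sup>2" "0 \<le> l k * (V k t)\<^sup>2" using l[of k] by auto
        have "(l k ^ 3 + l k) * (U k t)\<^sup>2 + l k * (V k t)\<^sup>2 \<le> P k"
          using P i iv unfolding distrib_right distrib_left by linarith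
        moreover have "(U k t)\<^sup>2 + (V k t)\<^sup>2 \<le> Q k"
          using P i ii iii iv unfolding Q_def distrib_right distrib_left by linarith
        ultimately show ?thesis by simp
      qed
    qed
  qed (use B sP sQ P0 Q0 in auto)
qed

end

section \<open>Passage to the limit\<close>

lemma tendsto_suminf_dominated:
  fixes f :: "nat \<Rightarrow> 'a \<Rightarrow> real"
  assumes "\<And>k. (f k \<longlongrightarrow> g k) F" and "\<forall>\<^sub>F x in F. \<forall>k. \<bar>f k x\<bar> \<le> M k"
    and "summable M" and "F \<noteq> bot"
  shows "((\<lambda>x. \<Sum>k. f k x) \<longlongrightarrow> (\<Sum>k. g k)) F"
proof -
  have "eventually (\<lambda>(k, x). norm (f k x) \<le> M k) (sequentially \<times>\<^sub>F F)"
    using eventually_prodI[OF always_eventually[of "\<lambda>_. True" sequentially, OF allI, OF TrueI] assms(2)]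
    by (rule eventually_mono) auto
  then show ?thesis
    using tannerys_theorem[of f g F M] assms by blast
qed

lemma continuous_on_Icc_bounded:
  fixes f :: "real \<Rightarrow> real"
  assumes "continuous_on {a..b} f"
  shows "\<exists>M. \<forall>x\<in>{a..b}. \<bar>f x\<bar> \<le> M"
  using compact_imp_bounded[OF compact_continuous_image[OF assms compact_Icc]]
  unfolding bounded_iff by auto

lemma galerkin_solution_mono:
  assumes "galerkin_solution \<mu> l a b N T U V" "T' \<le> T"
  shows "galerkin_solution \<mu> l a b N T' U V"
  using assms unfolding galerkin_solution_def
  by (auto intro!: DERIV_subset[where s = "{0..T}" and t = "{0..T'}"])

text \<open>Nothing bounds \<open>c\<close> on the whole half-line; the time-dependent Lipschitz
  constant of \<open>picard_global\<close> is made for this.\<close>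

lemma linear_oscillator:
  fixes c :: "real \<Rightarrow> real"
  assumes c: "continuous_on {0..} c"
  shows "\<exists>u v. u 0 = \<alpha> \<and> v 0 = \<beta> \<and> (\<forall>t\<ge>0. (u has_real_derivative v t) (at t within {0..}) \<and>
    (v has_real_derivative - (c t * q * u t)) (at t within {0..}))"
proof -
  let ?F = "\<lambda>t x i. if i = (0::nat) then x 1 else - (c t * q * x 0)"
  have "\<exists>x. \<forall>i<2. x i 0 = (if i = 0 then \<alpha> else \<beta>) \<and>
      (\<forall>t\<ge>0. (x i has_real_derivative ?F t (\<lambda>j. x j t) i) (at t within {0..}))"
  proof (rule picard_global[where K = "\<lambda>t. 1 + \<bar>c t * q\<bar>"])
    fix t and x y :: "nat \<Rightarrow> real" and i :: nat
    have S: "(\<Sum>j<2. \<bar>x j - y j\<bar>) = \<bar>x 0 - y 0\<bar> + \<bar>x 1 - y 1\<bar>" by (simp add: numeral_2_eq_2)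
    have "0 \<le> \<bar>c t * q\<bar> * \<bar>x 1 - y 1\<bar>" "0 \<le> \<bar>c t * q\<bar> * \<bar>x 0 - y 0\<bar>" by auto
    moreover have "\<bar>- (c t * q * x 0) + c t * q * y 0\<bar> = \<bar>c t * q\<bar> * \<bar>x 0 - y 0\<bar>"
      unfolding abs_mult[symmetric] by (subst abs_minus_cancel[symmetric]) (simp add: algebra_simps)
    ultimately show "\<bar>?F t x i - ?F t y i\<bar> \<le> (1 + \<bar>c t * q\<bar>) * (\<Sum>j<2. \<bar>x j - y j\<bar>)"
      unfolding S distrib_right distrib_left by (cases "i = 0") auto
  next
    fix x :: "nat \<Rightarrow> real \<Rightarrow> real" and i :: nat
    assume x: "\<And>j. continuous_on {0..} (x j)"
    then show "continuous_on {0..} (\<lambda>t. ?F t (\<lambda>j. x j t) i)"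
      by (cases "i = 0") (auto intro!: continuous_intros c)
  qed (auto intro!: continuous_intros c)
  then obtain x where x: "\<And>i. i < 2 \<Longrightarrow> x i 0 = (if i = 0 then \<alpha> else \<beta>) \<and>
      (\<forall>t\<ge>0. (x i has_real_derivative ?F t (\<lambda>j. x j t) i) (at t within {0..}))"
    by blast
  show ?thesis
    using x[of 0] x[of 1] by (intro exI[of _ "x 0"] exI[of _ "x 1"]) simp
qed

text \<open>The difference \<open>u - y\<close> solves the equation with coefficient
  \<open>d\<close> and source \<open>(d - c) * q * u\<close>, so among the solutions only
  \<open>u\<close> needs a bound. For a fixed mode \<open>q\<close> is a constant, and plain
  Gronwall passes from convergence of the coefficients to that of the solutions.\<close>

lemma oscillator_difference:
  fixes c d u v y z :: "real \<Rightarrow> real"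
  assumes u: "\<And>t. t \<in> {0..T} \<Longrightarrow> (u has_real_derivative v t) (at t within {0..T})"
    and v: "\<And>t. t \<in> {0..T} \<Longrightarrow> (v has_real_derivative - (c t * q * u t)) (at t within {0..T})"
    and y: "\<And>t. t \<in> {0..T} \<Longrightarrow> (y has_real_derivative z t) (at t within {0..T})"
    and z: "\<And>t. t \<in> {0..T} \<Longrightarrow> (z has_real_derivative - (d t * q * y t)) (at t within {0..T})"
    and ini: "u 0 = y 0" "v 0 = z 0" and q: "0 \<le> q"
    and C: "\<And>t. t \<in> {0..T} \<Longrightarrow> \<bar>d t\<bar> \<le> C" and M: "\<And>t. t \<in> {0..T} \<Longrightarrow> \<bar>u t\<bar> \<le> M"
    and del: "\<And>t. t \<in> {0..T} \<Longrightarrow> \<bar>c t - d t\<bar> \<le> \<delta>" and t: "t \<in> {0..T}"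
  shows "(u t - y t)\<^sup>2 + (v t - z t)\<^sup>2 \<le> (\<delta> * q * M)\<^sup>2 * t * exp ((2 + C * q) * t)"
proof -
  let ?w = "\<lambda>t. u t - y t" and ?x = "\<lambda>t. v t - z t"
  let ?E = "\<lambda>t. (?w t)\<^sup>2 + (?x t)\<^sup>2"
  let ?E' = "\<lambda>t. 2 * ?w t * ?x t + 2 * ?x t * (- (c t * q * u t) + d t * q * y t)"
  have C0: "0 \<le> C" using C[OF t] by linarith
  have "?E t \<le> (?E 0 + (\<delta> * q * M)\<^sup>2 * t) * exp ((2 + C * q) * t)"
  proof (rule gronwall[where E' = ?E' and T = T])
    fix s assume s: "s \<in> {0..T}"
    show "(?E has_real_derivative ?E' s) (at s within {0..T})"
      by (rule derivative_eq_intros u[OF s] v[OF s] y[OF s] z[OF s] refl)+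
        (simp add: power2_eq_square algebra_simps)
    let ?g = "(d s - c s) * q * u s"
    have "?E' s = (1 - d s * q) * (2 * ?w s * ?x s) + 2 * ?g * ?x s"
      by (simp add: algebra_simps)
    also have "\<dots> \<le> (1 + C * q) * ?E s + (?g\<^sup>2 + (?x s)\<^sup>2)"
    proof (intro add_mono sum_squares_bound)
      have "\<bar>d s * q\<bar> \<le> C * q" using C[OF s] q by (simp add: abs_mult mult_right_mono)
      then have 1: "\<bar>1 - d s * q\<bar> \<le> 1 + C * q" by linarith
      have "\<bar>2 * p * r\<bar> \<le> p\<^sup>2 + r\<^sup>2" for p r :: real
        using sum_squares_bound[of p r] sum_squares_bound[of p "- r"] by (simp add: abs_le_iff)
      then have "\<bar>2 * ?w s * ?x s\<bar> \<le> ?E s" .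
      then have "\<bar>1 - d s * q\<bar> * \<bar>2 * ?w s * ?x s\<bar> \<le> (1 + C * q) * ?E s"
        using 1 C0 q by (intro mult_mono) auto
      then show "(1 - d s * q) * (2 * ?w s * ?x s) \<le> (1 + C * q) * ?E s"
        using abs_ge_self[of "(1 - d s * q) * (2 * ?w s * ?x s)"] unfolding abs_mult by linarith
    qed
    also have "?g\<^sup>2 \<le> (\<delta> * q * M)\<^sup>2"
    proof -
      have "\<bar>?g\<bar> \<le> \<delta> * q * M"
      proof -
        have "0 \<le> \<delta>" using del[OF t] by linarith
        then show ?thesis
          unfolding abs_mult using del[OF s] M[OF s] q
          by (intro mult_mono) (auto simp: abs_minus_commute)
      qed
      then have "\<bar>?g\<bar>\<^sup>2 \<le> (\<delta> * q * M)\<^sup>2" by (intro power_mono) auto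
      then show ?thesis by simp
    qed
    also have "(1 + C * q) * ?E s + ((\<delta> * q * M)\<^sup>2 + (?x s)\<^sup>2) \<le> (2 + C * q) * ?E s + (\<delta> * q * M)\<^sup>2"
      by (simp add: algebra_simps)
    finally show "?E' s \<le> (2 + C * q) * ?E s + (\<delta> * q * M)\<^sup>2" by simp
  qed (use C0 q t in auto)
  then show ?thesis using ini by simp
qed

section \<open>Compactness and construction of the limit\<close>

context kirchhoff_data
begin

lemma m_continuous: "continuous_on {0..} m"
  by (rule admissible_continuous[OF admissible_m])

text \<open>Averages inherit the lower bound, the modulus and the constant \<open>L\<close>, so the
  a priori estimates see no \<open>\<epsilon>\<close>. The Lipschitz constant in the last claim may
  blow up as \<open>\<epsilon>\<close> tends to 0, but it enters only the existence of the
  approximations.\<close>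

lemma avg_m:
  assumes e: "0 < \<epsilon>" "\<epsilon> \<le> 1"
  shows "admissible (avg \<epsilon> m)"
    and "\<And>x. 0 \<le> x \<Longrightarrow> \<bar>avg \<epsilon> m x - m x\<bar> \<le> L * \<omega> \<epsilon>"
    and "\<And>x y. 0 \<le> x \<Longrightarrow> 0 \<le> y \<Longrightarrow> \<bar>avg \<epsilon> m x - avg \<epsilon> m y\<bar> \<le> L * \<omega> \<epsilon> / \<epsilon> * \<bar>x - y\<bar>"
proof -
  note c = continuous_on_subset[OF m_continuous]
  show close: "\<bar>avg \<epsilon> m x - m x\<bar> \<le> L * \<omega> \<epsilon>" if x: "0 \<le> x" for x
  proof -
    have le: "\<bar>m s - m x\<bar> \<le> L * \<omega> \<epsilon>" if "s \<in> {x..x+\<epsilon>}" for s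
    proof -
      have "\<bar>m s - m x\<bar> \<le> L * \<omega> \<bar>s - x\<bar>" using m_mod[of s x] that x by simp
      also have "\<dots> \<le> L * \<omega> \<epsilon>" using that L by (intro mult_left_mono w) auto
      finally show ?thesis .
    qed
    have "avg \<epsilon> m x \<le> m x + L * \<omega> \<epsilon>"
      by (intro avg_le c e) (use le x in \<open>auto simp: abs_le_iff algebra_simps\<close>)
    moreover have "m x - L * \<omega> \<epsilon> \<le> avg \<epsilon> m x"
      by (intro avg_ge c e) (use le x in \<open>auto simp: abs_le_iff algebra_simps\<close>)
    ultimately show ?thesis by linarith
  qed
  show "admissible (avg \<epsilon> m)"
    unfolding admissible_def
  proof (intro conjI allI impI)
    fix x :: real assume x: "0 \<le> x"
    show "\<nu> \<le> avg \<epsilon> m x" by (intro avg_ge c e m_low) (use x in auto)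
    have "L * \<omega> \<epsilon> \<le> L * \<omega> 1" using e L by (intro mult_left_mono w) auto
    then show "\<bar>avg \<epsilon> m x - m x\<bar> \<le> L * \<omega> 1" using close[OF x] by linarith
    fix y :: real assume y: "0 \<le> y"
    have cc: "continuous_on {0..0+\<epsilon>} (\<lambda>s. m (s + x) - m (s + y))"
      by (intro continuous_on_diff continuous_on_compose2[OF m_continuous])
        (use x y in \<open>auto intro!: continuous_intros\<close>)
    have b: "\<bar>m (s + x) - m (s + y)\<bar> \<le> L * \<omega> \<bar>x - y\<bar>" if "s \<in> {0..0+\<epsilon>}" for s
      using m_mod[of "s + x" "s + y"] that x y by simp
    show "\<bar>avg \<epsilon> m x - avg \<epsilon> m y\<bar> \<le> L * \<omega> \<bar>x - y\<bar>"
      unfolding avg_shift_diff[OF m_continuous e(1) x y] abs_le_iff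
    proof
      show "avg \<epsilon> (\<lambda>s. m (s + x) - m (s + y)) 0 \<le> L * \<omega> \<bar>x - y\<bar>"
        by (rule avg_le[OF cc e(1)]) (use b in \<open>auto simp: abs_le_iff\<close>)
      have "- (L * \<omega> \<bar>x - y\<bar>) \<le> avg \<epsilon> (\<lambda>s. m (s + x) - m (s + y)) 0"
        by (rule avg_ge[OF cc e(1)]) (use b in \<open>force simp: abs_le_iff\<close>)
      then show "- avg \<epsilon> (\<lambda>s. m (s + x) - m (s + y)) 0 \<le> L * \<omega> \<bar>x - y\<bar>" by simp
    qed
  qed
  show "\<bar>avg \<epsilon> m x - avg \<epsilon> m y\<bar> \<le> L * \<omega> \<epsilon> / \<epsilon> * \<bar>x - y\<bar>" if "0 \<le> x" "0 \<le> y" for x y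
  proof -
    have "norm ((m (z + \<epsilon>) - m z) / \<epsilon>) \<le> L * \<omega> \<epsilon> / \<epsilon>" if "z \<in> {0..}" for z
      using m_mod[of "z + \<epsilon>" z] that e by (simp add: divide_right_mono)
    then show ?thesis
      using field_differentiable_bound[of "{0..}" "avg \<epsilon> m" "\<lambda>z. (m (z + \<epsilon>) - m z) / \<epsilon>"
          "L * \<omega> \<epsilon> / \<epsilon>" x y] avg_has_real_derivative[OF m_continuous e(1)] that
      by auto
  qed
qed

lemma modulus_small:
  assumes "0 < e"
  shows "\<exists>h>0. \<forall>x. 0 \<le> x \<and> x \<le> h \<longrightarrow> L * \<omega> x \<le> e"
proof -
  have "continuous_on {0..} (\<lambda>x. L * \<omega> x)" by (intro continuous_intros w)
  then obtain h where h: "0 < h" "\<And>x. 0 \<le> x \<Longrightarrow> \<bar>x\<bar> < h \<Longrightarrow> \<bar>L * \<omega> x\<bar> < e"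
    using assms w(3) by (force simp: continuous_on_iff dist_real_def)
  then show ?thesis by (intro exI[of _ "h / 2"]) (force simp: abs_less_iff)
qed

text \<open>Arzela-Ascoli on every interval [0, j], then a diagonal subsequence. The Lipschitz bound
  is asked for \<open>n \<ge> j\<close> only, because the \<open>n\<close>-th approximation lives on
  [0, n].\<close>

lemma stiffness_subsequence:
  fixes S :: "nat \<Rightarrow> real \<Rightarrow> real"
  assumes lip: "\<And>j::nat. \<exists>B\<ge>0. \<forall>n\<ge>j. \<forall>x\<in>{0..real j}. \<forall>y\<in>{0..real j}. \<bar>S n x - S n y\<bar> \<le> B * \<bar>x - y\<bar>"
    and S0: "\<And>n. \<bar>S n 0\<bar> \<le> C"
  shows "\<exists>d s. strict_mono d \<and> (\<forall>j::nat. uniform_limit {0..real j} (\<lambda>n. S (d n)) s sequentially)"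
proof -
  define P where "P j r \<longleftrightarrow> (\<exists>g. uniform_limit {0..real j} (\<lambda>n. S (r n)) g sequentially)"
    for j :: nat and r :: "nat \<Rightarrow> nat"
  interpret subseqs P
  proof
    fix j :: nat and \<sigma> :: "nat \<Rightarrow> nat" assume \<sigma>: "strict_mono \<sigma>"
    obtain B where B: "0 \<le> B" and lipB: "\<And>n x y. j \<le> n \<Longrightarrow> x \<in> {0..real j} \<Longrightarrow> y \<in> {0..real j} \<Longrightarrow>
       \<bar>S n x - S n y\<bar> \<le> B * \<bar>x - y\<bar>" using lip[of j] by blast
    \<comment> \<open>The shift by \<open>j\<close> discards the indices for which no bound on
      [0, j] is known.\<close>
    let ?F = "\<lambda>n. S (\<sigma> (n + j))"
    have ge: "j \<le> \<sigma> (n + j)" for n using seq_suble[OF \<sigma>, of "n + j"] by simp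
    obtain g k where k: "strict_mono (k :: nat \<Rightarrow> nat)"
      and lim: "\<And>e. 0 < e \<Longrightarrow> \<exists>N. \<forall>n x. n \<ge> N \<and> x \<in> {0..real j} \<longrightarrow> norm (?F (k n) x - g x) < e"
    proof (rule Arzela_Ascoli[of "{0..real j}" ?F "C + B * real j"])
      fix n x assume x: "x \<in> {0..real j}"
      have "\<bar>?F n x - ?F n 0\<bar> \<le> B * \<bar>x - 0\<bar>" using x by (intro lipB ge) auto
      also have "\<dots> \<le> B * real j" using x B by (intro mult_left_mono) auto
      finally show "norm (?F n x) \<le> C + B * real j" using S0[of "\<sigma> (n + j)"] by simp
    next
      fix x e :: real assume x: "x \<in> {0..real j}" and e: "0 < e"
      have "\<bar>?F n x - ?F n y\<bar> < e" if "y \<in> {0..real j}" "\<bar>x - y\<bar> < e / (B + 1)" for n y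
      proof -
        have "\<bar>?F n x - ?F n y\<bar> \<le> B * \<bar>x - y\<bar>" by (intro lipB ge x that)
        also have "\<dots> \<le> (B + 1) * \<bar>x - y\<bar>" by (intro mult_right_mono) auto
        also have "\<dots> < e" using that(2) B by (simp add: field_simps)
        finally show ?thesis .
      qed
      then show "\<exists>d>0. \<forall>n y. y \<in> {0..real j} \<and> norm (x - y) < d \<longrightarrow> norm (?F n x - ?F n y) < e"
        using e B by (intro exI[of _ "e / (B + 1)"]) auto
    qed auto
    have "uniform_limit {0..real j} (\<lambda>n. S (\<sigma> (k n + j))) g sequentially"
      unfolding uniform_limit_iff eventually_sequentially
    proof (intro allI impI)
      fix e :: real assume "0 < e"
      from lim[OF this] obtain N
        where "\<forall>n x. n \<ge> N \<and> x \<in> {0..real j} \<longrightarrow> norm (S (\<sigma> (k n + j)) x - g x) < e" ..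
      then show "\<exists>N. \<forall>n\<ge>N. \<forall>x\<in>{0..real j}. dist (S (\<sigma> (k n + j)) x) (g x) < e"
        unfolding dist_norm by blast
    qed
    then have "P j (\<sigma> \<circ> (\<lambda>n. k n + j))" unfolding P_def o_def by blast
    moreover have "strict_mono (\<lambda>n. k n + j)" using k by (auto simp: strict_mono_def)
    ultimately show "\<exists>r'. strict_mono r' \<and> P j (\<sigma> \<circ> r')" by blast
  qed
  let ?d = diagseq
  have stable: "P j (r \<circ> q)" if q: "strict_mono q" and r: "P j r" for j r q
  proof -
    from r obtain g where "uniform_limit {0..real j} (\<lambda>n. S (r n)) g sequentially"
      unfolding P_def by blast
    then have "uniform_limit {0..real j} (\<lambda>n. S (r (q n))) g sequentially"
      unfolding uniform_limit_iff using eventually_subseq[OF q] by blast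
    then show ?thesis unfolding P_def o_def by blast
  qed
  \<comment> \<open>The diagonal sequence has the \<open>j\<close>-th property from index
    \<open>Suc j\<close> on; the shift is removed below, since finitely many terms do not affect a
    limit.\<close>
  have "P j (?d \<circ> (+) (Suc j))" for j by (rule diagseq_holds) (rule stable)
  then have "\<exists>g. uniform_limit {0..real j} (\<lambda>n. S (?d (n + Suc j))) g sequentially" for j
    unfolding P_def o_def by (simp only: add.commute)
  moreover have "uniform_limit {0..real j} (\<lambda>n. S (?d n)) g sequentially"
    if "uniform_limit {0..real j} (\<lambda>n. S (?d (n + Suc j))) g sequentially" for j g
    unfolding uniform_limit_iff
  proof (intro allI impI)
    fix e :: real assume "0 < e"
    then have "\<forall>\<^sub>F n in sequentially. \<forall>x\<in>{0..real j}. dist (S (?d (n + Suc j)) x) (g x) < e"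
      using that unfolding uniform_limit_iff by blast
    then show "\<forall>\<^sub>F n in sequentially. \<forall>x\<in>{0..real j}. dist (S (?d n) x) (g x) < e"
      by (rule eventually_sequentially_seg[THEN iffD1])
  qed
  ultimately have "\<exists>g. uniform_limit {0..real j} (\<lambda>n. S (?d n)) g sequentially" for j by blast
  then obtain g where g: "\<And>j. uniform_limit {0..real j} (\<lambda>n. S (?d n)) (g j) sequentially"
    using choice[of "\<lambda>j g. uniform_limit {0..real j} (\<lambda>n. S (?d n)) g sequentially"] by blast
  \<comment> \<open>The limits \<open>g j\<close> on the nested intervals agree, being pointwise
    limits of one sequence; \<open>lim\<close> glues them into one function.\<close>
  have eq: "lim (\<lambda>n. S (?d n) x) = g j x" if "x \<in> {0..real j}" for x j
    using tendsto_uniform_limitI[OF g that] by (rule limI)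
  have "uniform_limit {0..real j} (\<lambda>n. S (?d n)) (\<lambda>x. lim (\<lambda>n. S (?d n) x)) sequentially" for j
    using g[of j] eq[of _ j] unfolding uniform_limit_iff by (simp cong: ball_cong_simp)
  then show ?thesis using subseq_diagseq by blast
qed

text \<open>The bounds \<open>P\<close> and \<open>Q\<close>, uniform in \<open>t\<close> on [0, T],
  are stated along with the equations because they later give continuity and differentiability in
  the Gevrey norms by dominated convergence.\<close>

theorem mode_solution:
  "\<exists>U V. (\<forall>k. U k 0 = a k \<and> V k 0 = b k) \<and>
    (\<forall>k. \<forall>t\<ge>0. (U k has_real_derivative V k t) (at t within {0..}) \<and>
       (V k has_real_derivative - (m (\<Sum>j. (l j)\<^sup>2 * (U j t)\<^sup>2) * (l k)\<^sup>2 * U k t)) (at t within {0..})) \<and>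
    continuous_on {0..} (\<lambda>t. m (\<Sum>j. (l j)\<^sup>2 * (U j t)\<^sup>2)) \<and>
    (\<forall>T\<ge>0. \<exists>P Q. (\<forall>r\<ge>0. summable (\<lambda>k. P k * exp (r * \<phi> (l k)))) \<and> summable Q \<and>
      (\<forall>t\<in>{0..T}. \<forall>k. (l k ^ 3 + l k) * (U k t)\<^sup>2 + l k * (V k t)\<^sup>2 \<le> P k \<and>
         (U k t)\<^sup>2 + (V k t)\<^sup>2 \<le> Q k))"
proof -
  \<comment> \<open>The \<open>n\<close>-th approximation uses the averaging length
    \<open>\<epsilon> n\<close>, the first \<open>n\<close> modes and the interval [0, n]: one index
    drives all three limits.\<close>
  define \<epsilon> where "\<epsilon> n = 1 / real (Suc n)" for n
  have eps: "0 < \<epsilon> n" "\<epsilon> n \<le> 1" for n by (auto simp: \<epsilon>_def)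
  note adm = avg_m(1)[OF eps] and close = avg_m(2)[OF eps]
  have "\<exists>U V. galerkin_solution (avg (\<epsilon> n) m) l a b n (real n) U V" for n
  proof (rule galerkin_exists[OF _ avg_m(3)[OF eps] l])
    show "0 \<le> avg (\<epsilon> n) m x" if "0 \<le> x" for x
      using adm[of n] nu that unfolding admissible_def by force
  qed auto
  then obtain U V where UV: "\<And>n. galerkin_solution (avg (\<epsilon> n) m) l a b n (real n) (U n) (V n)"
    by metis
  have sol: "galerkin_solution (avg (\<epsilon> n) m) l a b n T (U n) (V n)" if "T \<le> real n" for n T
    by (rule galerkin_solution_mono[OF UV that])
  define S where "S n = stiffness l n (U n)" for n
  obtain d s where d: "strict_mono d"
    and lim: "\<And>j::nat. uniform_limit {0..real j} (\<lambda>n. S (d n)) s sequentially"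
  proof -
    have "\<exists>B\<ge>0. \<forall>n\<ge>j. \<forall>x\<in>{0..real j}. \<forall>y\<in>{0..real j}. \<bar>S n x - S n y\<bar> \<le> B * \<bar>x - y\<bar>" for j
    proof -
      obtain B and P Q :: "nat \<Rightarrow> real" where B: "0 \<le> B"
        and ap: "\<forall>\<mu> N U V. admissible \<mu> \<longrightarrow> galerkin_solution \<mu> l a b N (real j) U V \<longrightarrow>
      (\<forall>x\<in>{0..real j}. \<forall>y\<in>{0..real j}. \<bar>stiffness l N U x - stiffness l N U y\<bar> \<le> B * \<bar>x - y\<bar>) \<and>
      (\<forall>t\<in>{0..real j}. \<forall>k<N. (l k ^ 3 + l k) * (U k t)\<^sup>2 + l k * (V k t)\<^sup>2 \<le> P k \<and>
         (U k t)\<^sup>2 + (V k t)\<^sup>2 \<le> Q k)"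
        using a_priori[OF of_nat_0_le_iff[of j]] by (elim exE conjE) (rule that)
      show ?thesis
      proof (rule exI[of _ B], intro conjI allI impI)
        fix n assume "j \<le> n"
        then have "real j \<le> real n" by simp
        from ap[rule_format, OF adm sol[OF this]]
        show "\<forall>x\<in>{0..real j}. \<forall>y\<in>{0..real j}. \<bar>S n x - S n y\<bar> \<le> B * \<bar>x - y\<bar>"
          unfolding S_def by (intro ballI) blast
      qed (rule B)
    qed
    moreover have "\<bar>S n 0\<bar> \<le> S0" for n
      using s0_le[OF adm UV] by (simp add: S_def stiffness_nonneg)
    ultimately show ?thesis using stiffness_subsequence[of S] that by blast
  qed
  have dn: "n \<le> d n" for n by (rule seq_suble[OF d])
  have ptw: "(\<lambda>n. S (d n) t) \<longlonglongrightarrow> s t" if "0 \<le> t" for t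
    using that by (intro tendsto_uniform_limitI[OF lim[of "nat \<lceil>t\<rceil>"]]) (auto simp: of_nat_ceiling)
  have s_nonneg: "0 \<le> s t" if "0 \<le> t" for t
    by (rule LIMSEQ_le_const[OF ptw[OF that]]) (auto simp: S_def stiffness_nonneg)
  have cS: "continuous_on {0..real j} (S n)" if "j \<le> n" for j n
    unfolding S_def
    using sol[of "real j" n] that unfolding galerkin_solution_def
    by (intro DERIV_continuous_on[OF stiffness_has_real_derivative[where V = "V n"]]) auto
  have "continuous_on {0..real j} s" for j
  proof (rule uniform_limit_theorem[OF _ lim])
    show "\<forall>\<^sub>F n in sequentially. continuous_on {0..real j} (S (d n))"
      using cS order_trans[OF _ dn] by (intro eventually_sequentiallyI[of j]) blast
  qed simp
  then have cs: "continuous_on {0..} s"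
    unfolding continuous_on
  proof (intro ballI)
    fix t :: real assume t: "t \<in> {0..}" and *: "\<And>j::nat. \<forall>x\<in>{0..real j}. (s \<longlongrightarrow> s x) (at x within {0..real j})"
    obtain j where j: "t < real j" using reals_Archimedean2 by blast
    then have "(s \<longlongrightarrow> s t) (at t within {0..real j})" using t *[of j] by auto
    moreover have "at t within {0..real j} = at t within {0..}"
      using t j by (intro at_within_Icc_Ici) auto
    ultimately show "(s \<longlongrightarrow> s t) (at t within {0..})" by simp
  qed
  \<comment> \<open>So far nothing relates \<open>s\<close> to the modes of the limit, and
    \<open>c\<close> is simply a given continuous coefficient. The identification comes with
    \<open>s_eq\<close>.\<close>
  define c where "c t = m (s t)" for t
  have cc: "continuous_on {0..} c"
    unfolding c_def by (rule continuous_on_compose2[OF m_continuous cs]) (auto intro: s_nonneg)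
  have "\<exists>u v. u 0 = a k \<and> v 0 = b k \<and> (\<forall>t\<ge>0. (u has_real_derivative v t) (at t within {0..}) \<and>
    (v has_real_derivative - (c t * (l k)\<^sup>2 * u t)) (at t within {0..}))" for k
    by (rule linear_oscillator[OF cc])
  then obtain u v where ini: "\<And>k. u k 0 = a k" "\<And>k. v k 0 = b k"
    and u': "\<And>k t. 0 \<le> t \<Longrightarrow> (u k has_real_derivative v k t) (at t within {0..})"
    and v': "\<And>k t. 0 \<le> t \<Longrightarrow> (v k has_real_derivative - (c t * (l k)\<^sup>2 * u k t)) (at t within {0..})"
    by metis
  \<comment> \<open>Two errors: replacing \<open>m\<close> by its average, controlled by the modulus
    at the averaging length, and replacing \<open>s\<close> by its approximation, controlled by the
    modulus of \<open>m\<close> and the uniform convergence.\<close>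
  have unif: "\<forall>\<^sub>F n in sequentially. \<forall>t\<in>{0..real j}. \<bar>c t - avg (\<epsilon> (d n)) m (S (d n) t)\<bar> \<le> e"
    if e: "0 < e" for e j
  proof -
    obtain h where h: "0 < h" "\<And>x. 0 \<le> x \<Longrightarrow> x \<le> h \<Longrightarrow> L * \<omega> x \<le> e / 2"
      using modulus_small[of "e / 2"] e by auto
    have "\<forall>\<^sub>F n in sequentially. \<epsilon> n < h"
      using LIMSEQ_inverse_real_of_nat h(1) unfolding \<epsilon>_def
      by (intro order_tendstoD(2)[of _ 0]) (auto simp: inverse_eq_divide)
    then have "\<forall>\<^sub>F n in sequentially. \<epsilon> (d n) < h"
      by (rule eventually_subseq[OF d])
    moreover have "\<forall>\<^sub>F n in sequentially. \<forall>t\<in>{0..real j}. dist (S (d n) t) (s t) < h"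
      using lim[of j] h(1) unfolding uniform_limit_iff by blast
    ultimately show ?thesis
    proof eventually_elim
      case (elim n)
      show ?case
      proof
        fix t assume t: "t \<in> {0..real j}"
        have S: "0 \<le> S (d n) t" by (simp add: S_def stiffness_nonneg)
        have "\<bar>avg (\<epsilon> (d n)) m (S (d n) t) - m (S (d n) t)\<bar> \<le> L * \<omega> (\<epsilon> (d n))" by (rule close[OF S])
        also have "\<dots> \<le> e / 2" using h(2)[of "\<epsilon> (d n)"] elim(1) eps[of "d n"] by simp
        finally have 1: "\<bar>avg (\<epsilon> (d n)) m (S (d n) t) - m (S (d n) t)\<bar> \<le> e / 2" .
        have "\<bar>m (s t) - m (S (d n) t)\<bar> \<le> L * \<omega> \<bar>s t - S (d n) t\<bar>"
          using t by (intro m_mod s_nonneg S) auto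
        also have "\<dots> \<le> e / 2"
          using elim(2) t by (intro h(2)) (auto simp: dist_real_def abs_minus_commute intro: less_imp_le)
        finally show "\<bar>c t - avg (\<epsilon> (d n)) m (S (d n) t)\<bar> \<le> e" using 1 unfolding c_def by linarith
      qed
    qed
  qed
  have conv: "(\<lambda>n. U (d n) k t) \<longlonglongrightarrow> u k t" "(\<lambda>n. V (d n) k t) \<longlonglongrightarrow> v k t"
    if t0: "0 \<le> t" for k t
  proof -
    obtain j :: nat where j: "t < real j" using reals_Archimedean2 by blast
    let ?q = "(l k)\<^sup>2"
    have cu: "continuous_on {0..real j} (u k)"
      by (rule continuous_on_subset[OF DERIV_continuous_on[of "{0..}"]]) (use u' in auto)
    obtain M where M: "\<And>x. x \<in> {0..real j} \<Longrightarrow> \<bar>u k x\<bar> \<le> M"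
      using continuous_on_Icc_bounded[OF cu] by blast
    have "continuous_on {0..real j} c" by (rule continuous_on_subset[OF cc]) auto
    then obtain C where C: "\<And>x. x \<in> {0..real j} \<Longrightarrow> \<bar>c x\<bar> \<le> C"
      using continuous_on_Icc_bounded by blast
    define X where "X = (?q * M)\<^sup>2 * t * exp ((2 + (C + 1) * ?q) * t)"
    have X: "0 \<le> X" using t0 by (simp add: X_def)
    have main: "\<forall>\<^sub>F n in sequentially. (u k t - U (d n) k t)\<^sup>2 + (v k t - V (d n) k t)\<^sup>2 \<le> \<delta>\<^sup>2 * X"
      if del: "0 < \<delta>" "\<delta> \<le> 1" for \<delta>
      using unif[OF del(1), of j] eventually_ge_at_top[of "max j (Suc k)"]
    proof eventually_elim
      case (elim n)
      have n: "j \<le> d n" "k < d n" using elim(2) dn[of n] by auto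
      have g: "galerkin_solution (avg (\<epsilon> (d n)) m) l a b (d n) (real j) (U (d n)) (V (d n))"
        by (rule sol) (use n in simp)
      have gd: "(U (d n) k has_real_derivative V (d n) k x) (at x within {0..real j})"
        "(V (d n) k has_real_derivative - (avg (\<epsilon> (d n)) m (S (d n) x) * ?q * U (d n) k x)) (at x within {0..real j})"
        "U (d n) k 0 = a k" "V (d n) k 0 = b k"
        if "x \<in> {0..real j}" for x
        using g that n(2) unfolding galerkin_solution_def S_def by auto
      have "(u k t - U (d n) k t)\<^sup>2 + (v k t - V (d n) k t)\<^sup>2 \<le>
          (\<delta> * ?q * M)\<^sup>2 * t * exp ((2 + (C + 1) * ?q) * t)"
      proof (rule oscillator_difference[where T = "real j" and c = c])
        fix x assume x: "x \<in> {0..real j}"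
        show "(u k has_real_derivative v k x) (at x within {0..real j})"
          "(v k has_real_derivative - (c x * ?q * u k x)) (at x within {0..real j})"
          using u'[of x k] v'[of x k] x by (auto intro: DERIV_subset)
        show "\<bar>avg (\<epsilon> (d n)) m (S (d n) x)\<bar> \<le> C + 1"
          using C[OF x] elim(1) x del by (force simp: abs_le_iff)
      next
        show "u k 0 = U (d n) k 0" "v k 0 = V (d n) k 0" using gd(3,4)[of 0] ini by auto
      qed (use gd(1,2) elim(1) M t0 j in auto)
      then show ?case by (simp add: X_def power_mult_distrib mult_ac)
    qed
    have small: "\<forall>\<^sub>F n in sequentially. \<bar>u k t - U (d n) k t\<bar> < e \<and> \<bar>v k t - V (d n) k t\<bar> < e"
      if e: "0 < e" for e
    proof -
      \<comment> \<open>Chosen so that \<open>\<delta> * sqrt X < e\<close>; the summand 1 covers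
        \<open>X = 0\<close> and makes the inequality strict.\<close>
      define \<delta> where "\<delta> = min 1 (e / (sqrt X + 1))"
      have sq: "0 < sqrt X + 1" using X by (simp add: add_nonneg_pos)
      have del: "0 < \<delta>" "\<delta> \<le> 1" using e sq by (auto simp: \<delta>_def)
      have "\<delta> * (sqrt X + 1) \<le> e / (sqrt X + 1) * (sqrt X + 1)"
        using sq by (intro mult_right_mono) (auto simp: \<delta>_def)
      also have "\<dots> = e" using sq by simp
      finally have "\<delta> * (sqrt X + 1) \<le> e" .
      then have d1: "\<delta> * sqrt X < e" using del by (simp add: distrib_left)
      from main[OF del] show ?thesis
      proof eventually_elim
        case (elim n)
        have "\<delta>\<^sup>2 * X = (\<delta> * sqrt X)\<^sup>2" using X by (simp add: power_mult_distrib)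
        then have "(u k t - U (d n) k t)\<^sup>2 \<le> (\<delta> * sqrt X)\<^sup>2" "(v k t - V (d n) k t)\<^sup>2 \<le> (\<delta> * sqrt X)\<^sup>2"
          using elim zero_le_power2[of "u k t - U (d n) k t"] zero_le_power2[of "v k t - V (d n) k t"]
          by linarith+
        then have "\<bar>u k t - U (d n) k t\<bar> \<le> \<delta> * sqrt X" "\<bar>v k t - V (d n) k t\<bar> \<le> \<delta> * sqrt X"
          using del X by (auto simp flip: abs_le_square_iff)
        then show ?case using d1 by simp
      qed
    qed
    show "(\<lambda>n. U (d n) k t) \<longlonglongrightarrow> u k t"
      by (rule tendstoI, rule eventually_mono[OF small]) (auto simp: dist_real_def abs_minus_commute)
    show "(\<lambda>n. V (d n) k t) \<longlonglongrightarrow> v k t"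
      by (rule tendstoI, rule eventually_mono[OF small]) (auto simp: dist_real_def abs_minus_commute)
  qed
  have bounds: "\<exists>P Q. (\<forall>k. 0 \<le> P k \<and> 0 \<le> Q k) \<and>
      (\<forall>r\<ge>0. summable (\<lambda>k. P k * exp (r * \<phi> (l k)))) \<and> summable Q \<and>
      (\<forall>n\<ge>nat \<lceil>T\<rceil>. \<forall>t\<in>{0..T}. \<forall>k<d n. (l k ^ 3 + l k) * (U (d n) k t)\<^sup>2 + l k * (V (d n) k t)\<^sup>2 \<le> P k \<and>
         (U (d n) k t)\<^sup>2 + (V (d n) k t)\<^sup>2 \<le> Q k)" if T: "0 \<le> T" for T
  proof -
    obtain B P Q where P: "\<forall>k. 0 \<le> P k \<and> 0 \<le> Q k"
        "\<forall>r\<ge>0. summable (\<lambda>k. P k * exp (r * \<phi> (l k)))" "summable Q"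
      and PQ: "\<forall>\<mu> N U V. admissible \<mu> \<longrightarrow> galerkin_solution \<mu> l a b N T U V \<longrightarrow>
      (\<forall>x\<in>{0..T}. \<forall>y\<in>{0..T}. \<bar>stiffness l N U x - stiffness l N U y\<bar> \<le> B * \<bar>x - y\<bar>) \<and>
      (\<forall>t\<in>{0..T}. \<forall>k<N. (l k ^ 3 + l k) * (U k t)\<^sup>2 + l k * (V k t)\<^sup>2 \<le> P k \<and>
         (U k t)\<^sup>2 + (V k t)\<^sup>2 \<le> Q k)"
      using a_priori[OF T] by (elim exE conjE) (rule that)
    have large: "T \<le> real (d n)" if "nat \<lceil>T\<rceil> \<le> n" for n
    proof -
      have "T \<le> real n" using that by linarith
      then show ?thesis using dn[of n] by linarith
    qed
    show ?thesis
    proof (rule exI[of _ P], rule exI[of _ Q], intro conjI allI impI ballI)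
      fix n t k assume n: "nat \<lceil>T\<rceil> \<le> n" and t: "t \<in> {0..T}" and k: "k < d n"
      note b = PQ[THEN spec, THEN spec, THEN spec, THEN spec, THEN mp, OF adm, THEN mp,
          OF sol[OF large[OF n]], THEN conjunct2, THEN bspec, OF t, THEN spec, THEN mp, OF k]
      show "(l k ^ 3 + l k) * (U (d n) k t)\<^sup>2 + l k * (V (d n) k t)\<^sup>2 \<le> P k"
        "(U (d n) k t)\<^sup>2 + (V (d n) k t)\<^sup>2 \<le> Q k"
        using b by (rule conjunct1, rule conjunct2)
    qed (use P in simp_all)
  qed
  have ev_large: "\<forall>\<^sub>F n in sequentially. nat \<lceil>T\<rceil> \<le> n \<and> k < d n" for T k
  proof (rule eventually_sequentiallyI)
    show "nat \<lceil>T\<rceil> \<le> n \<and> k < d n" if "nat \<lceil>T\<rceil> + Suc k \<le> n" for n using that dn[of n] by auto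
  qed
  have limit_bounds: "\<exists>P Q. (\<forall>r\<ge>0. summable (\<lambda>k. P k * exp (r * \<phi> (l k)))) \<and> summable Q \<and>
      (\<forall>t\<in>{0..T}. \<forall>k. (l k ^ 3 + l k) * (u k t)\<^sup>2 + l k * (v k t)\<^sup>2 \<le> P k \<and>
         (u k t)\<^sup>2 + (v k t)\<^sup>2 \<le> Q k)" if T: "0 \<le> T" for T
  proof -
    obtain P Q where P: "\<forall>r\<ge>0. summable (\<lambda>k. P k * exp (r * \<phi> (l k)))" "summable Q"
      and PQ: "\<forall>n\<ge>nat \<lceil>T\<rceil>. \<forall>t\<in>{0..T}. \<forall>k<d n.
        (l k ^ 3 + l k) * (U (d n) k t)\<^sup>2 + l k * (V (d n) k t)\<^sup>2 \<le> P k \<and>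
         (U (d n) k t)\<^sup>2 + (V (d n) k t)\<^sup>2 \<le> Q k"
      using bounds[OF T] by (elim exE conjE) (rule that)
    have "(l k ^ 3 + l k) * (u k t)\<^sup>2 + l k * (v k t)\<^sup>2 \<le> P k \<and> (u k t)\<^sup>2 + (v k t)\<^sup>2 \<le> Q k"
      if t: "t \<in> {0..T}" for t k
    proof -
      have t0: "0 \<le> t" using t by simp
      have "(\<lambda>n. (l k ^ 3 + l k) * (U (d n) k t)\<^sup>2 + l k * (V (d n) k t)\<^sup>2) \<longlonglongrightarrow>
          (l k ^ 3 + l k) * (u k t)\<^sup>2 + l k * (v k t)\<^sup>2"
        by (intro tendsto_intros conv t0)
      then have 1: "(l k ^ 3 + l k) * (u k t)\<^sup>2 + l k * (v k t)\<^sup>2 \<le> P k"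
        by (rule tendsto_upperbound[OF _ eventually_mono[OF ev_large[of T k]]]) (use PQ t in auto)
      have "(\<lambda>n. (U (d n) k t)\<^sup>2 + (V (d n) k t)\<^sup>2) \<longlonglongrightarrow> (u k t)\<^sup>2 + (v k t)\<^sup>2"
        by (intro tendsto_intros conv t0)
      then have 2: "(u k t)\<^sup>2 + (v k t)\<^sup>2 \<le> Q k"
        by (rule tendsto_upperbound[OF _ eventually_mono[OF ev_large[of T k]]]) (use PQ t in auto)
      show ?thesis using 1 2 by simp
    qed
    note bd = this
    show ?thesis by (rule exI[of _ P], rule exI[of _ Q]) (use P bd in simp)
  qed
  \<comment> \<open>The number of modes grows with \<open>n\<close>, so the finite sums are extended
    by 0 to series, dominated by \<open>P k + Q k\<close> through the interpolation
    \<open>l2_le\<close>.\<close>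
  have s_eq: "s t = (\<Sum>k. (l k)\<^sup>2 * (u k t)\<^sup>2)" if t0: "0 \<le> t" for t
  proof -
    obtain P Q where P0: "\<And>k. 0 \<le> P k" "\<And>k. 0 \<le> Q k"
      and P: "\<forall>r\<ge>0. summable (\<lambda>k. P k * exp (r * \<phi> (l k)))" "summable Q"
      and PQ: "\<forall>n\<ge>nat \<lceil>t\<rceil>. \<forall>x\<in>{0..t}. \<forall>k<d n.
        (l k ^ 3 + l k) * (U (d n) k x)\<^sup>2 + l k * (V (d n) k x)\<^sup>2 \<le> P k \<and>
         (U (d n) k x)\<^sup>2 + (V (d n) k x)\<^sup>2 \<le> Q k"
    proof -
      from bounds[OF t0] obtain P Q where "\<forall>k. 0 \<le> P k \<and> 0 \<le> Q k"
        "\<forall>r\<ge>0. summable (\<lambda>k. P k * exp (r * \<phi> (l k)))" "summable Q"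
        "\<forall>n\<ge>nat \<lceil>t\<rceil>. \<forall>x\<in>{0..t}. \<forall>k<d n.
        (l k ^ 3 + l k) * (U (d n) k x)\<^sup>2 + l k * (V (d n) k x)\<^sup>2 \<le> P k \<and>
         (U (d n) k x)\<^sup>2 + (V (d n) k x)\<^sup>2 \<le> Q k"
        by (elim exE conjE) (rule that)
      then show thesis by (intro that[of P Q]) simp_all
    qed
    define f where "f k n = (if k < d n then (l k)\<^sup>2 * (U (d n) k t)\<^sup>2 else 0)" for k n
    have "(\<lambda>n. \<Sum>k. f k n) \<longlonglongrightarrow> (\<Sum>k. (l k)\<^sup>2 * (u k t)\<^sup>2)"
    proof (rule tendsto_suminf_dominated)
      fix k
      have "(\<lambda>n. (l k)\<^sup>2 * (U (d n) k t)\<^sup>2) \<longlonglongrightarrow> (l k)\<^sup>2 * (u k t)\<^sup>2"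
        by (intro tendsto_intros conv t0)
      then show "f k \<longlonglongrightarrow> (l k)\<^sup>2 * (u k t)\<^sup>2"
        by (rule Lim_transform_eventually)
          (rule eventually_mono[OF ev_large[of t k]], simp add: f_def)
    next
      show "\<forall>\<^sub>F n in sequentially. \<forall>k. \<bar>f k n\<bar> \<le> P k + Q k"
      proof (rule eventually_sequentiallyI[of "nat \<lceil>t\<rceil>"], rule allI)
        fix n k assume n: "nat \<lceil>t\<rceil> \<le> n"
        show "\<bar>f k n\<bar> \<le> P k + Q k"
        proof (cases "k < d n")
          case True
          let ?x = "(U (d n) k t)\<^sup>2"
          have "(l k)\<^sup>2 * ?x \<le> (1 + l k ^ 3) * ?x" by (intro mult_right_mono l2_le) auto
          moreover have "0 \<le> l k * ?x" "0 \<le> l k * (V (d n) k t)\<^sup>2" "0 \<le> (V (d n) k t)\<^sup>2"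
            using l[of k] by auto
          moreover have "(l k ^ 3 + l k) * ?x + l k * (V (d n) k t)\<^sup>2 \<le> P k"
            "?x + (V (d n) k t)\<^sup>2 \<le> Q k"
            using PQ n True t0 by auto
          ultimately have "(l k)\<^sup>2 * ?x \<le> P k + Q k"
            unfolding distrib_right by linarith
          then show ?thesis using True by (simp add: f_def)
        qed (use P0[of k] in \<open>simp add: f_def\<close>)
      qed
      show "summable (\<lambda>k. P k + Q k)"
        using P(1)[rule_format, of 0] P(2) by (intro summable_add) auto
    qed simp
    moreover have "(\<Sum>k. f k n) = S (d n) t" for n
      unfolding S_def stiffness_def
      by (subst suminf_finite[of "{..<d n}"]) (auto simp: f_def)
    ultimately show ?thesis using LIMSEQ_unique[OF ptw[OF t0]] by simp
  qed
  have c_eq: "c t = m (\<Sum>j. (l j)\<^sup>2 * (u j t)\<^sup>2)" if "0 \<le> t" for t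
    using s_eq[OF that] by (simp add: c_def)
  have "continuous_on {0..} (\<lambda>t. m (\<Sum>j. (l j)\<^sup>2 * (u j t)\<^sup>2))"
    using cc by (rule continuous_on_eq) (simp add: c_eq)
  then show ?thesis
    using ini u' v' limit_bounds c_eq by (intro exI[of _ u] exI[of _ v]) auto
qed

end

section \<open>Synthesis in the Hilbert space\<close>

lemma rpow_simps:
  assumes "0 \<le> x"
  shows "rpow x 1 = x" "rpow x 2 = x\<^sup>2" "rpow x 3 = x ^ 3"
  using assms by (auto simp: rpow_def powr_numeral dest: le_imp_less_or_eq)

section \<open>Orthonormal expansions and Gevrey norms\<close>

locale orthonormal_basis =
  fixes e :: "nat \<Rightarrow> 'h::{real_inner, complete_space}"
  assumes on: "\<And>j k. e j \<bullet> e k = (if j = k then 1 else 0)"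
    and dense: "closure (span (range e)) = UNIV"
begin

lemma sum_inner: "(\<Sum>k\<in>A. c k *\<^sub>R e k) \<bullet> e j = (if j \<in> A then c j else 0)" if "finite A"
  using that by (simp add: inner_sum_left on if_distrib[of "\<lambda>x. _ * x"] cong: if_cong)

lemma norm_sum_square: "(norm (\<Sum>k\<in>A. c k *\<^sub>R e k))\<^sup>2 = (\<Sum>k\<in>A. (c k)\<^sup>2)" if "finite A"
proof -
  let ?S = "\<Sum>k\<in>A. c k *\<^sub>R e k"
  have "x \<bullet> ?S = (\<Sum>k\<in>A. c k * (x \<bullet> e k))" for x by (simp add: inner_sum_right)
  from this[of ?S] have "?S \<bullet> ?S = (\<Sum>k\<in>A. (c k)\<^sup>2)"
    using that by (simp add: sum_inner power2_eq_square)
  then show ?thesis by (simp only: power2_norm_eq_inner)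
qed

text \<open>A vector orthogonal to all \<open>e k\<close> is orthogonal to the closure of their
  span, hence to itself.\<close>

lemma eqI: "u = v" if "\<And>k. u \<bullet> e k = v \<bullet> e k"
proof -
  let ?w = "u - v"
  have "span (range e) \<subseteq> {x. ?w \<bullet> x = 0}"
    by (rule span_minimal[OF _ subspace_hyperplane]) (use that in \<open>auto simp: inner_diff_left\<close>)
  then have "closure (span (range e)) \<subseteq> {x. ?w \<bullet> x = 0}"
    by (rule closure_minimal) (rule closed_hyperplane)
  then have "?w \<bullet> ?w = 0" using dense by blast
  then show ?thesis by simp
qed

text \<open>The Riesz-Fischer theorem: the partial sums form a Cauchy sequence, and completeness of
  the space provides the limit.\<close>

lemma synthesis:
  assumes c: "summable (\<lambda>k. (c k)\<^sup>2)"
  shows "(\<Sum>k. c k *\<^sub>R e k) \<bullet> e j = c j"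
    and "(norm (\<Sum>k. c k *\<^sub>R e k))\<^sup>2 = (\<Sum>k. (c k)\<^sup>2)"
proof -
  let ?p = "\<lambda>n. \<Sum>k<n. c k *\<^sub>R e k" and ?q = "\<lambda>n. \<Sum>k<n. (c k)\<^sup>2"
  have q: "?q \<longlonglongrightarrow> (\<Sum>k. (c k)\<^sup>2)" by (rule summable_LIMSEQ[OF c])
  have diff: "(norm (?p n - ?p m))\<^sup>2 = ?q n - ?q m" if "m < n" for m n
  proof -
    have "?p n - ?p m = (\<Sum>k\<in>{..<n} - {..<m}. c k *\<^sub>R e k)"
      using that by (subst sum_diff) auto
    moreover have "?q n - ?q m = (\<Sum>k\<in>{..<n} - {..<m}. (c k)\<^sup>2)"
      using that by (subst sum_diff) auto
    ultimately show ?thesis by (simp add: norm_sum_square)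
  qed
  have "Cauchy ?p"
  proof (rule metric_CauchyI)
    fix d :: real assume d: "0 < d"
    then obtain M where M: "\<And>m n. m \<ge> M \<Longrightarrow> n \<ge> M \<Longrightarrow> dist (?q m) (?q n) < d\<^sup>2"
      using LIMSEQ_imp_Cauchy[OF q] unfolding Cauchy_def by (meson zero_less_power)
    have *: "dist (?p m) (?p n) < d" if "m \<ge> M" "n \<ge> M" "m < n" for m n
    proof -
      have "(norm (?p n - ?p m))\<^sup>2 < d\<^sup>2"
        using M[OF that(1,2)] diff[OF that(3)] by (simp add: dist_real_def)
      then have "norm (?p n - ?p m) < d" using d by (simp add: power2_less_imp_less)
      then show ?thesis by (simp add: dist_norm norm_minus_commute)
    qed
    show "\<exists>M. \<forall>m\<ge>M. \<forall>n\<ge>M. dist (?p m) (?p n) < d"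
    proof (intro exI[of _ M] allI impI)
      fix m n assume mn: "M \<le> m" "M \<le> n"
      show "dist (?p m) (?p n) < d"
        using *[of m n] *[of n m] mn d by (cases m n rule: linorder_cases) (auto simp: dist_commute)
    qed
  qed
  then obtain u where u: "?p \<longlonglongrightarrow> u" using Cauchy_convergent unfolding convergent_def by blast
  then have eq: "(\<Sum>k. c k *\<^sub>R e k) = u" by (simp add: sums_def sums_unique[symmetric])
  have "(\<lambda>n. ?p n \<bullet> e j) \<longlonglongrightarrow> u \<bullet> e j" by (intro tendsto_intros u)
  moreover have "\<forall>\<^sub>F n in sequentially. ?p n \<bullet> e j = c j"
    by (rule eventually_sequentiallyI[of "Suc j"]) (simp add: sum_inner)
  then have "(\<lambda>n. ?p n \<bullet> e j) \<longlonglongrightarrow> c j" by (rule tendsto_eventually)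
  ultimately show "(\<Sum>k. c k *\<^sub>R e k) \<bullet> e j = c j" unfolding eq by (rule LIMSEQ_unique)
  have "(\<lambda>n. (norm (?p n))\<^sup>2) \<longlonglongrightarrow> (norm u)\<^sup>2" by (intro tendsto_intros u)
  then have "?q \<longlonglongrightarrow> (norm u)\<^sup>2" by (simp add: norm_sum_square)
  then show "(norm (\<Sum>k. c k *\<^sub>R e k))\<^sup>2 = (\<Sum>k. (c k)\<^sup>2)" unfolding eq using q by (rule LIMSEQ_unique)
qed

lemma parseval: "(norm u)\<^sup>2 = (\<Sum>k. (u \<bullet> e k)\<^sup>2)"
proof -
  have s: "summable (\<lambda>k. (u \<bullet> e k)\<^sup>2)" by (rule bessel_summable[OF on])
  have "u = (\<Sum>k. (u \<bullet> e k) *\<^sub>R e k)" by (rule eqI) (simp add: synthesis(1)[OF s])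
  then show ?thesis using synthesis(2)[OF s] by simp
qed

text \<open>Dominated convergence in both series of the norm. It reduces continuity of the solution
  and of its derivative, and differentiability in the Gevrey spaces, to single components plus a
  bound independent of \<open>s\<close>.\<close>

lemma gevrey_norm_tendsto_0:
  fixes x :: "'a \<Rightarrow> 'h"
  assumes x: "\<And>k. ((\<lambda>s. x s \<bullet> e k) \<longlongrightarrow> 0) F" and F: "F \<noteq> bot"
    and M: "\<forall>\<^sub>F s in F. \<forall>k. (x s \<bullet> e k)\<^sup>2 \<le> B k \<and> rpow (lam k) (4 * \<alpha>) * (x s \<bullet> e k)\<^sup>2 \<le> G k"
    and M1: "summable B" and M2: "summable (\<lambda>k. G k * exp (r * \<phi> (lam k)))"
  shows "((\<lambda>s. gevrey_norm e lam \<phi> r \<alpha> (x s)) \<longlongrightarrow> 0) F"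
proof -
  have z: "((\<lambda>s. c * (x s \<bullet> e k)\<^sup>2 * d) \<longlongrightarrow> 0) F" for k c d
    using tendsto_mult[OF tendsto_mult[OF tendsto_const[of c] tendsto_power[OF x[of k], of 2]]
        tendsto_const[of d]] by simp
  have "((\<lambda>s. \<Sum>k. (x s \<bullet> e k)\<^sup>2) \<longlongrightarrow> (\<Sum>k. 0)) F"
  proof (rule tendsto_suminf_dominated[OF _ _ M1 F])
    show "((\<lambda>s. (x s \<bullet> e k)\<^sup>2) \<longlongrightarrow> 0) F" for k using z[of 1 k 1] by simp
    show "\<forall>\<^sub>F s in F. \<forall>k. \<bar>(x s \<bullet> e k)\<^sup>2\<bar> \<le> B k" by (rule eventually_mono[OF M]) auto
  qed
  then have 1: "((\<lambda>s. (norm (x s))\<^sup>2) \<longlongrightarrow> 0) F" by (simp add: parseval)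
  have 2: "((\<lambda>s. \<Sum>k. gevrey_term e lam \<phi> r \<alpha> (x s) k) \<longlongrightarrow> (\<Sum>k. 0)) F"
  proof (rule tendsto_suminf_dominated[OF _ _ M2 F])
    show "((\<lambda>s. gevrey_term e lam \<phi> r \<alpha> (x s) k) \<longlongrightarrow> 0) F" for k
      unfolding gevrey_term_def by (rule z)
    show "\<forall>\<^sub>F s in F. \<forall>k. \<bar>gevrey_term e lam \<phi> r \<alpha> (x s) k\<bar> \<le> G k * exp (r * \<phi> (lam k))"
      by (rule eventually_mono[OF M]) (simp add: gevrey_term_nonneg, simp add: gevrey_term_def)
  qed
  have "((\<lambda>s. gevrey_norm e lam \<phi> r \<alpha> (x s)) \<longlongrightarrow> sqrt (0 + (\<Sum>k. 0))) F"
    unfolding gevrey_norm_def by (rule tendsto_real_sqrt[OF tendsto_add[OF 1 2]])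
  then show ?thesis by simp
qed

lemma kirchhoff_solution_exists:
  assumes data: "kirchhoff_data (\<lambda>k. u0 \<bullet> e k) (\<lambda>k. u1 \<bullet> e k) lam \<omega> m \<phi> \<rho> L \<nu> p"
  shows "\<exists>u. kirchhoff_global_solution e lam m u0 u1 u \<and>
     (\<forall>r>0. u \<in> C1_gevrey e lam \<phi> r (1/4) \<inter> C0_gevrey e lam \<phi> r (3/4))"
proof -
  interpret kirchhoff_data "\<lambda>k. u0 \<bullet> e k" "\<lambda>k. u1 \<bullet> e k" lam \<omega> m \<phi> \<rho> L \<nu> p by (rule data)
  obtain U V where sol: "\<forall>k. U k 0 = u0 \<bullet> e k \<and> V k 0 = u1 \<bullet> e k"
    "\<forall>k. \<forall>t\<ge>0. (U k has_real_derivative V k t) (at t within {0..}) \<and>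
       (V k has_real_derivative - (m (\<Sum>j. (lam j)\<^sup>2 * (U j t)\<^sup>2) * (lam k)\<^sup>2 * U k t)) (at t within {0..})"
    and c: "continuous_on {0..} (\<lambda>t. m (\<Sum>j. (lam j)\<^sup>2 * (U j t)\<^sup>2))"
    and PQ: "\<forall>T\<ge>0. \<exists>P Q. (\<forall>r\<ge>0. summable (\<lambda>k. P k * exp (r * \<phi> (lam k)))) \<and> summable Q \<and>
      (\<forall>t\<in>{0..T}. \<forall>k. (lam k ^ 3 + lam k) * (U k t)\<^sup>2 + lam k * (V k t)\<^sup>2 \<le> P k \<and>
         (U k t)\<^sup>2 + (V k t)\<^sup>2 \<le> Q k)"
    using mode_solution by (elim exE conjE) (rule that)
  have ini: "U k 0 = u0 \<bullet> e k" "V k 0 = u1 \<bullet> e k" for k using sol(1) by simp_all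
  have U': "(U k has_real_derivative V k t) (at t within {0..})"
    and V': "(V k has_real_derivative - (m (\<Sum>j. (lam j)\<^sup>2 * (U j t)\<^sup>2) * (lam k)\<^sup>2 * U k t))
      (at t within {0..})" if "0 \<le> t" for k t
    using sol(2) that by simp_all
  have bounds: "\<exists>P Q. (\<forall>r\<ge>0. summable (\<lambda>k. P k * exp (r * \<phi> (lam k)))) \<and> summable Q \<and>
      (\<forall>t\<in>{0..T}. \<forall>k. lam k ^ 3 * (U k t)\<^sup>2 \<le> P k \<and> lam k * (U k t)\<^sup>2 \<le> P k \<and>
         lam k * (V k t)\<^sup>2 \<le> P k \<and> (U k t)\<^sup>2 \<le> Q k \<and> (V k t)\<^sup>2 \<le> Q k)" if "0 \<le> T" for T
  proof -
    obtain P Q where P: "\<forall>r\<ge>0. summable (\<lambda>k. P k * exp (r * \<phi> (lam k)))" "summable Q"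
      and b: "\<forall>t\<in>{0..T}. \<forall>k. (lam k ^ 3 + lam k) * (U k t)\<^sup>2 + lam k * (V k t)\<^sup>2 \<le> P k \<and>
         (U k t)\<^sup>2 + (V k t)\<^sup>2 \<le> Q k" using PQ[rule_format, OF \<open>0 \<le> T\<close>] by (elim exE conjE) (rule that)
    have "lam k ^ 3 * (U k t)\<^sup>2 \<le> P k \<and> lam k * (U k t)\<^sup>2 \<le> P k \<and>
         lam k * (V k t)\<^sup>2 \<le> P k \<and> (U k t)\<^sup>2 \<le> Q k \<and> (V k t)\<^sup>2 \<le> Q k" if t: "t \<in> {0..T}" for t k
    proof -
      have nn: "0 \<le> lam k ^ 3 * (U k t)\<^sup>2" "0 \<le> lam k * (U k t)\<^sup>2" "0 \<le> lam k * (V k t)\<^sup>2"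
        "0 \<le> (U k t)\<^sup>2" "0 \<le> (V k t)\<^sup>2" using l[of k] by auto
      have b1: "(lam k ^ 3 + lam k) * (U k t)\<^sup>2 + lam k * (V k t)\<^sup>2 \<le> P k"
        and b2: "(U k t)\<^sup>2 + (V k t)\<^sup>2 \<le> Q k" using b t by blast+
      show ?thesis using nn b1 b2 unfolding distrib_right by (intro conjI; linarith)
    qed
    then show ?thesis using P by blast
  qed
  have sU: "summable (\<lambda>k. (U k t)\<^sup>2)" and sV: "summable (\<lambda>k. (V k t)\<^sup>2)" if t: "0 \<le> t" for t
  proof -
    obtain Q where "summable Q" "\<forall>k. (U k t)\<^sup>2 \<le> Q k \<and> (V k t)\<^sup>2 \<le> Q k"
    proof -
      obtain P Q where Q: "summable Q" and b: "\<forall>s\<in>{0..t}. \<forall>k. lam k ^ 3 * (U k s)\<^sup>2 \<le> P k \<and>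
         lam k * (U k s)\<^sup>2 \<le> P k \<and> lam k * (V k s)\<^sup>2 \<le> P k \<and> (U k s)\<^sup>2 \<le> Q k \<and> (V k s)\<^sup>2 \<le> Q k"
        using bounds[OF t] by (elim exE conjE) (rule that)
      show thesis by (rule that[OF Q]) (use b \<open>0 \<le> t\<close> in auto)
    qed
    then show "summable (\<lambda>k. (U k t)\<^sup>2)" "summable (\<lambda>k. (V k t)\<^sup>2)"
      by (auto intro!: summable_comparison_test'[of Q 0])
  qed
  define u where "u t = (\<Sum>k. U k t *\<^sub>R e k)" for t
  define v where "v t = (\<Sum>k. V k t *\<^sub>R e k)" for t
  have u: "u t \<bullet> e k = U k t" and v: "v t \<bullet> e k = V k t" if "0 \<le> t" for t k
    unfolding u_def v_def by (rule synthesis(1)[OF sU[OF that]], rule synthesis(1)[OF sV[OF that]])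
  have nb: "at t within {0..} \<noteq> bot" if "0 \<le> t" for t :: real
  proof
    assume "at t within {0..} = bot"
    moreover have "at_right t \<le> at t within {0..}" using that by (intro at_le) auto
    ultimately show False using trivial_limit_at_right_real[of t] by (simp add: bot_unique)
  qed
  \<comment> \<open>The bounds are uniform on compact time intervals only, so \<open>s\<close> is
    kept below \<open>t + 1\<close>.\<close>
  have near: "\<forall>\<^sub>F s in at t within {0..}. s \<in> {0..t+1} \<and> s \<noteq> t" if "0 \<le> t" for t :: real
    unfolding eventually_at by (rule exI[of _ 1]) (auto simp: dist_real_def)
  have sq: "(x - y)\<^sup>2 \<le> 2 * x\<^sup>2 + 2 * y\<^sup>2" for x y :: real
    using zero_le_power2[of "x + y"] by (simp add: power2_eq_square algebra_simps)
  have sq': "g * (x - y)\<^sup>2 \<le> 4 * M" if "g * x\<^sup>2 \<le> M" "g * y\<^sup>2 \<le> M" "0 \<le> g" for g x y M :: real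
  proof -
    have "g * (x - y)\<^sup>2 \<le> g * (2 * x\<^sup>2 + 2 * y\<^sup>2)" by (intro mult_left_mono sq that)
    also have "\<dots> = 2 * (g * x\<^sup>2) + 2 * (g * y\<^sup>2)" by (simp add: algebra_simps)
    finally show ?thesis using that by linarith
  qed
  have lam0: "0 \<le> lam k ^ 3" for k using l[of k] by simp
  have r3: "rpow (lam k) (4 * (3/4)) = lam k ^ 3" and r1: "rpow (lam k) (4 * (1/4)) = lam k" for k
    using rpow_simps[OF l[of k]] by auto
  have tU: "((\<lambda>s. U k s) \<longlongrightarrow> U k t) (at t within {0..})" if "0 \<le> t" for t k
    using DERIV_continuous[OF U'[OF that]] by (simp add: continuous_within)
  have tV: "((\<lambda>s. V k s) \<longlongrightarrow> V k t) (at t within {0..})" if "0 \<le> t" for t k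
    using DERIV_continuous[OF V'[OF that]] by (simp add: continuous_within)
  have in_gevrey: "u t \<in> gevrey e lam \<phi> r (3/4)" "u t \<in> gevrey e lam \<phi> r (1/4)" "v t \<in> gevrey e lam \<phi> r (1/4)"
    if t: "0 \<le> t" and r: "0 < r" for t r
  proof -
    obtain P Q where P: "\<forall>r\<ge>0. summable (\<lambda>k. P k * exp (r * \<phi> (lam k)))"
      and b: "\<forall>s\<in>{0..t}. \<forall>k. lam k ^ 3 * (U k s)\<^sup>2 \<le> P k \<and> lam k * (U k s)\<^sup>2 \<le> P k \<and>
         lam k * (V k s)\<^sup>2 \<le> P k \<and> (U k s)\<^sup>2 \<le> Q k \<and> (V k s)\<^sup>2 \<le> Q k"
      using bounds[OF t] by (elim exE conjE) (rule that)
    have P': "summable (\<lambda>k. P k * exp (r * \<phi> (lam k)))" using P r by simp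
    have b': "lam k ^ 3 * (U k t)\<^sup>2 \<le> P k" "lam k * (U k t)\<^sup>2 \<le> P k" "lam k * (V k t)\<^sup>2 \<le> P k" for k
      using b t by auto
    show "u t \<in> gevrey e lam \<phi> r (3/4)" "u t \<in> gevrey e lam \<phi> r (1/4)" "v t \<in> gevrey e lam \<phi> r (1/4)"
      unfolding gevrey_def mem_Collect_eq gevrey_term_def[abs_def] r3 r1 u[OF t] v[OF t]
      by (rule summable_comparison_test'[OF P', of 0]; use b' l lam0 in \<open>simp add: abs_mult\<close>)+
  qed
  have C0u: "u \<in> C0_gevrey e lam \<phi> r (3/4)" and C0v: "v \<in> C0_gevrey e lam \<phi> r (1/4)"
    and C1: "((\<lambda>s. gevrey_norm e lam \<phi> r (1/4) ((u s - u t) /\<^sub>R (s - t) - v t)) \<longlongrightarrow> 0) (at t within {0..})"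
    if r: "0 < r" and t: "0 \<le> t" for r t
  proof -
    have *: "((\<lambda>s. gevrey_norm e lam \<phi> r (3/4) (u s - u t)) \<longlongrightarrow> 0) (at t within {0..}) \<and>
      ((\<lambda>s. gevrey_norm e lam \<phi> r (1/4) (v s - v t)) \<longlongrightarrow> 0) (at t within {0..}) \<and>
      ((\<lambda>s. gevrey_norm e lam \<phi> r (1/4) ((u s - u t) /\<^sub>R (s - t) - v t)) \<longlongrightarrow> 0) (at t within {0..})"
      if t: "0 \<le> t" for t
    proof -
      obtain P Q where P: "\<forall>r\<ge>0. summable (\<lambda>k. P k * exp (r * \<phi> (lam k)))" and Q: "summable Q"
        and b: "\<forall>s\<in>{0..t+1}. \<forall>k. lam k ^ 3 * (U k s)\<^sup>2 \<le> P k \<and> lam k * (U k s)\<^sup>2 \<le> P k \<and>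
           lam k * (V k s)\<^sup>2 \<le> P k \<and> (U k s)\<^sup>2 \<le> Q k \<and> (V k s)\<^sup>2 \<le> Q k"
      proof -
        have "0 \<le> t + 1" using t by simp
        from bounds[OF this] show thesis by (elim exE conjE) (rule that)
      qed
      have 4: "summable (\<lambda>k. 4 * Q k)" "summable (\<lambda>k. (4 * P k) * exp (r * \<phi> (lam k)))"
        using P Q r summable_mult[of "\<lambda>k. P k * exp (r * \<phi> (lam k))" 4]
        by (auto intro: summable_mult simp: mult.assoc)
      have bs: "lam k ^ 3 * (U k s)\<^sup>2 \<le> P k" "lam k * (V k s)\<^sup>2 \<le> P k" "1 * (U k s)\<^sup>2 \<le> Q k" "1 * (V k s)\<^sup>2 \<le> Q k"
        if "s \<in> {0..t+1}" for s k using b that by auto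
      have tt: "t \<in> {0..t+1}" using t by simp
      \<comment> \<open>Mean value inequality: the difference quotients of \<open>U k\<close>
        inherit the bound on \<open>V k\<close>, with weight \<open>g\<close> equal to 1 or
        \<open>lam k\<close>. The derivative is bounded by \<open>sqrt (M / g)\<close>, so
        \<open>g = 0\<close> is treated apart.\<close>
      have quot: "g * ((U k s - U k t) / (s - t))\<^sup>2 \<le> M"
        if g: "0 \<le> g" and gM: "\<And>x. x \<in> {0..t+1} \<Longrightarrow> g * (V k x)\<^sup>2 \<le> M" and s: "s \<in> {0..t+1}" "s \<noteq> t"
        for g M k s
      proof (cases "g = 0")
        case True
        then show ?thesis using gM[OF tt] by simp
      next
        case False
        with g have g0: "0 < g" by simp
        have M0: "0 \<le> M / g" using gM[OF tt] g0
          by (meson divide_nonneg_pos mult_nonneg_nonneg order_trans zero_le_power2 g)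
        have "norm (U k s - U k t) \<le> sqrt (M / g) * norm (s - t)"
        proof (rule field_differentiable_bound[of "{0..t+1}" "U k" "V k"])
          show "(U k has_field_derivative V k x) (at x within {0..t+1})" if "x \<in> {0..t+1}" for x
            using that by (intro DERIV_subset[OF U']) auto
          show "norm (V k x) \<le> sqrt (M / g)" if "x \<in> {0..t+1}" for x
            using gM[OF that] g0 by (auto intro!: real_le_rsqrt simp: field_simps)
        qed (use s t in auto)
        then have "(norm (U k s - U k t))\<^sup>2 \<le> (sqrt (M / g) * norm (s - t))\<^sup>2"
          by (intro power_mono) auto
        then have "(U k s - U k t)\<^sup>2 \<le> M / g * (s - t)\<^sup>2"
          using M0 by (simp add: power_mult_distrib)
        then show ?thesis using g0 s by (simp add: power_divide field_simps)
      qed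
      have 1: "((\<lambda>s. gevrey_norm e lam \<phi> r (3/4) (u s - u t)) \<longlongrightarrow> 0) (at t within {0..})"
      proof (rule gevrey_norm_tendsto_0[where B = "\<lambda>k. 4 * Q k" and G = "\<lambda>k. 4 * P k"
            and \<phi> = \<phi> and lam = lam, OF _ nb[OF t] _ 4])
        fix k
        have "((\<lambda>s. U k s - U k t) \<longlongrightarrow> U k t - U k t) (at t within {0..})" by (intro tendsto_intros tU t)
        then have "((\<lambda>s. U k s - U k t) \<longlongrightarrow> 0) (at t within {0..})" by simp
        then show "((\<lambda>s. (u s - u t) \<bullet> e k) \<longlongrightarrow> 0) (at t within {0..})"
          by (rule Lim_transform_eventually)
            (rule eventually_mono[OF near[OF t]], auto simp: inner_diff_left u t)
      next
        show "\<forall>\<^sub>F s in at t within {0..}. \<forall>k. ((u s - u t) \<bullet> e k)\<^sup>2 \<le> 4 * Q k \<and>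
            rpow (lam k) (4 * (3/4)) * ((u s - u t) \<bullet> e k)\<^sup>2 \<le> 4 * P k"
        proof (rule eventually_mono[OF near[OF t]], intro allI conjI)
          fix s k assume s: "s \<in> {0..t+1} \<and> s \<noteq> t"
          then have e: "(u s - u t) \<bullet> e k = U k s - U k t" using t by (simp add: inner_diff_left u)
          have "1 * (U k s - U k t)\<^sup>2 \<le> 4 * Q k" using s by (intro sq' bs tt) auto
          then show "((u s - u t) \<bullet> e k)\<^sup>2 \<le> 4 * Q k" unfolding e by simp
          show "rpow (lam k) (4 * (3/4)) * ((u s - u t) \<bullet> e k)\<^sup>2 \<le> 4 * P k"
            unfolding e r3 using s by (intro sq' bs tt lam0) auto
        qed
      qed
      have 2: "((\<lambda>s. gevrey_norm e lam \<phi> r (1/4) (v s - v t)) \<longlongrightarrow> 0) (at t within {0..})"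
      proof (rule gevrey_norm_tendsto_0[where B = "\<lambda>k. 4 * Q k" and G = "\<lambda>k. 4 * P k"
            and \<phi> = \<phi> and lam = lam, OF _ nb[OF t] _ 4])
        fix k
        have "((\<lambda>s. V k s - V k t) \<longlongrightarrow> V k t - V k t) (at t within {0..})" by (intro tendsto_intros tV t)
        then have "((\<lambda>s. V k s - V k t) \<longlongrightarrow> 0) (at t within {0..})" by simp
        then show "((\<lambda>s. (v s - v t) \<bullet> e k) \<longlongrightarrow> 0) (at t within {0..})"
          by (rule Lim_transform_eventually)
            (rule eventually_mono[OF near[OF t]], auto simp: inner_diff_left v t)
      next
        show "\<forall>\<^sub>F s in at t within {0..}. \<forall>k. ((v s - v t) \<bullet> e k)\<^sup>2 \<le> 4 * Q k \<and>
            rpow (lam k) (4 * (1/4)) * ((v s - v t) \<bullet> e k)\<^sup>2 \<le> 4 * P k"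
        proof (rule eventually_mono[OF near[OF t]], intro allI conjI)
          fix s k assume s: "s \<in> {0..t+1} \<and> s \<noteq> t"
          then have e: "(v s - v t) \<bullet> e k = V k s - V k t" using t by (simp add: inner_diff_left v)
          have "1 * (V k s - V k t)\<^sup>2 \<le> 4 * Q k" using s by (intro sq' bs tt) auto
          then show "((v s - v t) \<bullet> e k)\<^sup>2 \<le> 4 * Q k" unfolding e by simp
          show "rpow (lam k) (4 * (1/4)) * ((v s - v t) \<bullet> e k)\<^sup>2 \<le> 4 * P k"
            unfolding e r1 using s by (intro sq' bs tt l) auto
        qed
      qed
      have 3: "((\<lambda>s. gevrey_norm e lam \<phi> r (1/4) ((u s - u t) /\<^sub>R (s - t) - v t)) \<longlongrightarrow> 0) (at t within {0..})"
      proof (rule gevrey_norm_tendsto_0[where B = "\<lambda>k. 4 * Q k" and G = "\<lambda>k. 4 * P k"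
            and \<phi> = \<phi> and lam = lam, OF _ nb[OF t] _ 4])
        fix k
        have "((\<lambda>s. (U k s - U k t) / (s - t)) \<longlongrightarrow> V k t) (at t within {0..})"
          using U'[OF t, of k] by (simp add: has_field_derivative_iff)
        then have "((\<lambda>s. (U k s - U k t) / (s - t) - V k t) \<longlongrightarrow> 0) (at t within {0..})"
          by (simp add: LIM_zero_iff)
        then show "((\<lambda>s. ((u s - u t) /\<^sub>R (s - t) - v t) \<bullet> e k) \<longlongrightarrow> 0) (at t within {0..})"
          by (rule Lim_transform_eventually)
            (rule eventually_mono[OF near[OF t]], auto simp: inner_diff_left u v t divide_inverse mult.commute)
      next
        show "\<forall>\<^sub>F s in at t within {0..}. \<forall>k. (((u s - u t) /\<^sub>R (s - t) - v t) \<bullet> e k)\<^sup>2 \<le> 4 * Q k \<and>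
            rpow (lam k) (4 * (1/4)) * (((u s - u t) /\<^sub>R (s - t) - v t) \<bullet> e k)\<^sup>2 \<le> 4 * P k"
        proof (rule eventually_mono[OF near[OF t]], intro allI conjI)
          fix s k assume s: "s \<in> {0..t+1} \<and> s \<noteq> t"
          then have e: "((u s - u t) /\<^sub>R (s - t) - v t) \<bullet> e k = (U k s - U k t) / (s - t) - V k t"
            using t by (simp add: inner_diff_left u v divide_inverse mult.commute)
          have "1 * ((U k s - U k t) / (s - t) - V k t)\<^sup>2 \<le> 4 * Q k"
            using s by (intro sq' quot bs tt) auto
          then show "(((u s - u t) /\<^sub>R (s - t) - v t) \<bullet> e k)\<^sup>2 \<le> 4 * Q k"
            unfolding e by simp
          show "rpow (lam k) (4 * (1/4)) * (((u s - u t) /\<^sub>R (s - t) - v t) \<bullet> e k)\<^sup>2 \<le> 4 * P k"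
            unfolding e r1 using s by (intro sq' quot bs tt l) auto
        qed
      qed
      show ?thesis using 1 2 3 by blast
    qed
    show "u \<in> C0_gevrey e lam \<phi> r (3/4)" "v \<in> C0_gevrey e lam \<phi> r (1/4)"
      unfolding C0_gevrey_def using * in_gevrey r by blast+
    show "((\<lambda>s. gevrey_norm e lam \<phi> r (1/4) ((u s - u t) /\<^sub>R (s - t) - v t)) \<longlongrightarrow> 0) (at t within {0..})"
      using *[OF t] by blast
  qed
  have reg: "u \<in> C1_gevrey e lam \<phi> r (1/4) \<inter> C0_gevrey e lam \<phi> r (3/4)" if r: "0 < r" for r
    using C0u[OF r order_refl] C0v[OF r order_refl] C1[OF r] in_gevrey(2)[OF _ r]
    unfolding C1_gevrey_def by blast
  have stiff: "(norm (op_pow e lam (1/2) (u t)))\<^sup>2 = (\<Sum>j. (lam j)\<^sup>2 * (U j t)\<^sup>2)"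
    and dom: "u t \<in> dom_pow e lam (1/2)" if t: "0 \<le> t" for t
  proof -
    obtain P Q where P: "\<forall>r\<ge>0. summable (\<lambda>k. P k * exp (r * \<phi> (lam k)))" and Q: "summable Q"
      and b: "\<forall>s\<in>{0..t}. \<forall>k. lam k ^ 3 * (U k s)\<^sup>2 \<le> P k \<and> lam k * (U k s)\<^sup>2 \<le> P k \<and>
         lam k * (V k s)\<^sup>2 \<le> P k \<and> (U k s)\<^sup>2 \<le> Q k \<and> (V k s)\<^sup>2 \<le> Q k"
      using bounds[OF t] by (elim exE conjE) (rule that)
    have s: "summable (\<lambda>k. (lam k)\<^sup>2 * (U k t)\<^sup>2)"
    proof (rule summable_comparison_test'[of "\<lambda>k. Q k + P k" 0])
      show "summable (\<lambda>k. Q k + P k)" using P[rule_format, of 0] Q by (intro summable_add) auto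
      fix k
      have "(lam k)\<^sup>2 * (U k t)\<^sup>2 \<le> (1 + lam k ^ 3) * (U k t)\<^sup>2" by (intro mult_right_mono l2_le) auto
      also have "\<dots> \<le> Q k + P k" using b t by (auto simp: distrib_right intro!: add_mono)
      finally show "norm ((lam k)\<^sup>2 * (U k t)\<^sup>2) \<le> Q k + P k" by simp
    qed
    have r2: "rpow (lam k) (4 * (1/2)) = (lam k)\<^sup>2" "rpow (lam k) (2 * (1/2)) = lam k" for k
      using rpow_simps[OF l[of k]] by auto
    show "u t \<in> dom_pow e lam (1/2)" unfolding dom_pow_def mem_Collect_eq r2 u[OF t] by (rule s)
    have "summable (\<lambda>k. (lam k * U k t)\<^sup>2)" using s by (simp add: power_mult_distrib)
    then show "(norm (op_pow e lam (1/2) (u t)))\<^sup>2 = (\<Sum>j. (lam j)\<^sup>2 * (U j t)\<^sup>2)"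
      unfolding op_pow_def r2 u[OF t] by (simp add: synthesis(2) power_mult_distrib)
  qed
  have u00: "u 0 = u0" by (rule eqI) (simp add: u ini)
  have v00: "v 0 = u1" by (rule eqI) (simp add: v ini)
  have "(u has_vector_derivative u1) (at 0 within {0..})"
    unfolding has_vector_derivative_def has_derivative_iff_norm
  proof
    show "bounded_linear (\<lambda>x. x *\<^sub>R u1)" by (rule bounded_linear_scaleR_left)
    \<comment> \<open>The Gevrey norm dominates the norm of the space, so differentiability at 0 in
      the former, known from \<open>C1\<close>, gives it in the latter.\<close>
    have "\<forall>\<^sub>F s in at 0 within {0..}. norm (norm (u s - u 0 - (s - 0) *\<^sub>R u1) / norm (s - 0)) \<le>
        gevrey_norm e lam \<phi> 1 (1/4) ((u s - u 0) /\<^sub>R (s - 0) - v 0)"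
    proof (rule eventually_mono[OF near[OF order_refl]])
      fix s :: real assume s: "s \<in> {0..0+1} \<and> s \<noteq> 0"
      let ?x = "(u s - u 0) /\<^sub>R (s - 0) - v 0"
      have "?x = (u s - u 0 - (s - 0) *\<^sub>R u1) /\<^sub>R (s - 0)"
        using s by (simp add: v00 scaleR_diff_right)
      then have "norm (norm (u s - u 0 - (s - 0) *\<^sub>R u1) / norm (s - 0)) = norm ?x"
        by (simp add: divide_inverse mult.commute)
      also have "\<dots> \<le> gevrey_norm e lam \<phi> 1 (1/4) ?x"
        using s by (intro norm_le_gevrey_norm gevrey_diff gevrey_scaleR in_gevrey) auto
      finally show "norm (norm (u s - u 0 - (s - 0) *\<^sub>R u1) / norm (s - 0)) \<le>
        gevrey_norm e lam \<phi> 1 (1/4) ?x" .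
    qed
    then show "((\<lambda>s. norm (u s - u 0 - (s - 0) *\<^sub>R u1) / norm (s - 0)) \<longlongrightarrow> 0) (at 0 within {0..})"
      by (rule Lim_null_comparison) (rule C1, auto)
  qed
  moreover have "\<exists>v w.
        (\<forall>t\<ge>0. ((\<lambda>s. u s \<bullet> e k) has_real_derivative v t) (at t within {0..})) \<and>
        (\<forall>t\<ge>0. (v has_real_derivative w t) (at t within {0..})) \<and>
        continuous_on {0..} w \<and>
        (\<forall>t\<ge>0. w t + m ((norm (op_pow e lam (1/2) (u t)))\<^sup>2) * (lam k)\<^sup>2 * (u t \<bullet> e k) = 0)" for k
  proof (rule exI[of _ "V k"],
      rule exI[of _ "\<lambda>t. - (m (\<Sum>j. (lam j)\<^sup>2 * (U j t)\<^sup>2) * (lam k)\<^sup>2 * U k t)"],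
      intro conjI allI impI)
    fix t :: real assume t: "0 \<le> t"
    show "((\<lambda>s. u s \<bullet> e k) has_real_derivative V k t) (at t within {0..})"
      by (rule has_field_derivative_transform_within[OF U'[OF t], of 1]) (use t u in auto)
    show "(V k has_real_derivative - (m (\<Sum>j. (lam j)\<^sup>2 * (U j t)\<^sup>2) * (lam k)\<^sup>2 * U k t)) (at t within {0..})"
      by (rule V'[OF t])
    show "- (m (\<Sum>j. (lam j)\<^sup>2 * (U j t)\<^sup>2) * (lam k)\<^sup>2 * U k t) +
        m ((norm (op_pow e lam (1/2) (u t)))\<^sup>2) * (lam k)\<^sup>2 * (u t \<bullet> e k) = 0"
      by (simp add: stiff[OF t] u[OF t])
  next
    have "continuous_on {0..} (U k)" using U' by (intro DERIV_continuous_on) auto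
    then show "continuous_on {0..} (\<lambda>t. - (m (\<Sum>j. (lam j)\<^sup>2 * (U j t)\<^sup>2) * (lam k)\<^sup>2 * U k t))"
      by (intro continuous_intros c)
  qed
  ultimately have "kirchhoff_global_solution e lam m u0 u1 u"
    unfolding kirchhoff_global_solution_def using dom u00 by blast
  then show ?thesis using reg by blast
qed

end

text \<open>What remains is to read the hypotheses componentwise: the exponents 3/4 and 1/4 give the
  weights \<open>lam k ^ 3\<close> and \<open>lam k\<close>, and the exponents 2 and 3 of the spaces
  of data become \<open>p + 1\<close> with \<open>p = 1\<close> and \<open>p = 2\<close>.\<close>

theorem theorem3p1:
  fixes D :: "'h::{real_inner, complete_space} set"
    and A :: "'h \<Rightarrow> 'h"
    and e :: "nat \<Rightarrow> 'h"
    and lam :: "nat \<Rightarrow> real"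
    and \<omega> m \<phi> :: "real \<Rightarrow> real"
    and \<rho> :: "nat \<Rightarrow> real"
    and u0 u1 :: 'h
  assumes "self_adjoint_operator D A" and "nonnegative_operator D A"
    and "eigenbasis D A e lam"
    and "continuity_modulus \<omega>"
    and "\<forall>x\<ge>0. 0 \<le> m x"
    and "\<exists>L. \<forall>a\<ge>0. \<forall>b\<ge>0. \<bar>m a - m b\<bar> \<le> L * \<omega> \<bar>a - b\<bar>"
    and "\<forall>x\<ge>0. 0 < \<phi> x"
    and "\<rho> \<in> divergent_seqs"
    and "low_frequency_regular e lam \<phi> u0" and "low_frequency_regular e lam \<phi> u1"
    and "((\<exists>\<nu>>0. \<forall>\<sigma>\<ge>0. \<nu> \<le> m \<sigma>) \<and>
          (\<exists>\<Lambda>. \<forall>\<sigma>>0. \<sigma> * \<omega> (1 / \<sigma>) \<le> \<Lambda> * \<phi> \<sigma>) \<and>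
          (u0, u1) \<in> gevrey_M e lam 2 \<phi> \<rho> (3/4) \<times> gevrey_M e lam 2 \<phi> \<rho> (1/4))
       \<or> ((\<forall>\<sigma>\<ge>0. 0 \<le> m \<sigma>) \<and>
          (\<exists>\<Lambda>. \<forall>\<sigma>>0. \<sigma> \<le> \<Lambda> * \<phi> (\<sigma> / sqrt (\<omega> (1 / \<sigma>)))) \<and>
          (u0, u1) \<in> gevrey_M e lam 3 \<phi> \<rho> (3/4) \<times> gevrey_M e lam 3 \<phi> \<rho> (1/4))"
  shows "\<exists>u. kirchhoff_global_solution e lam m u0 u1 u \<and>
             (\<forall>r>0. u \<in> C1_gevrey e lam \<phi> r (1/4) \<inter> C0_gevrey e lam \<phi> r (3/4))"
proof -
  note cm = assms(4)
  interpret orthonormal_basis e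
  proof
    show "e j \<bullet> e k = (if j = k then 1 else 0)" for j k
      using assms(3) by (simp add: eigenbasis_def)
    show "closure (span (range e)) = UNIV" using assms(3) by (simp add: eigenbasis_def)
  qed
  have lam: "0 \<le> lam k" for k using assms(3) by (simp add: eigenbasis_def)
  have phi: "0 < \<phi> x" if "0 \<le> x" for x using assms(7) that by blast
  have rho: "0 < \<rho> n" "filterlim \<rho> at_top sequentially" for n
    using assms(8) by (auto simp: divergent_seqs_def)
  obtain L0 where L0: "\<forall>a\<ge>0. \<forall>b\<ge>0. \<bar>m a - m b\<bar> \<le> L0 * \<omega> \<bar>a - b\<bar>" using assms(6) by blast
  \<comment> \<open>The hypothesis gives no sign for \<open>L0\<close>.\<close>
  define L where "L = \<bar>L0\<bar>"
  have L: "0 \<le> L" by (simp add: L_def)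
  have m_mod: "\<bar>m x - m y\<bar> \<le> L * \<omega> \<bar>x - y\<bar>" if "0 \<le> x" "0 \<le> y" for x y
  proof -
    have "\<bar>m x - m y\<bar> \<le> L0 * \<omega> \<bar>x - y\<bar>" using L0 that by blast
    also have "\<dots> \<le> L * \<omega> \<bar>x - y\<bar>"
      unfolding L_def by (intro mult_right_mono continuity_modulusD(5)[OF cm]) auto
    finally show ?thesis .
  qed
  have r1: "rpow (lam k) (4 * (1/4)) = lam k" and r3: "rpow (lam k) (4 * (3/4)) = lam k ^ 3" for k
    using rpow_simps[OF lam[of k]] by auto
  have low: "(\<lambda>k. lam k * (w \<bullet> e k)\<^sup>2 * exp (r * \<phi> (lam k))) summable_on {k. lam k \<le> R}"
    if "low_frequency_regular e lam \<phi> w" "0 < r" for w r R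
    using that unfolding low_frequency_regular_def gevrey_term_def[abs_def] r1 by blast
  have data: "kirchhoff_data (\<lambda>k. u0 \<bullet> e k) (\<lambda>k. u1 \<bullet> e k) lam \<omega> m \<phi> \<rho> L \<nu> p"
    if nu: "0 \<le> \<nu>" "\<And>x. 0 \<le> x \<Longrightarrow> \<nu> \<le> m x" and p: "p = 2 \<or> p = 1 \<and> 0 < \<nu>"
      and beta: "\<And>n. rpow (\<rho> n) \<beta> = \<rho> n ^ (p + 1)"
      and M0: "u0 \<in> gevrey_M e lam \<beta> \<phi> \<rho> (3/4)" and M1: "u1 \<in> gevrey_M e lam \<beta> \<phi> \<rho> (1/4)"
      and hf: "\<And>C0 T. 0 \<le> C0 \<Longrightarrow> 0 \<le> T \<Longrightarrow>
        \<exists>K0\<ge>0. \<exists>K1\<ge>0. \<exists>R0. high_frequency_estimate \<nu> \<omega> \<phi> L C0 T K0 K1 R0"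
    for \<nu> p \<beta>
  proof (rule kirchhoff_data.intro)
    note H0 = M0[unfolded gevrey_M_def mem_Collect_eq gevrey_term_def[abs_def] r3 beta]
    note H1 = M1[unfolded gevrey_M_def mem_Collect_eq gevrey_term_def[abs_def] r1 beta]
    fix n
    show "(\<lambda>k. lam k ^ 3 * (u0 \<bullet> e k)\<^sup>2 * exp (\<rho> n ^ (p + 1) * \<phi> (lam k))) summable_on {k. lam k > \<rho> n}"
      "(\<Sum>\<^sub>\<infinity>k\<in>{k. lam k > \<rho> n}. lam k ^ 3 * (u0 \<bullet> e k)\<^sup>2 * exp (\<rho> n ^ (p + 1) * \<phi> (lam k))) \<le> \<rho> n"
      using H0[THEN spec, of n] by (rule conjunct1, rule conjunct2)
    show "(\<lambda>k. lam k * (u1 \<bullet> e k)\<^sup>2 * exp (\<rho> n ^ (p + 1) * \<phi> (lam k))) summable_on {k. lam k > \<rho> n}"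
      "(\<Sum>\<^sub>\<infinity>k\<in>{k. lam k > \<rho> n}. lam k * (u1 \<bullet> e k)\<^sup>2 * exp (\<rho> n ^ (p + 1) * \<phi> (lam k))) \<le> \<rho> n"
      using H1[THEN spec, of n] by (rule conjunct1, rule conjunct2)
  next
    fix r R :: real assume "0 < r"
    then show "(\<lambda>k. lam k * (u0 \<bullet> e k)\<^sup>2 * exp (r * \<phi> (lam k))) summable_on {k. lam k \<le> R}"
      "(\<lambda>k. lam k * (u1 \<bullet> e k)\<^sup>2 * exp (r * \<phi> (lam k))) summable_on {k. lam k \<le> R}"
      by (rule low[OF assms(9)], rule low[OF assms(10)])
  next
    show "summable (\<lambda>k. (u0 \<bullet> e k)\<^sup>2)" "summable (\<lambda>k. (u1 \<bullet> e k)\<^sup>2)"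
      by (rule bessel_summable[OF on])+
  qed (rule cm L nu(1) lam phi nu(2) m_mod rho(2) p hf; assumption)+
  have rho2: "rpow (\<rho> n) 2 = \<rho> n ^ (1 + 1)" and rho3: "rpow (\<rho> n) 3 = \<rho> n ^ (2 + 1)" for n
    using rpow_simps[of "\<rho> n"] rho(1)[of n] by (auto simp: power2_eq_square power3_eq_cube)
  from assms(11) show ?thesis
  proof (elim disjE conjE exE)
    fix \<nu> \<Lambda> assume nu: "0 < \<nu>" "\<forall>\<sigma>\<ge>0. \<nu> \<le> m \<sigma>" and Lam: "\<forall>\<sigma>>0. \<sigma> * \<omega> (1 / \<sigma>) \<le> \<Lambda> * \<phi> \<sigma>"
      and M: "(u0, u1) \<in> gevrey_M e lam 2 \<phi> \<rho> (3/4) \<times> gevrey_M e lam 2 \<phi> \<rho> (1/4)"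
    have "kirchhoff_data (\<lambda>k. u0 \<bullet> e k) (\<lambda>k. u1 \<bullet> e k) lam \<omega> m \<phi> \<rho> L \<nu> 1"
    proof (rule data[OF _ _ _ rho2])
      show "\<exists>K0\<ge>0. \<exists>K1\<ge>0. \<exists>R0. high_frequency_estimate \<nu> \<omega> \<phi> L C0 T K0 K1 R0"
        if "0 \<le> C0" "0 \<le> T" for C0 T
        by (rule high_frequency_estimate_strict[where \<Lambda> = \<Lambda>, OF cm nu(1) L that phi])
          (use Lam in simp_all)
    qed (use nu M in \<open>simp_all add: less_imp_le\<close>)
    then show ?thesis by (rule kirchhoff_solution_exists)
  next
    fix \<Lambda> assume m0: "\<forall>\<sigma>\<ge>0. 0 \<le> m \<sigma>" and Lam: "\<forall>\<sigma>>0. \<sigma> \<le> \<Lambda> * \<phi> (\<sigma> / sqrt (\<omega> (1 / \<sigma>)))"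
      and M: "(u0, u1) \<in> gevrey_M e lam 3 \<phi> \<rho> (3/4) \<times> gevrey_M e lam 3 \<phi> \<rho> (1/4)"
    have "kirchhoff_data (\<lambda>k. u0 \<bullet> e k) (\<lambda>k. u1 \<bullet> e k) lam \<omega> m \<phi> \<rho> L 0 2"
    proof (rule data[OF _ _ _ rho3])
      show "\<exists>K0\<ge>0. \<exists>K1\<ge>0. \<exists>R0. high_frequency_estimate 0 \<omega> \<phi> L C0 T K0 K1 R0"
        if "0 \<le> C0" "0 \<le> T" for C0 T
        by (rule high_frequency_estimate_weak[where \<Lambda> = \<Lambda>, OF cm L that phi])
          (use Lam in simp_all)
    qed (use m0 M in simp_all)
    then show ?thesis by (rule kirchhoff_solution_exists)
  qed
qed

end
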